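(* The relation $E_{K_\sigma}$ is Borel reducible to isomorphism and to complemented embeddability between subspaces of $c_0$. Indeed, there exist a sequence of integers $(K_n)_{n\ge1}$ with $K_n\ge 2$ and a sequence of reals $(p_n)_{n\ge1}$ such that for all $\alpha,\beta\in X_0$ the following statements are equivalent: (1) $\alpha\,H_0\,\beta$; (2) $c_0(\ell_{p_n}^{K_n}(\alpha))\sim c_0(\ell_{p_n}^{K_n}(\beta))$; (3) $c_0(\ell_{p_n}^{K_n}(\alpha))$ and $c_0(\ell_{p_n}^{K_n}(\beta))$ are isomorphic; (4) $c_0(\ell_{p_n}^{K_n}(\alpha))$ is isomorphic to a complemented subspace of $c_0(\ell_{p_n}^{K_n}(\beta))$.
   Context: Borel reducibility: for relations $R$ on $E$ and $R'$ on $E'$ (not necessarily equivalence relations), where $E,E'$ are Polish (or standard Borel) spaces, $(E,R)\le_B(E',R')$ ($R$ is Borel reducible to $R'$) means that there is a Borel map $f:E\to E'$ with $xRy\Leftrightarrow f(x)R'f(y)$ for all $x,y\in E$. $R$ and $R'$ are Borel bireducible if each is Borel reducible to the other. $E_{K_\sigma}$ denotes a $\le_B$-maximum element among $K_\sigma$ equivalence relations on Polish spaces (it exists and is unique up to Borel bireducibility). $X_0=\prod_{n\ge 1} n$, where $n=\{0,1,\dots,n-1\}$, so $\alpha\in X_0$ is a sequence $(\alpha(n))_{n\ge1}$ of integers with $0\le\alpha(n)<n$. The relation $H_0$ on $X_0$ is: $\alpha H_0\beta$ iff there is $N$ such that $|\alpha(k)-\beta(k)|\le N$ for all $k$. By a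 theorem of Rosendal, $H_0$ is Borel bireducible with $E_{K_\sigma}$. The set of closed linear subspaces of a separable Banach space carries the Effros-Borel structure; "Borel reducible to isomorphism (etc.) between subspaces of $Y$" means Borel reducible to the corresponding relation on the (closed) subspaces of $Y$. Isomorphism means linear homeomorphism; complemented embeddability is the relation "$X$ is isomorphic to a complemented subspace of $Y$". For a sequence of integers $(K_n)_{n\ge1}$ with $K_n\ge2$, a sequence $(p_n)_{n\ge1}$ of reals greater than $1$, and $\alpha\in X_0$, $c_0(\ell_{p_n}^{K_n}(\alpha))$ denotes the $c_0$-sum $\big(\sum_{n\ge1}\oplus\,\ell^{K_n}_{p_n+\alpha(n)/\log K_n}\big)_{c_0}$. Here $\ell_q^K$ is $K$-dimensional $\ell_q$ space; the sum has a canonical basis consisting of the vectors $e_{n,i}$ ($n\ge1$, $1\le i\le K_n$), $e_{n,i}$ being the $i$-th unit vector of the $n$-th summand. For two such sums with the same $(K_n)$, $X\sim Y$ means that the canonical bases are equivalent, i.e. the correspondence $e_{n,i}\mapsto e_{n,i}$ extends to a linear isomorphism of $X$ onto $Y$. Every $c_0$-sum of finite-dimensional spaces is isomorphic to a subspace of $c_0$. *)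

theory Defs
  imports "HOL-Analysis.Analysis"
begin

section \<open>Borel reducibility and the relation $E_{K_\sigma}$\<close>

definition polish_topology :: "'a topology \<Rightarrow> bool" where
  "polish_topology X \<longleftrightarrow> completely_metrizable_space X \<and> separable_space X"

definition borel_of_topology :: "'a topology \<Rightarrow> 'a measure" where
  "borel_of_topology X = sigma (topspace X) {U. openin X U}"

definition borel_reducible ::
    "'a measure \<Rightarrow> ('a \<times> 'a) set \<Rightarrow> 'b measure \<Rightarrow> ('b \<times> 'b) set \<Rightarrow> bool" where
  "borel_reducible M R N S \<longleftrightarrow>
     (\<exists>f \<in> measurable M N. \<forall>x\<in>space M. \<forall>y\<in>space M. (x, y) \<in> R \<longleftrightarrow> (f x, f y) \<in> S)"

definition Ksigma_in :: "'a topology \<Rightarrow> 'a set \<Rightarrow> bool" where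
  "Ksigma_in X A \<longleftrightarrow> (\<exists>C :: nat \<Rightarrow> 'a set. (\<forall>n. compactin X (C n)) \<and> A = (\<Union>n. C n))"

definition Ksigma_equiv :: "'a topology \<Rightarrow> ('a \<times> 'a) set \<Rightarrow> bool" where
  "Ksigma_equiv X R \<longleftrightarrow>
     polish_topology X \<and> equiv (topspace X) R \<and> Ksigma_in (prod_topology X X) R"

text \<open>
  \<open>is_E_Ksigma X R\<close>: the relation \<open>R\<close> on \<open>X\<close> is a maximum, for Borel reducibility, among the
  \<open>K\<^sub>\<sigma>\<close> equivalence relations on Polish spaces. Since every Polish space has at most continuum many
  points, it is homeomorphic to a Polish topology on some set of reals; hence it suffices to let
  \<open>Y\<close> range over the topologies carried by arbitrary sets of reals (\<open>topspace Y\<close> need not be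
  \<open>UNIV\<close>, and the topology is not the Euclidean one in general).
\<close>
definition is_E_Ksigma :: "'a topology \<Rightarrow> ('a \<times> 'a) set \<Rightarrow> bool" where
  "is_E_Ksigma X R \<longleftrightarrow> Ksigma_equiv X R \<and>
     (\<forall>(Y :: real topology) S. Ksigma_equiv Y S \<longrightarrow>
        borel_reducible (borel_of_topology Y) S (borel_of_topology X) R)"

section \<open>The relation $H_0$\<close>

definition X0 :: "(nat \<Rightarrow> nat) set" where
  "X0 = (\<Pi>\<^sub>E n\<in>{1..}. {..<n})"

definition H0 :: "((nat \<Rightarrow> nat) \<times> (nat \<Rightarrow> nat)) set" where
  "H0 = {(\<alpha>, \<beta>). \<alpha> \<in> X0 \<and> \<beta> \<in> X0 \<and>
     (\<exists>N::nat. \<forall>k\<ge>1. \<bar>int (\<alpha> k) - int (\<beta> k)\<bar> \<le> int N)}"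

section \<open>Normed spaces given by a carrier and a norm\<close>

text \<open>
  The norm of a \<open>c\<^sub>0\<close>-sum depends on numerical parameters, so normed spaces are
  represented as linear subspaces of a real vector space together with a norm, which need not
  be related to any norm carried by the ambient type.
\<close>
record 'a nspace =
  vecs :: "'a set"
  nrm :: "'a \<Rightarrow> real"

definition bounded_linear_between ::
    "'a::real_vector nspace \<Rightarrow> 'b::real_vector nspace \<Rightarrow> ('a \<Rightarrow> 'b) \<Rightarrow> bool" where
  "bounded_linear_between X Y T \<longleftrightarrow>
     T ` vecs X \<subseteq> vecs Y \<and>
     (\<forall>x\<in>vecs X. \<forall>y\<in>vecs X. T (x + y) = T x + T y) \<and>
     (\<forall>c. \<forall>x\<in>vecs X. T (c *\<^sub>R x) = c *\<^sub>R T x) \<and>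
     (\<exists>C. \<forall>x\<in>vecs X. nrm Y (T x) \<le> C * nrm X x)"

definition isomorphism_between ::
    "'a::real_vector nspace \<Rightarrow> 'b::real_vector nspace \<Rightarrow> ('a \<Rightarrow> 'b) \<Rightarrow> bool" where
  "isomorphism_between X Y T \<longleftrightarrow>
     bij_betw T (vecs X) (vecs Y) \<and>
     bounded_linear_between X Y T \<and>
     bounded_linear_between Y X (inv_into (vecs X) T)"

definition isomorphic_nspaces ::
    "'a::real_vector nspace \<Rightarrow> 'b::real_vector nspace \<Rightarrow> bool" where
  "isomorphic_nspaces X Y \<longleftrightarrow> (\<exists>T. isomorphism_between X Y T)"

definition complemented_subspace :: "'a::real_vector set \<Rightarrow> 'a nspace \<Rightarrow> bool" where
  "complemented_subspace Z Y \<longleftrightarrow>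
     (\<exists>P. bounded_linear_between Y Y P \<and> (\<forall>x\<in>vecs Y. P (P x) = P x) \<and> P ` vecs Y = Z)"

definition complementably_embeds ::
    "'a::real_vector nspace \<Rightarrow> 'b::real_vector nspace \<Rightarrow> bool" where
  "complementably_embeds X Y \<longleftrightarrow>
     (\<exists>Z. complemented_subspace Z Y \<and> isomorphic_nspaces X \<lparr>vecs = Z, nrm = nrm Y\<rparr>)"

section \<open>Closed subspaces and the Effros Borel structure\<close>

definition closed_subspaces :: "'a::real_normed_vector set \<Rightarrow> 'a set set" where
  "closed_subspaces Y = {F. F \<subseteq> Y \<and> subspace F \<and> closed F}"

text \<open>
  As \<open>F \<subseteq> Y\<close>, the generating sets for \<open>U\<close> open in the ambient space are the same as those for
  \<open>U\<close> relatively open in \<open>Y\<close>.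
\<close>
definition Effros_borel :: "'a::real_normed_vector set \<Rightarrow> 'a set measure" where
  "Effros_borel Y = sigma (closed_subspaces Y)
     {{F \<in> closed_subspaces Y. F \<inter> U \<noteq> {}} |U. open U}"

abbreviation as_nspace :: "'a::real_normed_vector set \<Rightarrow> 'a nspace" where
  "as_nspace F \<equiv> \<lparr>vecs = F, nrm = norm\<rparr>"

definition isomorphism_rel :: "'a::real_normed_vector set \<Rightarrow> ('a set \<times> 'a set) set" where
  "isomorphism_rel Y = {(F, G). F \<in> closed_subspaces Y \<and> G \<in> closed_subspaces Y \<and>
     isomorphic_nspaces (as_nspace F) (as_nspace G)}"

definition complemented_embed_rel :: "'a::real_normed_vector set \<Rightarrow> ('a set \<times> 'a set) set" where
  "complemented_embed_rel Y = {(F, G). F \<in> closed_subspaces Y \<and> G \<in> closed_subspaces Y \<and>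
     complementably_embeds (as_nspace F) (as_nspace G)}"

section \<open>The space $c_0$ and $c_0$-sums of finite-dimensional $\ell_q$ spaces\<close>

text \<open>Since \<open>nat\<close> is discrete, \<open>nat \<Rightarrow>\<^sub>C real\<close> is $\ell_\infty$ with the supremum norm.\<close>
definition c0 :: "(nat \<Rightarrow>\<^sub>C real) set" where
  "c0 = {x. apply_bcontfun x \<longlonglongrightarrow> 0}"

definition lq_norm :: "nat \<Rightarrow> real \<Rightarrow> (nat \<Rightarrow> real) \<Rightarrow> real" where
  "lq_norm K q v = (\<Sum>i=1..K. \<bar>v i\<bar> powr q) powr (1 / q)"

text \<open>
  The \<open>c\<^sub>0\<close>-sum, over \<open>n \<ge> 1\<close>, of the spaces $\ell_{q_n}^{K_n}$. Its vectors are bounded functions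
  on \<open>nat \<times> nat\<close> (a discrete space) supported on the pairs \<open>(n, i)\<close> with \<open>n \<ge> 1\<close> and
  \<open>1 \<le> i \<le> K n\<close>; the supremum norm of the ambient type plays no role.
\<close>
definition c0_sum_lq :: "(nat \<Rightarrow> nat) \<Rightarrow> (nat \<Rightarrow> real) \<Rightarrow> ((nat \<times> nat) \<Rightarrow>\<^sub>C real) nspace" where
  "c0_sum_lq K q =
     \<lparr>vecs = {x. (\<forall>n i. \<not> (1 \<le> n \<and> 1 \<le> i \<and> i \<le> K n) \<longrightarrow> apply_bcontfun x (n, i) = 0) \<and>
                 (\<lambda>n. lq_norm (K n) (q n) (\<lambda>i. apply_bcontfun x (n, i))) \<longlonglongrightarrow> 0},
      nrm = (\<lambda>x. SUP n\<in>{1..}. lq_norm (K n) (q n) (\<lambda>i. apply_bcontfun x (n, i)))\<rparr>"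

definition c0_lp :: "(nat \<Rightarrow> nat) \<Rightarrow> (nat \<Rightarrow> real) \<Rightarrow> (nat \<Rightarrow> nat) \<Rightarrow> ((nat \<times> nat) \<Rightarrow>\<^sub>C real) nspace" where
  "c0_lp K p \<alpha> = c0_sum_lq K (\<lambda>n. p n + real (\<alpha> n) / ln (real (K n)))"

definition basis_vec :: "nat \<Rightarrow> nat \<Rightarrow> ((nat \<times> nat) \<Rightarrow>\<^sub>C real)" where
  "basis_vec n i = Bcontfun (\<lambda>m. if m = (n, i) then 1 else 0)"

lemma apply_basis_vec: "apply_bcontfun (basis_vec n i) m = (if m = (n, i) then 1 else 0)"
proof -
  have o: "open {z}" for z :: "nat \<times> nat"
    using open_Times[OF open_discrete[of "{fst z}"] open_discrete[of "{snd z}"]] by simp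
  have c: "continuous_on UNIV f" for f :: "nat \<times> nat \<Rightarrow> real"
    unfolding continuous_on_eq_continuous_within continuous_within
    by (simp add: at_within_def nhds_discrete_open[OF o])
  have "(\<lambda>m. if m = (n, i) then 1 else 0 :: real) \<in> bcontfun"
    by (rule bcontfun_normI[where b = 1]) (auto simp: c)
  then show ?thesis
    unfolding basis_vec_def by (simp add: Bcontfun_inverse)
qed

definition canonical_bases_equivalent ::
    "(nat \<Rightarrow> nat) \<Rightarrow> ((nat \<times> nat) \<Rightarrow>\<^sub>C real) nspace \<Rightarrow> ((nat \<times> nat) \<Rightarrow>\<^sub>C real) nspace \<Rightarrow> bool" where
  "canonical_bases_equivalent K X Y \<longleftrightarrow>
     (\<exists>T. isomorphism_between X Y T \<and>
        (\<forall>n i. 1 \<le> n \<and> 1 \<le> i \<and> i \<le> K n \<longrightarrow> T (basis_vec n i) = basis_vec n i))"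

end

theory Submission
  imports Defs
begin

text \<open>
  The first half of the theorem needs one direction of Rosendal's theorem: every $K_\sigma$
  equivalence relation $R$ reduces to $H_0$. Write $R$ as the union of compact symmetric sets
  $F_0 \subseteq F_1 \subseteq \dots$ with $F_n \circ F_n \subseteq F_{n+1}$. The least $n$ with
  $(x,y) \in F_n$ then behaves like a distance between $x$ and $y$, infinite exactly when $x$ and $y$
  are inequivalent. The distances of $x$ to the members of a countable family of closed sets,
  truncated at every level, are the entries of a point of $X_0$; equivalent points have entries at
  bounded distance by the triangle inequality, and inequivalent ones do not, because the $F_n$ are
  closed (lemma \<open>Ksigma_equiv_reduces_to_H0\<close>).

  For the second half take $p_n = 2 + 1/n$ and $K_n = 2^{1000 n^3}$, and write $X_\alpha$ for the
  $c_0$-sum with the exponents $p_n + \alpha(n)/\ln K_n$. If $|\alpha(n) - \beta(n)| \le N$, then the two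
  exponents of block $n$ are so close that the norms on $\mathbb{R}^{K_n}$ are equivalent with a constant
  that depends on $N$ only, and the identity is an isomorphism. Conversely, let $X_\alpha$ be
  isomorphic to a complemented subspace of $X_\beta$. Then the identity of $X_\alpha$ factors as $S T$
  through $X_\beta$, with both norms at most some $C$. Restricted to block $n$ of $X_\alpha$ the trace of
  $S T$ is $K_n$; it is the sum of the contributions of the blocks $m$ of $X_\beta$ through which the
  operators pass, and these are estimated separately (lemma \<open>trace_estimate\<close>).

  The blocks $m < n$ contribute at most $C^2$ times their total dimension, which is negligible
  since $K_n$ grows fast. For the other blocks the tool is a quantitative form of Pitt's theorem
  (lemma \<open>few_large_columns\<close>): if $2 \le r < q$, an operator from $\ell_q^K$ to $\ell_r^M$ of norm at most
  $C$ sends at most $(C/\kappa)^{qr/(q-r)}$ unit vectors to vectors of norm greater than $\kappa$, since $\ell_r$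
  has cotype $r$. This number does not depend on the dimensions. If the exponents $q$ and $r$ of the
  two blocks $n$ are far apart on the scale $1/\ln K_n$, it applies to one of the two operators
  between these blocks and makes the contribution of $m = n$ small. For $m > n$ the exponent of block
  $m$ is smaller than that of block $n$ by a gap that depends on $n$ only, so that every $T_m$ has few
  large columns. The small columns contribute little, and the large ones contribute little because
  $S$ maps a $c_0$-sum into $\ell_q^K$ with $q$ finite (lemma \<open>offdiagonal_trace_le\<close>). As the
  contributions add up to $K_n$, the exponents of the blocks $n$ are close, with a bound that depends
  on $C$ only; this says $\alpha \mathrel{H_0} \beta$ (lemma \<open>factorization_imp_H0\<close>).

  To pass to subspaces of $c_0$, evaluate the vectors of $X_\alpha$ at finitely many functionals of
  each block, taken from a fixed grid that norms the block up to the factor $2$. The range is a closed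
  subspace of $c_0$ isomorphic to $X_\alpha$. Its finitely supported vectors are dense in it, and those
  living on the first $N$ blocks are determined by $\alpha(1), \dots, \alpha(N)$; so the subspace is a Borel
  function of $\alpha$ (lemma \<open>copy_measurable\<close>).
\<close>

section \<open>Reducing $K_\sigma$ equivalence relations to $H_0$\<close>

text \<open>
  The composition is a projection of the part of $A \times B$ on which the two middle coordinates
  agree, and this part is closed in $A \times B$ because the space is Hausdorff.
\<close>
lemma compactin_relcomp:
  assumes X: "Hausdorff_space X"
    and A: "compactin (prod_topology X X) A" and B: "compactin (prod_topology X X) B"
  shows "compactin (prod_topology X X) (A O B)"
proof -
  let ?XX = "prod_topology X X"
  define E where "E = {z \<in> topspace (prod_topology ?XX ?XX). snd (fst z) = fst (snd z)}"
  have proj: "continuous_map (prod_topology ?XX ?XX) X (\<lambda>z. fst (fst z))"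
      "continuous_map (prod_topology ?XX ?XX) X (\<lambda>z. snd (fst z))"
      "continuous_map (prod_topology ?XX ?XX) X (\<lambda>z. fst (snd z))"
      "continuous_map (prod_topology ?XX ?XX) X (\<lambda>z. snd (snd z))"
    using continuous_map_compose[OF continuous_map_fst[of ?XX ?XX] continuous_map_fst[of X X]]
      continuous_map_compose[OF continuous_map_fst[of ?XX ?XX] continuous_map_snd[of X X]]
      continuous_map_compose[OF continuous_map_snd[of ?XX ?XX] continuous_map_fst[of X X]]
      continuous_map_compose[OF continuous_map_snd[of ?XX ?XX] continuous_map_snd[of X X]]
    by (simp_all add: o_def)
  have "closedin (prod_topology ?XX ?XX) E"
    unfolding E_def by (rule closedin_continuous_maps_eq[OF X proj(2,3)])
  moreover have "compactin (prod_topology ?XX ?XX) (A \<times> B)"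
    using A B by (simp add: compactin_Times)
  ultimately have "compactin (prod_topology ?XX ?XX) (E \<inter> A \<times> B)"
    by (rule closed_Int_compactin)
  moreover have "continuous_map (prod_topology ?XX ?XX) ?XX (\<lambda>z. (fst (fst z), snd (snd z)))"
    by (intro continuous_map_pairedI proj)
  ultimately have "compactin ?XX ((\<lambda>z. (fst (fst z), snd (snd z))) ` (E \<inter> A \<times> B))"
    by (rule image_compactin)
  moreover have "(\<lambda>z. (fst (fst z), snd (snd z))) ` (E \<inter> A \<times> B) = A O B"
  proof (intro equalityI subsetI)
    fix u assume "u \<in> A O B"
    then obtain a b c where u: "u = (a, c)" "(a, b) \<in> A" "(b, c) \<in> B" by auto
    then have "((a, b), (b, c)) \<in> E \<inter> A \<times> B"
      using compactin_subset_topspace[OF A] compactin_subset_topspace[OF B] by (auto simp: E_def)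
    then show "u \<in> (\<lambda>z. (fst (fst z), snd (snd z))) ` (E \<inter> A \<times> B)"
      by (rule rev_image_eqI) (simp add: u)
  qed (auto simp: E_def)
  ultimately show ?thesis by simp
qed

lemma compactin_converse:
  assumes "compactin (prod_topology X X) A"
  shows "compactin (prod_topology X X) (A\<inverse>)"
proof -
  have "continuous_map (prod_topology X X) (prod_topology X X) (\<lambda>z. (snd z, fst z))"
    by (intro continuous_map_pairedI continuous_map_fst continuous_map_snd)
  from image_compactin[OF assms this] show ?thesis
    by (rule back_subst) force
qed

text \<open>
  Squaring the previous set at every step keeps it compact, and transitivity and symmetry of $R$
  keep it inside $R$. The inclusions $F_n \circ F_n \subseteq F_{n+1}$ are a substitute for the
  triangle inequality.
\<close>
lemma Ksigma_equiv_tower: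
  assumes "Ksigma_equiv X R"
  obtains F where "\<And>n::nat. compactin (prod_topology X X) (F n)" "\<And>n. sym (F n)" 
    "\<And>n. F n O F n \<subseteq> F (Suc n)" "\<And>m n. m \<le> n \<Longrightarrow> F m \<subseteq> F n" "R = (\<Union>n. F n)"
proof -
  have haus: "Hausdorff_space X"
    using assms by (auto simp: Ksigma_equiv_def polish_topology_def
        intro: metrizable_imp_Hausdorff_space completely_metrizable_imp_metrizable_space)
  have R: "equiv (topspace X) R"
    using assms by (simp add: Ksigma_equiv_def)
  obtain C where C: "\<And>n::nat. compactin (prod_topology X X) (C n)" "R = (\<Union>n. C n)"
    using assms by (auto simp: Ksigma_equiv_def Ksigma_in_def)
  define F where "F = rec_nat (C 0 \<union> (C 0)\<inverse>) (\<lambda>n A. A \<union> A O A \<union> C (Suc n) \<union> (C (Suc n))\<inverse>)"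
  have F0: "F 0 = C 0 \<union> (C 0)\<inverse>" by (simp add: F_def)
  have FS: "F (Suc n) = F n \<union> F n O F n \<union> C (Suc n) \<union> (C (Suc n))\<inverse>" for n
    by (simp add: F_def)
  have 1: "compactin (prod_topology X X) (F n)" for n
    by (induction n) (simp_all add: F0 FS C haus compactin_Un compactin_converse compactin_relcomp)
  have 2: "sym (F n)" for n
  proof (induction n)
    case 0
    show ?case by (auto simp: F0 sym_def)
  next
    case (Suc n)
    then have "sym (F n O F n)" by (auto simp: sym_conv_converse_eq converse_relcomp)
    with Suc show ?case by (auto simp: FS sym_def)
  qed
  have 3: "F n O F n \<subseteq> F (Suc n)" for n by (auto simp: FS)
  have 4: "F m \<subseteq> F n" if "m \<le> n" for m n
    using that by (rule lift_Suc_mono_le[of F, rotated]) (auto simp: FS)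
  have symR: "R\<inverse> = R" and transR: "R O R \<subseteq> R"
    using R by (simp_all add: equiv_def sym_conv_converse_eq trans_O_subset)
  have CR: "C n \<subseteq> R" "(C n)\<inverse> \<subseteq> R" for n
    using C(2) symR by blast+
  have "F n \<subseteq> R" for n
  proof (induction n)
    case (Suc n)
    then have "F n O F n \<subseteq> R" using transR by blast
    then show ?case using Suc CR[of "Suc n"] by (simp add: FS)
  qed (simp add: F0 CR)
  moreover have "C n \<subseteq> F n" for n by (cases n) (auto simp: F0 FS)
  ultimately have 5: "R = (\<Union>n. F n)" using C(2) by blast
  show ?thesis by (rule that[OF 1 2 3 4 5])
qed

text \<open>
  Closed rather than open basic sets, so that their intersection with a compact set is compact.
\<close>
lemma closed_net_of_polish:
  assumes "polish_topology X"
  obtains C where "\<And>k::nat. closedin X (C k)"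
    "\<And>U y. openin X U \<Longrightarrow> y \<in> U \<Longrightarrow> \<exists>k. y \<in> C k \<and> C k \<subseteq> U"
proof -
  obtain M d where M: "Metric_space M d" "X = Metric_space.mtopology M d"
    using assms by (auto simp: polish_topology_def completely_metrizable_space_def)
  interpret Metric_space M d by fact
  obtain S where S: "countable S" "S \<subseteq> M" "mtopology closure_of S = M"
    using assms by (auto simp: polish_topology_def separable_space_def M)
  define C where "C k = (case prod_decode k of (i, j) \<Rightarrow> mcball (from_nat_into S i) (inverse (real (Suc j))))" for k
  show ?thesis
  proof
    show "closedin X (C k)" for k
      by (simp add: C_def M(2) split: prod.split)
    fix U y assume U: "openin X U" "y \<in> U"
    then obtain r where r: "r > 0" "mball y r \<subseteq> U" and yM: "y \<in> M"
      using openin_mtopology by (metis M(2) subsetD)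
    obtain j where j: "inverse (real (Suc j)) < r / 2"
      using reals_Archimedean[of "r/2"] r by auto
    define e where "e = inverse (real (Suc j))"
    have e: "e > 0" "2 * e < r" using j by (auto simp: e_def)
    have "S \<inter> mball y e \<noteq> {}"
      using S(3) e yM dense_intersects_open[of mtopology S] by (auto simp: )
    then obtain a where a: "a \<in> S" "a \<in> mball y e" by blast
    then obtain i where i: "from_nat_into S i = a"
      using from_nat_into_surj[OF S(1)] by blast
    have Ck: "C (prod_encode (i, j)) = mcball a e" by (simp add: C_def i e_def)
    have "y \<in> mcball a e" using a by (auto simp: commute)
    moreover have "mcball a e \<subseteq> mball y r"
    proof
      fix z assume z: "z \<in> mcball a e"
      then have "d y z \<le> d y a + d a z" using a triangle by auto
      then show "z \<in> mball y r" using z a e by auto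
    qed
    ultimately show "\<exists>k. y \<in> C k \<and> C k \<subseteq> U"
      using r Ck by blast
  qed
qed

text \<open>
  Here \<open>D k j\<close> is the set of points at distance at most \<open>j\<close> from the closed set \<open>C k\<close>. It is the
  projection of a compact set, hence closed. Counting the \<open>j < N\<close> for which $x$ is not in it gives the
  distance truncated at \<open>N\<close>; the coordinate of $X_0$ that codes the pair \<open>(k, N)\<close> exceeds \<open>N\<close>, so that
  the value is admissible there. If $x$ and $y$ are inequivalent then for every $n$ some \<open>C k\<close> around
  $y$ is at distance greater than $n$ from $x$, while its distance from $y$ stays bounded.
\<close>
lemma Ksigma_equiv_reduces_to_H0:
  assumes "Ksigma_equiv X R"
  obtains f where "\<And>x. f x \<in> X0"
    "\<And>n c. 1 \<le> n \<Longrightarrow> {x \<in> topspace X. f x n = c} \<in> sets (borel_of_topology X)"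
    "\<And>x y. x \<in> topspace X \<Longrightarrow> y \<in> topspace X \<Longrightarrow> (x, y) \<in> R \<longleftrightarrow> (f x, f y) \<in> H0"
proof -
  have pol: "polish_topology X" and R: "equiv (topspace X) R"
    using assms by (auto simp: Ksigma_equiv_def)
  then have haus: "Hausdorff_space X"
    by (auto simp: polish_topology_def intro: metrizable_imp_Hausdorff_space
        completely_metrizable_imp_metrizable_space)
  obtain F where F: "\<And>n::nat. compactin (prod_topology X X) (F n)" "\<And>n. sym (F n)" 
    "\<And>n. F n O F n \<subseteq> F (Suc n)" "\<And>m n. m \<le> n \<Longrightarrow> F m \<subseteq> F n" "R = (\<Union>n. F n)"
    using Ksigma_equiv_tower[OF assms] by metis
  obtain C where C: "\<And>k::nat. closedin X (C k)"
    "\<And>U y. openin X U \<Longrightarrow> y \<in> U \<Longrightarrow> \<exists>k. y \<in> C k \<and> C k \<subseteq> U"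
    using closed_net_of_polish[OF pol] by metis
  define D where "D k j = {x. \<exists>z\<in>C k. (x, z) \<in> F j}" for k j
  define f where "f x = (\<lambda>n\<in>{1..}. case prod_decode (n - 1) of (k, N) \<Rightarrow> card {j. j < N \<and> x \<notin> D k j})" for x
  have comp: "(x, z) \<in> F (m + n + 1)" if "(x, y) \<in> F m" "(y, z) \<in> F n" for x y z m n
  proof -
    have "(x, y) \<in> F (m + n)" "(y, z) \<in> F (m + n)"
      using that F(4)[of m "m + n"] F(4)[of n "m + n"] by auto
    then show ?thesis using F(3)[of "m + n"] by auto
  qed
  have Dsets: "topspace X \<inter> D k j \<in> sets (borel_of_topology X)" for k j
  proof -
    have "compactin (prod_topology X X) ((topspace X \<times> C k) \<inter> F j)"
      using C(1) F(1) by (intro closed_Int_compactin) (auto simp: closedin_prod_Times_iff)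
    then have "compactin X (fst ` ((topspace X \<times> C k) \<inter> F j))"
      by (rule image_compactin) (rule continuous_map_fst)
    moreover have "fst ` ((topspace X \<times> C k) \<inter> F j) = topspace X \<inter> D k j"
      by (force simp: D_def image_iff)
    ultimately have "closedin X (topspace X \<inter> D k j)"
      using compactin_imp_closedin[OF haus] by simp
    then have o: "openin X (topspace X - (topspace X \<inter> D k j))" by blast
    have sub: "{U. openin X U} \<subseteq> Pow (topspace X)" by (auto dest: openin_subset)
    have sp: "space (borel_of_topology X) = topspace X"
      using sub by (simp add: borel_of_topology_def space_measure_of)
    have "topspace X - (topspace X \<inter> D k j) \<in> sets (borel_of_topology X)"
      using o sub by (simp add: borel_of_topology_def sets_measure_of sigma_sets.Basic)
    from sets.compl_sets[OF this] show ?thesis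
      by (simp add: sp Diff_Diff_Int Int_absorb1)
  qed
  have fval: "f x (Suc (prod_encode (k, N))) = card {j. j < N \<and> x \<notin> D k j}" for x k N
    by (simp add: f_def)
  have cardle: "card {j. j < N \<and> x \<notin> D k j} \<le> N" for x k N
    using card_mono[of "{..<N}" "{j. j < N \<and> x \<notin> D k j}"] by auto
  have X0: "f x \<in> X0" for x
    unfolding X0_def
  proof (rule PiE_I)
    fix n :: nat assume "n \<in> {1..}"
    then obtain k N where kN: "prod_decode (n - 1) = (k, N)" "n = Suc (prod_encode (k, N))"
      by (metis One_nat_def Suc_diff_1 atLeast_iff less_eq_Suc_le prod.exhaust prod_decode_inverse)
    have "N \<le> prod_encode (k, N)" by (rule le_prod_encode_2)
    with cardle[of N x k] show "f x n \<in> {..<n}" by (simp add: kN fval)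
  qed (auto simp: f_def)
  show ?thesis
  proof
    show "f x \<in> X0" for x by (rule X0)
  next
    fix n c :: nat assume n: "1 \<le> n"
    obtain k N where kN: "prod_decode (n - 1) = (k, N)" by fastforce
    have fx: "f x n = card {j. j < N \<and> x \<notin> D k j}" for x using n kN by (simp add: f_def)
    have "{x \<in> topspace X. f x n = c} =
        (\<Union>J \<in> {J. J \<subseteq> {..<N} \<and> card J = c}. 
          (topspace X - (\<Union>j\<in>J. topspace X \<inter> D k j)) \<inter> (topspace X - (\<Union>j\<in>{..<N} - J. topspace X - (topspace X \<inter> D k j))))"
      (is "?L = (\<Union>J\<in>?JJ. ?A J)")
    proof (intro equalityI subsetI)
      fix x assume "x \<in> ?L"
      then show "x \<in> (\<Union>J\<in>?JJ. ?A J)"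
        by (intro UN_I[of "{j. j < N \<and> x \<notin> D k j}"]) (auto simp: fx)
    next
      fix x assume "x \<in> (\<Union>J\<in>?JJ. ?A J)"
      then obtain J where J: "J \<subseteq> {..<N}" "card J = c" "x \<in> ?A J" by auto
      then have "{j. j < N \<and> x \<notin> D k j} = J" by (auto split: if_splits)
      then show "x \<in> ?L" using J by (auto simp: fx)
    qed
    moreover have "(\<Union>J\<in>?JJ. ?A J) \<in> sets (borel_of_topology X)"
    proof -
      have sub: "{U. openin X U} \<subseteq> Pow (topspace X)" by (auto dest: openin_subset)
      have top: "topspace X \<in> sets (borel_of_topology X)"
        using sub by (simp add: borel_of_topology_def sets_measure_of sigma_sets.Basic)
      have "finite ?JJ" by simp
      moreover have "?A J \<in> sets (borel_of_topology X)" if "J \<in> ?JJ" for J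
      proof -
        have "finite J" using that by (auto intro: finite_subset)
        then have "(\<Union>j\<in>J. topspace X \<inter> D k j) \<in> sets (borel_of_topology X)"
          by (rule sets.finite_UN) (rule Dsets)
        moreover have "(\<Union>j\<in>{..<N} - J. topspace X - (topspace X \<inter> D k j)) \<in> sets (borel_of_topology X)"
          by (rule sets.finite_UN[OF _ sets.Diff[OF top Dsets]]) simp
        ultimately show ?thesis using top by (blast intro: sets.Int sets.Diff)
      qed
      ultimately show ?thesis by (rule sets.finite_UN)
    qed
    ultimately show "{x \<in> topspace X. f x n = c} \<in> sets (borel_of_topology X)" by simp
  next
    fix x y assume x: "x \<in> topspace X" and y: "y \<in> topspace X"
    \<comment> \<open>The triangle inequality for the truncated distances, with the error \<open>1\<close> of \<open>comp\<close>.\<close>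
    have step: "f u n \<le> f v n + (p + 1)" if uv: "(u, v) \<in> F p" and n: "1 \<le> n" for u v p n
    proof -
      obtain k N where kN: "prod_decode (n - 1) = (k, N)" by fastforce
      let ?A = "\<lambda>w. {j. j < N \<and> w \<notin> D k j}"
      have "?A u \<subseteq> {..<p + 1} \<union> (\<lambda>j. j + (p + 1)) ` ?A v"
      proof
        fix j assume j: "j \<in> ?A u"
        show "j \<in> {..<p + 1} \<union> (\<lambda>j. j + (p + 1)) ` ?A v"
        proof (cases "j < p + 1")
          case False
          have "v \<notin> D k (j - (p + 1))"
          proof
            assume "v \<in> D k (j - (p + 1))"
            then obtain z where "z \<in> C k" "(v, z) \<in> F (j - (p + 1))" by (auto simp: D_def)
            moreover have "p + (j - (p + 1)) + 1 = j" using False by simp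
            ultimately have "(u, z) \<in> F j" using comp[OF uv] by metis
            with \<open>z \<in> C k\<close> j show False by (auto simp: D_def)
          qed
          then have "j - (p + 1) \<in> ?A v" using j by auto
          then show ?thesis using False by (auto intro!: image_eqI[of _ _ "j - (p + 1)"])
        qed auto
      qed
      then have "card (?A u) \<le> card ({..<p + 1} \<union> (\<lambda>j. j + (p + 1)) ` ?A v)"
        by (intro card_mono) auto
      also have "\<dots> \<le> (p + 1) + card (?A v)"
        by (rule order_trans[OF card_Un_le]) (auto intro: card_image_le)
      finally show ?thesis using n kN by (simp add: f_def)
    qed
    show "(x, y) \<in> R \<longleftrightarrow> (f x, f y) \<in> H0"
    proof
      assume "(x, y) \<in> R"
      then obtain p where p: "(x, y) \<in> F p" using F(5) by auto
      then have p': "(y, x) \<in> F p" using F(2)[of p] by (auto dest: symD)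
      have "\<bar>int (f x k) - int (f y k)\<bar> \<le> int (p + 1)" if "1 \<le> k" for k
        using step[OF p that] step[OF p' that] by linarith
      then show "(f x, f y) \<in> H0" using X0 unfolding H0_def by blast
    next
      assume H: "(f x, f y) \<in> H0"
      show "(x, y) \<in> R"
      proof (rule ccontr)
        assume xy: "(x, y) \<notin> R"
        obtain B :: nat where B: "\<And>k. 1 \<le> k \<Longrightarrow> \<bar>int (f x k) - int (f y k)\<bar> \<le> int B"
          using H by (auto simp: H0_def)
        have "(y, y) \<in> R" using R y by (auto simp: equiv_def refl_on_def)
        then obtain p where p: "(y, y) \<in> F p" using F(5) by auto
        define n where "n = B + p + 1"
        have "closedin (prod_topology X X) (F n)"
          using haus F(1) by (intro compactin_imp_closedin) (auto simp: Hausdorff_space_prod_topology)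
        then have "openin (prod_topology X X) (topspace (prod_topology X X) - F n)" by blast
        moreover have "(x, y) \<in> topspace (prod_topology X X) - F n" using x y xy F(5) by auto
        ultimately obtain U V where UV: "openin X U" "openin X V" "x \<in> U" "y \<in> V"
          "U \<times> V \<subseteq> topspace (prod_topology X X) - F n"
          unfolding openin_prod_topology_alt by meson
        obtain k where k: "y \<in> C k" "C k \<subseteq> V" using C(2)[OF UV(2,4)] by auto
        have xD: "x \<notin> D k j" if "j \<le> n" for j
          using UV k F(4)[OF that] by (auto simp: D_def)
        have yD: "y \<in> D k j" if "p \<le> j" for j
          using k p F(4)[OF that] by (auto simp: D_def)
        have "{j. j < Suc n \<and> x \<notin> D k j} = {..<Suc n}" using xD by auto
        then have fx: "f x (Suc (prod_encode (k, Suc n))) = Suc n"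
          by (simp add: fval del: lessThan_Suc)
        have "{j. j < Suc n \<and> y \<notin> D k j} \<subseteq> {..<p}" using yD by (auto simp: not_less[symmetric])
        then have "card {j. j < Suc n \<and> y \<notin> D k j} \<le> card {..<p}" by (intro card_mono) auto
        then have fy: "f y (Suc (prod_encode (k, Suc n))) \<le> p" by (simp add: fval)
        show False
          using B[of "Suc (prod_encode (k, Suc n))"] fx fy by (simp add: n_def)
      qed
    qed
  qed
qed

section \<open>The norm of $\ell_q^K$\<close>

lemma lq_norm_nonneg [simp]: "0 \<le> lq_norm K q v"
  by (simp add: lq_norm_def)

lemma lq_norm_powr: "0 < q \<Longrightarrow> lq_norm K q v powr q = (\<Sum>i=1..K. \<bar>v i\<bar> powr q)"
  by (simp add: lq_norm_def powr_powr sum_nonneg)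

lemma lq_norm_le_iff:
  assumes "0 < q" "0 \<le> b"
  shows "lq_norm K q v \<le> b \<longleftrightarrow> (\<Sum>i=1..K. \<bar>v i\<bar> powr q) \<le> b powr q"
  using assms
  by (metis lq_norm_nonneg lq_norm_powr powr_less_mono2 powr_mono2 less_imp_le not_le)

lemma abs_le_lq_norm:
  assumes "0 < q" "i \<in> {1..K}"
  shows "\<bar>v i\<bar> \<le> lq_norm K q v"
proof -
  have "\<bar>v i\<bar> powr q \<le> (\<Sum>i=1..K. \<bar>v i\<bar> powr q)"
    using assms by (intro member_le_sum) auto
  also have "\<dots> = lq_norm K q v powr q" using assms by (simp add: lq_norm_powr)
  finally show ?thesis using assms
    by (metis abs_ge_zero lq_norm_nonneg powr_less_mono2 not_le)
qed

lemma lq_norm_mono: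
  assumes "0 < q" "\<And>i. i \<in> {1..K} \<Longrightarrow> \<bar>u i\<bar> \<le> \<bar>v i\<bar>"
  shows "lq_norm K q u \<le> lq_norm K q v"
  unfolding lq_norm_def using assms
  by (intro powr_mono2 sum_mono sum_nonneg) auto

lemma lq_norm_zero: "(\<And>i. i \<in> {1..K} \<Longrightarrow> v i = 0) \<Longrightarrow> 0 < q \<Longrightarrow> lq_norm K q v = 0"
  by (simp add: lq_norm_def)

lemma lq_norm_cong: "(\<And>i. i \<in> {1..K} \<Longrightarrow> u i = v i) \<Longrightarrow> lq_norm K q u = lq_norm K q v"
  by (simp add: lq_norm_def)

lemma lq_norm_scale: "0 < q \<Longrightarrow> lq_norm K q (\<lambda>i. c * v i) = \<bar>c\<bar> * lq_norm K q v"
  by (simp add: lq_norm_def abs_mult powr_mult sum_nonneg powr_powr flip: sum_distrib_left)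

lemma lq_norm_unit:
  assumes "0 < q" "i \<in> {1..K}"
  shows "lq_norm K q (\<lambda>l. if l = i then c else 0) = \<bar>c\<bar>"
proof -
  have "(\<Sum>l=1..K. \<bar>if l = i then c else 0\<bar> powr q) = (\<Sum>l=1..K. if l = i then \<bar>c\<bar> powr q else 0)"
    using assms by (intro sum.cong) auto
  also have "\<dots> = \<bar>c\<bar> powr q" using assms by simp
  finally show ?thesis using assms by (simp add: lq_norm_def powr_powr)
qed

lemma sum_powr_normalized:
  assumes "0 < q" "lq_norm K q v \<noteq> 0"
  shows "(\<Sum>i=1..K. (\<bar>v i\<bar> / lq_norm K q v) powr q) = 1"
proof -
  have "(\<Sum>i=1..K. (\<bar>v i\<bar> / lq_norm K q v) powr q) = (\<Sum>i=1..K. \<bar>v i\<bar> powr q) / lq_norm K q v powr q"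
    by (simp add: sum_divide_distrib powr_divide)
  also have "\<dots> = 1" using assms(2) by (simp only: lq_norm_powr[OF assms(1), symmetric]) simp
  finally show ?thesis .
qed

text \<open>
  Hoelder's inequality against the constant function, obtained by summing Young's inequality.
\<close>
lemma sum_abs_le_lq_norm:
  assumes "1 < q"
  shows "(\<Sum>i=1..K. \<bar>v i\<bar>) \<le> real K powr (1 - 1/q) * lq_norm K q v"
proof (cases "lq_norm K q v = 0")
  case True
  then have "\<bar>v i\<bar> = 0" if "i \<in> {1..K}" for i
    using abs_le_lq_norm[of q i K v] that assms by simp
  then show ?thesis by simp
next
  case False
  define N where "N = lq_norm K q v"
  have N: "N > 0" using False lq_norm_nonneg[of K q v] by (simp add: N_def order.strict_iff_order)
  have K: "real K > 0" using False assms by (cases K) (auto simp: lq_norm_def)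
  define q' where "q' = q / (q - 1)"
  have q': "q' > 1" "1/q + 1/q' = 1" using assms by (simp_all add: q'_def field_simps)
  have "(\<Sum>i=1..K. (\<bar>v i\<bar> / N * real K powr (1/q)) * 1)
      \<le> (\<Sum>i=1..K. (\<bar>v i\<bar> / N * real K powr (1/q)) powr q / q + 1 powr q' / q')"
    using assms q' N by (intro sum_mono Youngs_inequality) auto
  also have "\<dots> = (\<Sum>i=1..K. \<bar>v i\<bar> powr q * (real K / (q * N powr q))) + real K * (1 / q')"
  proof -
    have "(\<bar>v i\<bar> / N * real K powr (1/q)) powr q / q = \<bar>v i\<bar> powr q * (real K / (q * N powr q))" for i
      using assms N by (simp add: powr_mult powr_divide powr_powr)
    then show ?thesis by (simp add: sum.distrib)
  qed
  also have "(\<Sum>i=1..K. \<bar>v i\<bar> powr q * (real K / (q * N powr q))) = N powr q * (real K / (q * N powr q))"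
    unfolding sum_distrib_right[symmetric] using assms by (simp only: N_def lq_norm_powr)
  also have "\<dots> = real K * (1 / q)" using N by simp
  also have "real K * (1 / q) + real K * (1 / q') = real K"
    unfolding distrib_left[symmetric] q'(2) by simp
  finally have "(\<Sum>i=1..K. \<bar>v i\<bar>) * (real K powr (1/q) / N) \<le> real K"
    by (simp add: sum_distrib_right sum_divide_distrib)
  then have "(\<Sum>i=1..K. \<bar>v i\<bar>) \<le> real K / (real K powr (1/q)) * N"
    using N K by (simp add: field_simps)
  also have "real K / (real K powr (1/q)) = real K powr (1 - 1/q)"
    using K by (simp add: powr_diff)
  finally show ?thesis by (simp add: N_def)
qed

lemma sum_powr_le_card:
  fixes a :: "'a \<Rightarrow> real"
  assumes "finite D" "\<And>i. i \<in> D \<Longrightarrow> 0 \<le> a i" "0 < r"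
  shows "(\<Sum>i\<in>D. a i) powr r \<le> real (card D) powr r * (\<Sum>i\<in>D. a i powr r)"
proof (cases "D = {}")
  case False
  obtain l where l: "l \<in> D" "\<And>i. i \<in> D \<Longrightarrow> a i \<le> a l"
    using finite_has_maximal[of "a ` D"] False assms(1)
    by (metis (no_types, lifting) Max_ge Max_in finite_imageI image_iff image_is_empty)
  have "(\<Sum>i\<in>D. a i) \<le> real (card D) * a l" using sum_bounded_above[of D a "a l"] l by simp
  then have "(\<Sum>i\<in>D. a i) powr r \<le> (real (card D) * a l) powr r"
    using assms by (intro powr_mono2 sum_nonneg) auto
  also have "\<dots> = real (card D) powr r * a l powr r" using assms l by (simp add: powr_mult)
  also have "\<dots> \<le> real (card D) powr r * (\<Sum>i\<in>D. a i powr r)"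
    using assms l by (intro mult_left_mono member_le_sum) auto
  finally show ?thesis .
qed simp

text \<open>
  The square is wasteful, but avoids Minkowski's inequality; only the independence of the dimension
  \<open>M\<close> matters.
\<close>
lemma lq_norm_sum_le_card:
  assumes "finite D" "1 \<le> r" "\<And>i. i \<in> D \<Longrightarrow> lq_norm M r (\<lambda>j. t j i) \<le> C" "0 \<le> C"
  shows "lq_norm M r (\<lambda>j. \<Sum>i\<in>D. \<bar>t j i\<bar>) \<le> (real (card D))\<^sup>2 * C"
proof (cases "D = {}")
  case True
  then show ?thesis using assms by (simp add: lq_norm_zero)
next
  case False
  define n where "n = real (card D)"
  have n: "n \<ge> 1" using False assms(1) by (simp add: n_def Suc_le_eq card_gt_0_iff)
  have "(\<Sum>j=1..M. \<bar>\<Sum>i\<in>D. \<bar>t j i\<bar>\<bar> powr r) \<le> (\<Sum>j=1..M. n powr r * (\<Sum>i\<in>D. \<bar>t j i\<bar> powr r))"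
    using sum_powr_le_card[OF assms(1), of "\<lambda>i. \<bar>t _ i\<bar>" r] assms
    by (intro sum_mono) (auto simp: n_def sum_nonneg)
  also have "\<dots> = n powr r * (\<Sum>i\<in>D. \<Sum>j=1..M. \<bar>t j i\<bar> powr r)"
    by (subst sum.swap) (simp add: sum_distrib_left)
  also have "\<dots> = n powr r * (\<Sum>i\<in>D. lq_norm M r (\<lambda>j. t j i) powr r)"
    using assms by (simp add: lq_norm_powr)
  also have "\<dots> \<le> n powr r * (\<Sum>i\<in>D. C powr r)"
    using assms by (intro mult_left_mono sum_mono powr_mono2) auto
  also have "\<dots> = n powr r * (n * C powr r)" by (simp add: n_def)
  \<comment> \<open>Estimating \<open>n\<close> by \<open>n powr r\<close> costs a factor but makes the bound uniform in \<open>r\<close>.\<close>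
  also have "\<dots> \<le> n powr r * (n powr r * C powr r)"
    using n powr_mono[of 1 r n] assms by (intro mult_left_mono mult_right_mono) auto
  also have "\<dots> = (n\<^sup>2 * C) powr r"
    using n assms by (simp add: powr_mult power2_eq_square)
  finally show ?thesis using assms by (subst lq_norm_le_iff) (auto simp: n_def)
qed

lemma lq_norm_add_le:
  assumes "1 \<le> q"
  shows "lq_norm K q (\<lambda>i. u i + v i) \<le> 4 * max (lq_norm K q u) (lq_norm K q v)"
proof -
  define t where "t i b = (if b then u i else v i)" for i b
  have "lq_norm K q (\<lambda>i. u i + v i) \<le> lq_norm K q (\<lambda>i. \<Sum>b\<in>UNIV. \<bar>t i b\<bar>)"
    using assms by (intro lq_norm_mono) (auto simp: t_def UNIV_bool)
  also have "\<dots> \<le> (real (card (UNIV :: bool set)))\<^sup>2 * max (lq_norm K q u) (lq_norm K q v)"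
  proof (rule lq_norm_sum_le_card)
    show "lq_norm K q (\<lambda>i. t i b) \<le> max (lq_norm K q u) (lq_norm K q v)" for b
      by (cases b) (simp_all add: t_def)
  qed (use assms in \<open>simp_all add: le_max_iff_disj\<close>)
  finally show ?thesis by simp
qed

text \<open>
  For a normalized vector, $u^p \le e^N u^q$ holds for the coordinates $u \ge 1/K$ because
  $K^{|p-q|} \le e^N$, and all the other coordinates together contribute at most $1$.
\<close>
lemma lq_norm_perturb:
  assumes "1 \<le> p" "1 \<le> q" "1 \<le> K" and N: "\<bar>p - q\<bar> * ln (real K) \<le> N"
  shows "lq_norm K p v \<le> (exp N + 1) * lq_norm K q v"
proof (cases "lq_norm K q v = 0")
  case True
  then have "v i = 0" if "i \<in> {1..K}" for i
    using abs_le_lq_norm[of q i K v] that assms(2) by simp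
  then have "lq_norm K p v = 0" using assms(1) by (intro lq_norm_zero) auto
  then show ?thesis using True by simp
next
  case False
  define M where "M = lq_norm K q v"
  have M: "0 < M" using False lq_norm_nonneg[of K q v] by (simp add: M_def order.strict_iff_order)
  have K: "0 < real K" using assms by simp
  have lnK: "0 \<le> ln (real K)" using assms by simp
  have N0: "0 \<le> N" using N lnK by (meson abs_ge_zero mult_nonneg_nonneg order_trans)
  have main: "(\<bar>v i\<bar> / M) powr p \<le> exp N * (\<bar>v i\<bar> / M) powr q + 1 / real K" if i: "i \<in> {1..K}" for i
  proof -
    define u where "u = \<bar>v i\<bar> / M"
    have u: "0 \<le> u" "u \<le> 1"
      using abs_le_lq_norm[of q i K v] i assms(2) M by (simp_all add: u_def M_def)
    have "u powr p \<le> exp N * u powr q + 1 / real K"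
    proof (cases "u < 1 / real K")
      case True
      have "u powr p \<le> u"
      proof (cases "u = 0")
        case False
        then show ?thesis using powr_mono'[of 1 p u] u assms by simp
      qed simp
      also have "\<dots> \<le> 1 / real K" using True by simp
      finally show ?thesis by (simp add: add_increasing)
    next
      case False
      then have u1: "1 / real K \<le> u" by simp
      have u0: "0 < u" using u1 K by (meson divide_pos_pos less_le_trans zero_less_one)
      have lnu: "- ln u \<le> ln (real K)"
      proof -
        have "ln (1 / real K) \<le> ln u" using u1 u0 K by simp
        then show ?thesis using K by (simp add: ln_div)
      qed
      have "ln u \<le> 0" using u u0 by simp
      then have "(p - q) * ln u \<le> \<bar>p - q\<bar> * (- ln u)"
        by (metis abs_ge_self abs_mult abs_of_nonpos)
      also have "\<dots> \<le> \<bar>p - q\<bar> * ln (real K)" using lnu by (intro mult_left_mono) auto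
      also have "\<dots> \<le> N" by (rule N)
      finally have "u powr (p - q) \<le> exp N" using u0 by (simp add: powr_def)
      then have "u powr (p - q) * u powr q \<le> exp N * u powr q" by (intro mult_right_mono) auto
      moreover have "u powr (p - q) * u powr q = u powr p" by (simp flip: powr_add)
      moreover have "0 \<le> 1 / real K" by simp
      ultimately show ?thesis by linarith
    qed
    then show ?thesis by (simp add: u_def)
  qed
  have "(\<Sum>i=1..K. \<bar>v i\<bar> powr p) = M powr p * (\<Sum>i=1..K. (\<bar>v i\<bar> / M) powr p)"
    using M by (simp add: sum_distrib_left powr_divide)
  also have "\<dots> \<le> M powr p * (\<Sum>i=1..K. exp N * (\<bar>v i\<bar> / M) powr q + 1 / real K)"
    using main by (intro mult_left_mono sum_mono) auto
  also have "(\<Sum>i=1..K. exp N * (\<bar>v i\<bar> / M) powr q + 1 / real K) = exp N + 1"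
  proof -
    have *: "(\<Sum>i=1..K. (\<bar>v i\<bar> / M) powr q) = 1"
      unfolding M_def using assms(2) False by (intro sum_powr_normalized) auto
    show ?thesis using K by (simp only: sum.distrib sum_distrib_left[symmetric] *) simp
  qed
  also have "M powr p * (exp N + 1) \<le> M powr p * (exp N + 1) powr p"
    using powr_mono[of 1 p "exp N + 1"] assms(1) by (intro mult_left_mono) auto
  also have "\<dots> = ((exp N + 1) * M) powr p" using M by (simp add: powr_mult)
  finally show ?thesis
    using assms M by (subst lq_norm_le_iff) (auto simp: M_def)
qed

section \<open>Choosing signs\<close>

lemma powr_superadditive:
  fixes x y c :: real
  assumes "1 \<le> c" "0 \<le> x" "0 \<le> y"
  shows "x powr c + y powr c \<le> (x + y) powr c"
proof (cases "x + y = 0")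
  case True
  then have "x = 0" "y = 0" using assms by auto
  then show ?thesis by simp
next
  case False
  have *: "z powr c = z * z powr (c - 1)" if "0 \<le> z" for z :: real
    using that by (cases "z = 0") (auto simp: powr_diff)
  have "x powr c + y powr c = x * x powr (c - 1) + y * y powr (c - 1)"
    using * assms by simp
  also have "\<dots> \<le> x * (x + y) powr (c - 1) + y * (x + y) powr (c - 1)"
    using assms by (intro add_mono mult_left_mono powr_mono2) auto
  also have "\<dots> = (x + y) powr c"
    using *[of "x + y"] assms by (simp add: distrib_right)
  finally show ?thesis .
qed

lemma powr_midpoint_convex:
  fixes u v c :: real
  assumes "1 \<le> c" "0 \<le> u" "0 \<le> v"
  shows "2 * ((u + v) / 2) powr c \<le> u powr c + v powr c"
proof (cases "u = 0 \<or> v = 0")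
  case True
  have *: "2 * (z / 2) powr c \<le> z powr c" if "0 \<le> z" for z :: real
  proof -
    have "(2::real) powr 1 \<le> 2 powr c" using assms by (intro powr_mono) auto
    then have "z powr c * 2 \<le> z powr c * 2 powr c" by (intro mult_left_mono) auto
    then show ?thesis using that by (simp add: powr_divide field_simps)
  qed
  show ?thesis using True *[OF assms(2)] *[OF assms(3)] assms by auto
next
  case False
  then have "u > 0" "v > 0" using assms by auto
  with convex_onD[OF powr_convex[OF assms(1)], of "1/2" u v] show ?thesis
    by (simp add: field_simps)
qed

text \<open>
  The parallelogram law together with convexity and superadditivity of $x \mapsto x^{r/2}$.
\<close>
lemma clarkson_scalar:
  fixes a b r :: real
  assumes "2 \<le> r"
  shows "2 * (\<bar>a\<bar> powr r + \<bar>b\<bar> powr r) \<le> \<bar>a + b\<bar> powr r + \<bar>a - b\<bar> powr r"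
proof -
  have *: "\<bar>z\<bar> powr r = (z\<^sup>2) powr (r / 2)" for z :: real
  proof (cases "z = 0")
    case False
    then have "(z\<^sup>2) powr (r / 2) = (\<bar>z\<bar> powr 2) powr (r / 2)" by simp
    then show ?thesis by (simp add: powr_powr del: powr_numeral)
  qed simp
  have "2 * (\<bar>a\<bar> powr r + \<bar>b\<bar> powr r) \<le> 2 * (a\<^sup>2 + b\<^sup>2) powr (r / 2)"
    unfolding * using assms by (intro mult_left_mono powr_superadditive) auto
  also have "a\<^sup>2 + b\<^sup>2 = ((a + b)\<^sup>2 + (a - b)\<^sup>2) / 2"
    by (simp add: power2_eq_square algebra_simps)
  also have "2 * (((a + b)\<^sup>2 + (a - b)\<^sup>2) / 2) powr (r / 2) \<le> ((a + b)\<^sup>2) powr (r / 2) + ((a - b)\<^sup>2) powr (r / 2)"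
    using assms by (intro powr_midpoint_convex) auto
  finally show ?thesis by (simp add: *)
qed

text \<open>
  This says that $\ell_r$ has cotype $r$ with constant $1$. The signs are chosen one after the other:
  by Clarkson's inequality the average over both choices is large enough at every step.
\<close>
lemma cotype_signs:
  fixes t :: "'j \<Rightarrow> 'i \<Rightarrow> real"
  assumes "finite I" "2 \<le> r"
  shows "\<exists>\<epsilon>. (\<forall>i. \<bar>\<epsilon> i\<bar> = 1) \<and>
    (\<Sum>j\<in>J. \<Sum>i\<in>I. \<bar>t j i\<bar> powr r) \<le> (\<Sum>j\<in>J. \<bar>\<Sum>i\<in>I. \<epsilon> i * t j i\<bar> powr r)"
  using assms(1)
proof (induction I rule: finite_induct)
  case empty
  show ?case by (rule exI[of _ "\<lambda>_. 1"]) simp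
next
  case (insert i I)
  then obtain \<epsilon> :: "'i \<Rightarrow> real" where \<epsilon>: "\<forall>i. \<bar>\<epsilon> i\<bar> = 1"
    "(\<Sum>j\<in>J. \<Sum>i\<in>I. \<bar>t j i\<bar> powr r) \<le> (\<Sum>j\<in>J. \<bar>\<Sum>i\<in>I. \<epsilon> i * t j i\<bar> powr r)"
    by blast
  define X where "X j = (\<Sum>i\<in>I. \<epsilon> i * t j i)" for j
  have upd: "(\<Sum>l\<in>insert i I. (\<epsilon>(i := c)) l * t j l) = X j + c * t j i" for c j
  proof -
    have "(\<Sum>l\<in>I. (\<epsilon>(i := c)) l * t j l) = X j"
      unfolding X_def using insert.hyps by (intro sum.cong) auto
    then show ?thesis using insert.hyps by simp
  qed
  have "2 * (\<Sum>j\<in>J. \<Sum>l\<in>insert i I. \<bar>t j l\<bar> powr r)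
      = 2 * ((\<Sum>j\<in>J. \<Sum>l\<in>I. \<bar>t j l\<bar> powr r) + (\<Sum>j\<in>J. \<bar>t j i\<bar> powr r))"
    using insert.hyps by (simp add: sum.distrib)
  also have "\<dots> \<le> 2 * ((\<Sum>j\<in>J. \<bar>X j\<bar> powr r) + (\<Sum>j\<in>J. \<bar>t j i\<bar> powr r))"
    using \<epsilon>(2) by (simp add: X_def)
  also have "\<dots> = (\<Sum>j\<in>J. 2 * (\<bar>X j\<bar> powr r + \<bar>t j i\<bar> powr r))"
    by (simp add: sum.distrib sum_distrib_left)
  also have "\<dots> \<le> (\<Sum>j\<in>J. \<bar>X j + t j i\<bar> powr r + \<bar>X j - t j i\<bar> powr r)"
    by (intro sum_mono clarkson_scalar assms)
  also have "\<dots> = (\<Sum>j\<in>J. \<bar>X j + t j i\<bar> powr r) + (\<Sum>j\<in>J. \<bar>X j - t j i\<bar> powr r)"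
    by (simp add: sum.distrib)
  finally consider
      "(\<Sum>j\<in>J. \<Sum>l\<in>insert i I. \<bar>t j l\<bar> powr r) \<le> (\<Sum>j\<in>J. \<bar>X j + 1 * t j i\<bar> powr r)"
    | "(\<Sum>j\<in>J. \<Sum>l\<in>insert i I. \<bar>t j l\<bar> powr r) \<le> (\<Sum>j\<in>J. \<bar>X j + (-1) * t j i\<bar> powr r)"
    by fastforce
  then show ?case
  proof cases
    case 1
    then show ?thesis using \<epsilon>(1) unfolding upd[symmetric] by (intro exI[of _ "\<epsilon>(i := 1)"]) auto
  next
    case 2
    then show ?thesis using \<epsilon>(1) unfolding upd[symmetric] by (intro exI[of _ "\<epsilon>(i := -1)"]) auto
  qed
qed

text \<open>
  One choice of signs works for all rows at once because only sums over the rows are compared.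
  A row joins the comparison at the step at which its selected entry is added, when
  $|x + s| + |x - s| \ge 2|s|$; afterwards $|x + s| + |x - s| \ge 2|x|$ preserves what has been gained.
\<close>
lemma selection_signs:
  fixes s :: "'a \<Rightarrow> 'i \<Rightarrow> real"
  assumes "finite I"
  shows "\<exists>\<epsilon>. (\<forall>i. \<bar>\<epsilon> i\<bar> = 1) \<and>
    (\<Sum>a\<in>A. if sel a \<in> I then \<bar>s a (sel a)\<bar> else 0)
      \<le> (\<Sum>a\<in>A. if sel a \<in> I then \<bar>\<Sum>i\<in>I. \<epsilon> i * s a i\<bar> else 0)"
  using assms
proof (induction I rule: finite_induct)
  case empty
  show ?case by (rule exI[of _ "\<lambda>_. 1"]) simp
next
  case (insert i I)
  then obtain \<epsilon> :: "'i \<Rightarrow> real" where \<epsilon>: "\<forall>i. \<bar>\<epsilon> i\<bar> = 1"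
    "(\<Sum>a\<in>A. if sel a \<in> I then \<bar>s a (sel a)\<bar> else 0)
      \<le> (\<Sum>a\<in>A. if sel a \<in> I then \<bar>\<Sum>i\<in>I. \<epsilon> i * s a i\<bar> else 0)"
    by blast
  define X where "X a = (\<Sum>i\<in>I. \<epsilon> i * s a i)" for a
  let ?Y = "\<lambda>c a. if sel a \<in> insert i I then \<bar>X a + c * s a i\<bar> else 0"
  have upd: "(\<Sum>l\<in>insert i I. (\<epsilon>(i := c)) l * s a l) = X a + c * s a i" for c a
  proof -
    have "(\<Sum>l\<in>I. (\<epsilon>(i := c)) l * s a l) = X a"
      unfolding X_def using insert.hyps by (intro sum.cong) auto
    then show ?thesis using insert.hyps by simp
  qed
  have "2 * (\<Sum>a\<in>A. if sel a \<in> insert i I then \<bar>s a (sel a)\<bar> else 0)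
      = 2 * ((\<Sum>a\<in>A. if sel a \<in> I then \<bar>s a (sel a)\<bar> else 0) + (\<Sum>a\<in>A. if sel a = i then \<bar>s a i\<bar> else 0))"
    unfolding sum.distrib[symmetric]
    using insert.hyps by (intro arg_cong2[of _ _ _ _ "(*)"] refl sum.cong) auto
  also have "\<dots> \<le> 2 * ((\<Sum>a\<in>A. if sel a \<in> I then \<bar>X a\<bar> else 0) + (\<Sum>a\<in>A. if sel a = i then \<bar>s a i\<bar> else 0))"
    unfolding X_def by (intro mult_left_mono add_right_mono \<epsilon>(2)) simp
  also have "\<dots> = (\<Sum>a\<in>A. 2 * ((if sel a \<in> I then \<bar>X a\<bar> else 0) + (if sel a = i then \<bar>s a i\<bar> else 0)))"
    by (simp add: sum.distrib sum_distrib_left)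
  also have "\<dots> \<le> (\<Sum>a\<in>A. ?Y 1 a + ?Y (-1) a)"
    using insert.hyps by (intro sum_mono) auto
  also have "\<dots> = (\<Sum>a\<in>A. ?Y 1 a) + (\<Sum>a\<in>A. ?Y (-1) a)"
    by (rule sum.distrib)
  finally consider
      "(\<Sum>a\<in>A. if sel a \<in> insert i I then \<bar>s a (sel a)\<bar> else 0) \<le> (\<Sum>a\<in>A. ?Y 1 a)"
    | "(\<Sum>a\<in>A. if sel a \<in> insert i I then \<bar>s a (sel a)\<bar> else 0) \<le> (\<Sum>a\<in>A. ?Y (-1) a)"
    by fastforce
  then show ?case
  proof cases
    case 1
    then show ?thesis using \<epsilon>(1) unfolding upd[symmetric] by (intro exI[of _ "\<epsilon>(i := 1)"]) auto
  next
    case 2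
    then show ?thesis using \<epsilon>(1) unfolding upd[symmetric] by (intro exI[of _ "\<epsilon>(i := -1)"]) auto
  qed
qed

section \<open>Traces of products of matrices between $\ell_q$ spaces\<close>

text \<open>
  The matrix \<open>t j i\<close>, with row index \<open>j\<close>, has norm at most \<open>C\<close> from $\ell_q^K$ to $\ell_r^M$.
\<close>
definition matrix_bound :: "real \<Rightarrow> nat \<Rightarrow> real \<Rightarrow> nat \<Rightarrow> real \<Rightarrow> (nat \<Rightarrow> nat \<Rightarrow> real) \<Rightarrow> bool" where
  "matrix_bound C K q M r t \<longleftrightarrow>
     (\<forall>x. lq_norm M r (\<lambda>j. \<Sum>i=1..K. t j i * x i) \<le> C * lq_norm K q x)"

lemma matrix_bound_column:
  assumes "matrix_bound C K q M r t" "0 < q" "i \<in> {1..K}"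
  shows "lq_norm M r (\<lambda>j. t j i) \<le> C"
proof -
  have "(\<Sum>l=1..K. t j l * (if l = i then 1 else 0)) = t j i" for j
    using assms(3) by (simp add: if_distrib cong: if_cong)
  then show ?thesis
    using assms(1)[unfolded matrix_bound_def, rule_format, of "\<lambda>l. if l = i then 1 else 0"]
      lq_norm_unit[OF assms(2,3), of 1] by simp
qed

text \<open>
  Let $n$ be the number of these columns. With suitable signs their sum has norm at least
  $\kappa n^{1/r}$ by cotype, and at most $C n^{1/q}$ by boundedness; as $r < q$ this limits $n$.
\<close>
lemma few_large_columns:
  assumes t: "matrix_bound C K q M r t" and r: "2 \<le> r" "r < q" and pos: "0 < C" "0 < \<kappa>"
  shows "real (card {i\<in>{1..K}. \<kappa> < lq_norm M r (\<lambda>j. t j i)}) \<le> (C / \<kappa>) powr (q * r / (q - r))"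
proof -
  define D where "D = {i\<in>{1..K}. \<kappa> < lq_norm M r (\<lambda>j. t j i)}"
  show ?thesis
  proof (cases "D = {}")
    case True
    then have "card D = 0" by simp
    then show ?thesis unfolding D_def[symmetric] by simp
  next
    case False
    have fin: "finite D" and DK: "D \<subseteq> {1..K}" by (auto simp: D_def)
    define n where "n = real (card D)"
    have n: "n > 0" using False fin by (simp add: n_def card_gt_0_iff)
    obtain \<epsilon> :: "nat \<Rightarrow> real" where \<epsilon>: "\<forall>i. \<bar>\<epsilon> i\<bar> = 1"
      "(\<Sum>j=1..M. \<Sum>i\<in>D. \<bar>t j i\<bar> powr r) \<le> (\<Sum>j=1..M. \<bar>\<Sum>i\<in>D. \<epsilon> i * t j i\<bar> powr r)"
      using cotype_signs[OF fin r(1), of t "{1..M}"] by blast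
    define x where "x i = (if i \<in> D then \<epsilon> i else 0)" for i
    have x: "lq_norm K q x = n powr (1 / q)"
    proof -
      have "(\<Sum>i=1..K. \<bar>x i\<bar> powr q) = (\<Sum>i\<in>D. 1)"
        using DK \<epsilon>(1) by (intro sum.mono_neutral_cong_right) (auto simp: x_def)
      then show ?thesis by (simp add: lq_norm_def n_def)
    qed
    have tx: "(\<Sum>i=1..K. t j i * x i) = (\<Sum>i\<in>D. \<epsilon> i * t j i)" for j
      using DK by (intro sum.mono_neutral_cong_right) (auto simp: x_def)
    have "n * \<kappa> powr r = (\<Sum>i\<in>D. \<kappa> powr r)" by (simp add: n_def)
    also have "\<dots> \<le> (\<Sum>i\<in>D. lq_norm M r (\<lambda>j. t j i) powr r)"
      using r pos by (intro sum_mono powr_mono2) (auto simp: D_def)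
    also have "\<dots> = (\<Sum>i\<in>D. \<Sum>j=1..M. \<bar>t j i\<bar> powr r)"
      using r by (simp add: lq_norm_powr)
    also have "\<dots> = (\<Sum>j=1..M. \<Sum>i\<in>D. \<bar>t j i\<bar> powr r)" by (rule sum.swap)
    also have "\<dots> \<le> lq_norm M r (\<lambda>j. \<Sum>i=1..K. t j i * x i) powr r"
      unfolding tx using \<epsilon>(2) r by (simp add: lq_norm_powr)
    also have "\<dots> \<le> (C * n powr (1 / q)) powr r"
      using t[unfolded matrix_bound_def, rule_format, of x] r by (intro powr_mono2) (auto simp: x)
    finally have "(n * \<kappa> powr r) powr (1 / r) \<le> ((C * n powr (1 / q)) powr r) powr (1 / r)"
      using r pos n by (intro powr_mono2) auto
    then have "n powr (1 / r) * \<kappa> \<le> C * n powr (1 / q)"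
      using r pos n by (simp add: powr_mult powr_powr)
    then have "n powr (1 / r) / n powr (1 / q) \<le> C / \<kappa>"
      using n pos by (simp add: field_simps)
    then have "n powr (1 / r - 1 / q) \<le> C / \<kappa>" by (simp add: powr_diff)
    then have "(n powr (1 / r - 1 / q)) powr (q * r / (q - r)) \<le> (C / \<kappa>) powr (q * r / (q - r))"
      using r by (intro powr_mono2) auto
    moreover have "(1 / r - 1 / q) * (q * r / (q - r)) = 1"
      using r by (simp add: field_simps)
    ultimately have "n powr 1 \<le> (C / \<kappa>) powr (q * r / (q - r))" by (simp only: powr_powr)
    then show ?thesis unfolding D_def[symmetric] using n by (simp add: n_def)
  qed
qed

lemma sum_columns_le:
  assumes t: "matrix_bound C K q M r t" and r: "2 \<le> r" "r < q" and pos: "0 < C" "0 < \<kappa>"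
  shows "(\<Sum>i=1..K. lq_norm M r (\<lambda>j. t j i)) \<le> \<kappa> * real K + C * (C / \<kappa>) powr (q * r / (q - r))"
proof -
  define D where "D = {i\<in>{1..K}. \<kappa> < lq_norm M r (\<lambda>j. t j i)}"
  have "(\<Sum>i=1..K. lq_norm M r (\<lambda>j. t j i)) \<le> (\<Sum>i=1..K. \<kappa> + (if i \<in> D then C else 0))"
    using matrix_bound_column[OF t] r pos by (intro sum_mono) (force simp: D_def)
  also have "\<dots> = \<kappa> * real K + C * real (card D)"
    by (simp add: sum.distrib sum.If_cases D_def Int_def)
  also have "\<dots> \<le> \<kappa> * real K + C * (C / \<kappa>) powr (q * r / (q - r))"
    using few_large_columns[OF assms] pos by (simp add: D_def)
  finally show ?thesis .
qed

text \<open>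
  The \<open>t m\<close> are the components of an operator $T$ from $\ell_q^K$ into an $\ell_\infty$-sum of
  finitely many blocks, and the \<open>s m\<close> are those of an operator $S$ back. Call column $i$ large in block
  $m$ if $\|T_m e_i\| > \kappa$. For fixed $i$ the small columns form a vector of norm at most $\kappa$ in the
  $\ell_\infty$-sum, to which $S$ is applied. There are at most $L$ large columns in each block, so
  that $|T_m|$ summed over them gives a vector $w_m$ of norm at most $L^2 C$. In the trace, pair $w_m$
  with the largest entry of each row of \<open>s m\<close>, and replace these entries by signed sums of the whole rows
  (lemma \<open>selection_signs\<close>). What results is a pairing of $S y$ with a sign vector in $\mathbb{R}^K$, and
  that is at most $K^{1-1/q} \|S y\|_q$, which is much smaller than $K$.
\<close>
lemma offdiagonal_trace_le:
  fixes M :: "nat \<Rightarrow> nat" and r :: "nat \<Rightarrow> real" and s t :: "nat \<Rightarrow> nat \<Rightarrow> nat \<Rightarrow> real"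
  assumes F: "finite F"
    and T: "\<And>m. m \<in> F \<Longrightarrow> matrix_bound C K q (M m) (r m) (t m)"
    and S: "\<And>y b. 0 \<le> b \<Longrightarrow> (\<And>m. m \<in> F \<Longrightarrow> lq_norm (M m) (r m) (y m) \<le> b) \<Longrightarrow>
        lq_norm K q (\<lambda>i. \<Sum>m\<in>F. \<Sum>j=1..M m. s m j i * y m j) \<le> C * b"
    and r: "\<And>m. m \<in> F \<Longrightarrow> 2 \<le> r m"
    and L: "\<And>m. m \<in> F \<Longrightarrow> real (card {i\<in>{1..K}. \<kappa> < lq_norm (M m) (r m) (\<lambda>j. t m j i)}) \<le> L"
    and q: "1 < q" and pos: "0 < C" "0 < \<kappa>" "0 \<le> L"
  shows "(\<Sum>i=1..K. \<Sum>m\<in>F. \<Sum>j=1..M m. \<bar>s m j i * t m j i\<bar>)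
    \<le> \<kappa> * C * real K + L\<^sup>2 * C\<^sup>2 * real K powr (1 - 1 / q)"
proof (cases "K = 0")
  case True
  then show ?thesis using pos by simp
next
  case K: False
  define D where "D m = {i\<in>{1..K}. \<kappa> < lq_norm (M m) (r m) (\<lambda>j. t m j i)}" for m
  have Dfin: "finite (D m)" and DK: "D m \<subseteq> {1..K}" for m by (auto simp: D_def)
  have small: "(\<Sum>m\<in>F. \<Sum>j=1..M m. if i \<in> D m then 0 else \<bar>s m j i * t m j i\<bar>) \<le> C * \<kappa>"
    if i: "i \<in> {1..K}" for i
  proof -
    define y where "y m j = (if i \<in> D m then 0 else sgn (s m j i) * \<bar>t m j i\<bar>)" for m j
    have "lq_norm (M m) (r m) (y m) \<le> \<kappa>" if m: "m \<in> F" for m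
    proof (cases "i \<in> D m")
      case True
      then show ?thesis using pos r[OF m] by (subst lq_norm_zero) (auto simp: y_def)
    next
      case False
      have "lq_norm (M m) (r m) (y m) \<le> lq_norm (M m) (r m) (\<lambda>j. t m j i)"
        using r[OF m] by (intro lq_norm_mono) (auto simp: y_def abs_mult abs_sgn_eq)
      also have "\<dots> \<le> \<kappa>" using False i by (simp add: D_def)
      finally show ?thesis .
    qed
    from S[OF _ this] have *: "lq_norm K q (\<lambda>i. \<Sum>m\<in>F. \<Sum>j=1..M m. s m j i * y m j) \<le> C * \<kappa>" using pos by simp
    have "(\<Sum>m\<in>F. \<Sum>j=1..M m. if i \<in> D m then 0 else \<bar>s m j i * t m j i\<bar>)
        = (\<Sum>m\<in>F. \<Sum>j=1..M m. s m j i * y m j)"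
    proof (intro sum.cong refl)
      show "(if i \<in> D m then 0 else \<bar>s m j i * t m j i\<bar>) = s m j i * y m j" for m j
        by (cases "s m j i" "0::real" rule: linorder_cases) (simp_all add: y_def abs_mult)
    qed
    also have "\<dots> \<le> lq_norm K q (\<lambda>i. \<Sum>m\<in>F. \<Sum>j=1..M m. s m j i * y m j)"
      using abs_le_lq_norm[of q i K "\<lambda>i. \<Sum>m\<in>F. \<Sum>j=1..M m. s m j i * y m j"] i q by linarith
    finally show ?thesis using * by linarith
  qed
  define sel where "sel = (\<lambda>(m, j). SOME l. l \<in> {1..K} \<and> (\<forall>i\<in>{1..K}. \<bar>s m j i\<bar> \<le> \<bar>s m j l\<bar>))"
  have sel: "sel (m, j) \<in> {1..K} \<and> (\<forall>i\<in>{1..K}. \<bar>s m j i\<bar> \<le> \<bar>s m j (sel (m, j))\<bar>)" for m j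
  proof -
    have "\<exists>l. l \<in> {1..K} \<and> (\<forall>i\<in>{1..K}. \<bar>s m j i\<bar> \<le> \<bar>s m j l\<bar>)"
    proof -
      have "Max ((\<lambda>i. \<bar>s m j i\<bar>) ` {1..K}) \<in> (\<lambda>i. \<bar>s m j i\<bar>) ` {1..K}"
        using K by (intro Max_in) auto
      then obtain l where l: "l \<in> {1..K}" "Max ((\<lambda>i. \<bar>s m j i\<bar>) ` {1..K}) = \<bar>s m j l\<bar>" by blast
      have "\<bar>s m j i\<bar> \<le> \<bar>s m j l\<bar>" if "i \<in> {1..K}" for i
        unfolding l(2)[symmetric] using that by (intro Max_ge) auto
      with l(1) show ?thesis by blast
    qed
    from someI_ex[OF this] show ?thesis by (simp add: sel_def)
  qed
  define w where "w m j = (\<Sum>i\<in>D m. \<bar>t m j i\<bar>)" for m j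
  have w0: "0 \<le> w m j" for m j by (simp add: w_def sum_nonneg)
  define A where "A = Sigma F (\<lambda>m. {1..M m})"
  define s' where "s' = (\<lambda>(m, j) i. w m j * s m j i)"
  obtain \<epsilon> :: "nat \<Rightarrow> real" where \<epsilon>: "\<forall>i. \<bar>\<epsilon> i\<bar> = 1"
    "(\<Sum>a\<in>A. if sel a \<in> {1..K} then \<bar>s' a (sel a)\<bar> else 0)
      \<le> (\<Sum>a\<in>A. if sel a \<in> {1..K} then \<bar>\<Sum>i=1..K. \<epsilon> i * s' a i\<bar> else 0)"
    using selection_signs[of "{1..K}" sel s' A] by blast
  \<comment> \<open>The signs of the row sums turn the sum of their absolute values into a value of the functional \<open>\<epsilon>\<close> at $S y$.\<close>
  define y where "y m j = w m j * sgn (\<Sum>i=1..K. \<epsilon> i * s m j i)" for m j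
  define v where "v i = (\<Sum>m\<in>F. \<Sum>j=1..M m. s m j i * y m j)" for i
  have "lq_norm (M m) (r m) (y m) \<le> L\<^sup>2 * C" if m: "m \<in> F" for m
  proof -
    have "lq_norm (M m) (r m) (y m) \<le> lq_norm (M m) (r m) (w m)"
      using r[OF m] w0 by (intro lq_norm_mono) (auto simp: y_def abs_mult abs_sgn_eq)
    also have "\<dots> \<le> (real (card (D m)))\<^sup>2 * C"
      unfolding w_def
      using r[OF m] pos matrix_bound_column[OF T[OF m]] q DK[of m] Dfin
      by (intro lq_norm_sum_le_card) auto
    also have "\<dots> \<le> L\<^sup>2 * C"
      using L[OF m] pos by (intro mult_right_mono power_mono) (auto simp: D_def)
    finally show ?thesis .
  qed
  from S[OF _ this] have v: "lq_norm K q v \<le> C * (L\<^sup>2 * C)" using pos by (simp add: v_def[abs_def])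
  have "(\<Sum>i=1..K. \<Sum>m\<in>F. \<Sum>j=1..M m. if i \<in> D m then \<bar>s m j i * t m j i\<bar> else 0)
      = (\<Sum>m\<in>F. \<Sum>j=1..M m. \<Sum>i=1..K. if i \<in> D m then \<bar>s m j i * t m j i\<bar> else 0)"
    by (subst sum.swap) (intro sum.cong refl sum.swap)
  also have "\<dots> = (\<Sum>m\<in>F. \<Sum>j=1..M m. \<Sum>i\<in>D m. \<bar>s m j i * t m j i\<bar>)"
    using DK by (intro sum.cong refl sum.mono_neutral_cong_right) auto
  also have "\<dots> \<le> (\<Sum>m\<in>F. \<Sum>j=1..M m. \<Sum>i\<in>D m. \<bar>s m j (sel (m, j))\<bar> * \<bar>t m j i\<bar>)"
    using sel DK by (intro sum_mono) (force simp: abs_mult intro!: mult_right_mono)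
  also have "\<dots> = (\<Sum>m\<in>F. \<Sum>j=1..M m. \<bar>s' (m, j) (sel (m, j))\<bar>)"
  proof (intro sum.cong refl)
    fix m j
    have "\<bar>s' (m, j) (sel (m, j))\<bar> = \<bar>s m j (sel (m, j))\<bar> * w m j"
      using w0[of m j] by (simp add: s'_def abs_mult)
    then show "(\<Sum>i\<in>D m. \<bar>s m j (sel (m, j))\<bar> * \<bar>t m j i\<bar>) = \<bar>s' (m, j) (sel (m, j))\<bar>"
      by (simp add: w_def sum_distrib_left)
  qed
  also have "\<dots> = (\<Sum>a\<in>A. \<bar>s' a (sel a)\<bar>)"
    unfolding A_def using F by (subst sum.Sigma) (auto intro: sum.cong)
  also have "\<dots> \<le> (\<Sum>a\<in>A. \<bar>\<Sum>i=1..K. \<epsilon> i * s' a i\<bar>)"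
  proof -
    have "sel a \<in> {1..K}" for a using sel by (cases a) auto
    then show ?thesis using \<epsilon>(2) by simp
  qed
  also have "\<dots> = (\<Sum>m\<in>F. \<Sum>j=1..M m. \<bar>\<Sum>i=1..K. \<epsilon> i * s' (m, j) i\<bar>)"
    unfolding A_def using F by (subst sum.Sigma) (auto intro: sum.cong)
  also have "\<dots> = (\<Sum>m\<in>F. \<Sum>j=1..M m. y m j * (\<Sum>i=1..K. \<epsilon> i * s m j i))"
  proof (intro sum.cong refl)
    fix m j
    have "(\<Sum>i=1..K. \<epsilon> i * s' (m, j) i) = w m j * (\<Sum>i=1..K. \<epsilon> i * s m j i)"
      by (simp add: s'_def sum_distrib_left mult_ac)
    then show "\<bar>\<Sum>i=1..K. \<epsilon> i * s' (m, j) i\<bar> = y m j * (\<Sum>i=1..K. \<epsilon> i * s m j i)"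
      using w0[of m j]
      by (cases "(\<Sum>i=1..K. \<epsilon> i * s m j i)" "0::real" rule: linorder_cases)
         (simp_all add: y_def abs_mult)
  qed
  also have "\<dots> = (\<Sum>m\<in>F. \<Sum>j=1..M m. \<Sum>i=1..K. \<epsilon> i * (s m j i * y m j))"
    by (simp add: sum_distrib_left mult_ac)
  also have "\<dots> = (\<Sum>i=1..K. \<Sum>m\<in>F. \<Sum>j=1..M m. \<epsilon> i * (s m j i * y m j))"
    by (subst (2) sum.swap) (intro sum.cong refl sum.swap)
  also have "\<dots> = (\<Sum>i=1..K. \<epsilon> i * v i)"
    by (simp add: v_def sum_distrib_left)
  also have "\<dots> \<le> (\<Sum>i=1..K. \<bar>v i\<bar>)"
  proof (intro sum_mono)
    fix i show "\<epsilon> i * v i \<le> \<bar>v i\<bar>" using \<epsilon>(1) abs_ge_self[of "\<epsilon> i * v i"] by (simp add: abs_mult)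
  qed
  also have "\<dots> \<le> real K powr (1 - 1 / q) * lq_norm K q v" by (rule sum_abs_le_lq_norm[OF q])
  also have "\<dots> \<le> real K powr (1 - 1 / q) * (C * (L\<^sup>2 * C))" by (intro mult_left_mono v) simp
  finally have large: "(\<Sum>i=1..K. \<Sum>m\<in>F. \<Sum>j=1..M m. if i \<in> D m then \<bar>s m j i * t m j i\<bar> else 0)
      \<le> L\<^sup>2 * C\<^sup>2 * real K powr (1 - 1 / q)" by (simp add: power2_eq_square mult_ac)
  have "(\<Sum>i=1..K. \<Sum>m\<in>F. \<Sum>j=1..M m. \<bar>s m j i * t m j i\<bar>)
      = (\<Sum>i=1..K. \<Sum>m\<in>F. \<Sum>j=1..M m. if i \<in> D m then 0 else \<bar>s m j i * t m j i\<bar>)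
       + (\<Sum>i=1..K. \<Sum>m\<in>F. \<Sum>j=1..M m. if i \<in> D m then \<bar>s m j i * t m j i\<bar> else 0)"
    unfolding sum.distrib[symmetric] by (intro sum.cong refl) auto
  also have "(\<Sum>i=1..K. \<Sum>m\<in>F. \<Sum>j=1..M m. if i \<in> D m then 0 else \<bar>s m j i * t m j i\<bar>) \<le> real K * (C * \<kappa>)"
    using sum_bounded_above[of "{1..K}" _ "C * \<kappa>", OF small] by simp
  finally show ?thesis using large by (simp add: mult_ac)
qed

text \<open>
  The first term bounds the contribution of the blocks $m < n$, by the number of their coordinates;
  the second that of $m = n$, where \<open>sum_columns_le\<close> applies to $T$ if $r_n < q$ and to $S$
  otherwise; the third that of $m > n$; and the last the part of $S T$ beyond block $N$.
\<close>
lemma trace_estimate: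
  fixes K :: "nat \<Rightarrow> nat" and r :: "nat \<Rightarrow> real" and s t :: "nat \<Rightarrow> nat \<Rightarrow> nat \<Rightarrow> real"
  assumes n: "1 \<le> n" "n \<le> N" and pos: "0 < C" "0 < \<kappa>" "0 \<le> L"
    and T: "\<And>m. 1 \<le> m \<Longrightarrow> matrix_bound C (K n) q (K m) (r m) (t m)"
    and S: "\<And>F y b. finite F \<Longrightarrow> F \<subseteq> {1..} \<Longrightarrow> 0 \<le> b \<Longrightarrow>
        (\<And>m. m \<in> F \<Longrightarrow> lq_norm (K m) (r m) (y m) \<le> b) \<Longrightarrow>
        lq_norm (K n) q (\<lambda>i. \<Sum>m\<in>F. \<Sum>j=1..K m. s m j i * y m j) \<le> C * b"
    and ST: "\<And>i. i \<in> {1..K n} \<Longrightarrow> \<bar>1 - (\<Sum>m=1..N. \<Sum>j=1..K m. s m j i * t m j i)\<bar> \<le> \<eta>"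
    and q: "2 \<le> q" and r: "\<And>m. 1 \<le> m \<Longrightarrow> 2 \<le> r m" and ne: "r n \<noteq> q"
    and L: "\<And>m. n < m \<Longrightarrow> r m < q \<and> (C / \<kappa>) powr (q * r m / (q - r m)) \<le> L"
  shows "real (K n) \<le> C\<^sup>2 * (\<Sum>m=1..<n. real (K m))
      + C * (\<kappa> * real (K n) + C * (C / \<kappa>) powr (q * r n / \<bar>q - r n\<bar>))
      + (\<kappa> * C * real (K n) + L\<^sup>2 * C\<^sup>2 * real (K n) powr (1 - 1 / q)) + \<eta> * real (K n)"
proof -
  define \<tau> where "\<tau> m = (\<Sum>i=1..K n. \<Sum>j=1..K m. s m j i * t m j i)" for m
  have S1: "lq_norm (K n) q (\<lambda>i. \<Sum>j=1..K m. s m j i * y j) \<le> C * lq_norm (K m) (r m) y"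
    if "1 \<le> m" for m y
    using S[of "{m}" "lq_norm (K m) (r m) y" "\<lambda>_. y"] that by simp
  have T1: "\<bar>\<Sum>i=1..K n. t m j i * x i\<bar> \<le> C * lq_norm (K n) q x" if "1 \<le> m" "j \<in> {1..K m}" for m j x
  proof -
    have "\<bar>\<Sum>i=1..K n. t m j i * x i\<bar> \<le> lq_norm (K m) (r m) (\<lambda>j. \<Sum>i=1..K n. t m j i * x i)"
      using abs_le_lq_norm[of "r m" j "K m" "\<lambda>j. \<Sum>i=1..K n. t m j i * x i"] r[OF that(1)] that by simp
    also have "\<dots> \<le> C * lq_norm (K n) q x" using T[OF that(1)] by (simp add: matrix_bound_def)
    finally show ?thesis .
  qed
  have Scol: "lq_norm (K n) q (\<lambda>i. s m j i) \<le> C" if "1 \<le> m" "j \<in> {1..K m}" for m j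
  proof -
    have "(\<Sum>l=1..K m. s m l i * (if l = j then 1 else 0)) = s m j i" for i
      using that by (simp add: if_distrib cong: if_cong)
    then show ?thesis
      using S1[OF that(1), of "\<lambda>l. if l = j then 1 else 0"] lq_norm_unit[of "r m" j "K m" 1]
        r[OF that(1)] that by simp
  qed
  have swap: "\<tau> m = (\<Sum>j=1..K m. \<Sum>i=1..K n. t m j i * s m j i)" for m
    unfolding \<tau>_def by (subst sum.swap) (simp add: mult.commute)
  have low: "\<tau> m \<le> C\<^sup>2 * real (K m)" if m: "1 \<le> m" for m
  proof -
    have "(\<Sum>i=1..K n. t m j i * s m j i) \<le> C\<^sup>2" if j: "j \<in> {1..K m}" for j
    proof -
      have "(\<Sum>i=1..K n. t m j i * s m j i) \<le> C * lq_norm (K n) q (\<lambda>i. s m j i)"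
        using T1[OF m j, of "\<lambda>i. s m j i"] by simp
      also have "\<dots> \<le> C * C" using Scol[OF m j] pos by (intro mult_left_mono) auto
      finally show ?thesis by (simp add: power2_eq_square)
    qed
    then show ?thesis unfolding swap using sum_bounded_above[of "{1..K m}" _ "C\<^sup>2"] by (simp add: mult.commute)
  qed
  have diag: "\<tau> n \<le> C * (\<kappa> * real (K n) + C * (C / \<kappa>) powr (q * r n / \<bar>q - r n\<bar>))"
  proof (cases "r n < q")
    case True
    have "(\<Sum>j=1..K n. s n j i * t n j i) \<le> C * lq_norm (K n) (r n) (\<lambda>j. t n j i)" if i: "i \<in> {1..K n}" for i
      using abs_le_lq_norm[of q i "K n" "\<lambda>i'. \<Sum>j=1..K n. s n j i' * t n j i"]
        S1[OF n(1), of "\<lambda>j. t n j i"] q i by simp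
    then have "\<tau> n \<le> (\<Sum>i=1..K n. C * lq_norm (K n) (r n) (\<lambda>j. t n j i))"
      unfolding \<tau>_def by (intro sum_mono) auto
    also have "\<dots> = C * (\<Sum>i=1..K n. lq_norm (K n) (r n) (\<lambda>j. t n j i))" by (simp add: sum_distrib_left)
    also have "\<dots> \<le> C * (\<kappa> * real (K n) + C * (C / \<kappa>) powr (q * r n / (q - r n)))"
      using sum_columns_le[OF T[OF n(1)] r[OF n(1)] True pos(1,2)] pos by (intro mult_left_mono) auto
    finally show ?thesis using True by simp
  next
    case False
    then have rq: "q < r n" using ne by simp
    have S': "matrix_bound C (K n) (r n) (K n) q (\<lambda>i j. s n j i)"
      using S1[OF n(1)] by (simp add: matrix_bound_def)
    have "\<tau> n \<le> (\<Sum>j=1..K n. C * lq_norm (K n) q (\<lambda>i. s n j i))"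
      unfolding swap
    proof (intro sum_mono)
      fix j assume "j \<in> {1..K n}"
      then show "(\<Sum>i=1..K n. t n j i * s n j i) \<le> C * lq_norm (K n) q (\<lambda>i. s n j i)"
        using T1[OF n(1), of j "\<lambda>i. s n j i"] by simp
    qed
    also have "\<dots> = C * (\<Sum>j=1..K n. lq_norm (K n) q (\<lambda>i. s n j i))" by (simp add: sum_distrib_left)
    also have "\<dots> \<le> C * (\<kappa> * real (K n) + C * (C / \<kappa>) powr (r n * q / (r n - q)))"
      using sum_columns_le[OF S' q rq pos(1,2)] pos by (intro mult_left_mono) auto
    finally show ?thesis using rq by (simp add: mult.commute)
  qed
  have high: "(\<Sum>m\<in>{n<..N}. \<tau> m) \<le> \<kappa> * C * real (K n) + L\<^sup>2 * C\<^sup>2 * real (K n) powr (1 - 1 / q)"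
  proof -
    have "(\<Sum>m\<in>{n<..N}. \<tau> m) = (\<Sum>i=1..K n. \<Sum>m\<in>{n<..N}. \<Sum>j=1..K m. s m j i * t m j i)"
      unfolding \<tau>_def by (rule sum.swap)
    also have "\<dots> \<le> (\<Sum>i=1..K n. \<Sum>m\<in>{n<..N}. \<Sum>j=1..K m. \<bar>s m j i * t m j i\<bar>)"
      by (intro sum_mono abs_ge_self)
    also have "\<dots> \<le> \<kappa> * C * real (K n) + L\<^sup>2 * C\<^sup>2 * real (K n) powr (1 - 1 / q)"
    proof (rule offdiagonal_trace_le[where r = r])
      fix m assume m: "m \<in> {n<..N}"
      then have m1: "1 \<le> m" and nm: "n < m" using n by auto
      show "matrix_bound C (K n) q (K m) (r m) (t m)" by (rule T[OF m1])
      show "2 \<le> r m" by (rule r[OF m1])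
      show "real (card {i \<in> {1..K n}. \<kappa> < lq_norm (K m) (r m) (\<lambda>j. t m j i)}) \<le> L"
        using few_large_columns[OF T[OF m1] r[OF m1] _ pos(1,2)] L[OF nm] by linarith
    next
      fix y b assume "0 \<le> b" "\<And>m. m \<in> {n<..N} \<Longrightarrow> lq_norm (K m) (r m) (y m) \<le> b"
      then show "lq_norm (K n) q (\<lambda>i. \<Sum>m\<in>{n<..N}. \<Sum>j=1..K m. s m j i * y m j) \<le> C * b"
        using n by (intro S) auto
    qed (use q pos in auto)
    finally show ?thesis .
  qed
  have "real (K n) = (\<Sum>i=1..K n. 1)" by simp
  also have "\<dots> \<le> (\<Sum>i=1..K n. (\<Sum>m=1..N. \<Sum>j=1..K m. s m j i * t m j i) + \<eta>)"
  proof (intro sum_mono)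
    fix i assume "i \<in> {1..K n}"
    from ST[OF this] show "1 \<le> (\<Sum>m=1..N. \<Sum>j=1..K m. s m j i * t m j i) + \<eta>" by linarith
  qed
  also have "\<dots> = (\<Sum>m=1..N. \<tau> m) + \<eta> * real (K n)"
    unfolding \<tau>_def sum.distrib by (subst sum.swap) simp
  also have "{1..N} = {1..<n} \<union> {n} \<union> {n<..N}" using n by auto
  also have "(\<Sum>m\<in>{1..<n} \<union> {n} \<union> {n<..N}. \<tau> m) = (\<Sum>m=1..<n. \<tau> m) + \<tau> n + (\<Sum>m\<in>{n<..N}. \<tau> m)"
    by (subst sum.union_disjoint; (subst sum.union_disjoint)?) auto
  also have "(\<Sum>m=1..<n. \<tau> m) \<le> C\<^sup>2 * (\<Sum>m=1..<n. real (K m))"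
    unfolding sum_distrib_left by (intro sum_mono low) auto
  finally show ?thesis using diag high by linarith
qed

section \<open>Operators between $c_0$-sums\<close>

lemma apply_bcontfun_sum: "apply_bcontfun (\<Sum>a\<in>S. f a) x = (\<Sum>a\<in>S. apply_bcontfun (f a) x)"
  by (induction S rule: infinite_finite_induct) (simp_all add: plus_bcontfun.rep_eq zero_bcontfun.rep_eq)

lemma apply_basis_combination:
  assumes "finite S"
  shows "apply_bcontfun (\<Sum>a\<in>S. c a *\<^sub>R basis_vec (fst a) (snd a)) x = (if x \<in> S then c x else 0)"
proof -
  have "apply_bcontfun (\<Sum>a\<in>S. c a *\<^sub>R basis_vec (fst a) (snd a)) x = (\<Sum>a\<in>S. if a = x then c a else 0)"
    by (auto simp: apply_bcontfun_sum scaleR_bcontfun.rep_eq apply_basis_vec intro!: sum.cong)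
  then show ?thesis using assms by simp
qed

lemma vecs_c0_sum_lq:
  "x \<in> vecs (c0_sum_lq K q) \<longleftrightarrow>
     (\<forall>n i. \<not> (1 \<le> n \<and> 1 \<le> i \<and> i \<le> K n) \<longrightarrow> apply_bcontfun x (n, i) = 0) \<and>
     (\<lambda>n. lq_norm (K n) (q n) (\<lambda>i. apply_bcontfun x (n, i))) \<longlonglongrightarrow> 0"
  by (simp add: c0_sum_lq_def)

lemma block_le_nrm:
  assumes "x \<in> vecs (c0_sum_lq K q)" "1 \<le> n"
  shows "lq_norm (K n) (q n) (\<lambda>i. apply_bcontfun x (n, i)) \<le> nrm (c0_sum_lq K q) x"
proof -
  have "(\<lambda>n. lq_norm (K n) (q n) (\<lambda>i. apply_bcontfun x (n, i))) \<longlonglongrightarrow> 0"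
    using assms(1) by (simp add: vecs_c0_sum_lq)
  then have "bdd_above (range (\<lambda>n. lq_norm (K n) (q n) (\<lambda>i. apply_bcontfun x (n, i))))"
    by (intro bounded_imp_bdd_above convergent_imp_bounded)
  then have "bdd_above ((\<lambda>n. lq_norm (K n) (q n) (\<lambda>i. apply_bcontfun x (n, i))) ` {1..})"
    by (rule bdd_above_mono) auto
  then show ?thesis using assms(2) by (auto simp: c0_sum_lq_def intro!: cSUP_upper)
qed

lemma nrm_le:
  assumes "\<And>n. 1 \<le> n \<Longrightarrow> lq_norm (K n) (q n) (\<lambda>i. apply_bcontfun x (n, i)) \<le> b"
  shows "nrm (c0_sum_lq K q) x \<le> b"
  using assms by (auto simp: c0_sum_lq_def intro!: cSUP_least)

lemma nrm_nonneg:
  assumes "x \<in> vecs (c0_sum_lq K q)"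
  shows "0 \<le> nrm (c0_sum_lq K q) x"
  by (rule order_trans[OF lq_norm_nonneg block_le_nrm[OF assms order_refl]])

lemma finite_support_in_vecs:
  assumes S: "finite S" "S \<subseteq> Sigma {1..} (\<lambda>n. {1..K n})"
    and x: "\<And>a. a \<notin> S \<Longrightarrow> apply_bcontfun x a = 0" and q: "\<And>n. 1 \<le> n \<Longrightarrow> 0 < q n"
  shows "x \<in> vecs (c0_sum_lq K q)"
proof -
  obtain B where B: "\<forall>n\<in>fst ` S. n \<le> B"
    using finite_imageI[OF S(1), of fst] unfolding finite_nat_set_iff_bounded_le by blast
  have "\<forall>\<^sub>F n in sequentially. lq_norm (K n) (q n) (\<lambda>i. apply_bcontfun x (n, i)) = 0"
  proof (rule eventually_sequentiallyI)
    fix n assume n: "Suc B \<le> n"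
    show "lq_norm (K n) (q n) (\<lambda>i. apply_bcontfun x (n, i)) = 0"
    proof (rule lq_norm_zero)
      fix i
      have "n \<notin> fst ` S" using B n by auto
      then have "(n, i) \<notin> S" by (metis fst_conv imageI)
      then show "apply_bcontfun x (n, i) = 0" by (rule x)
    next
      show "0 < q n" by (rule q) (use n in linarith)
    qed
  qed
  then have "(\<lambda>n. lq_norm (K n) (q n) (\<lambda>i. apply_bcontfun x (n, i))) \<longlonglongrightarrow> 0"
    by (rule tendsto_eventually)
  moreover have "apply_bcontfun x (n, i) = 0" if "\<not> (1 \<le> n \<and> 1 \<le> i \<and> i \<le> K n)" for n i
  proof (rule x)
    show "(n, i) \<notin> S"
    proof
      assume "(n, i) \<in> S"
      with S(2) have "(n, i) \<in> Sigma {1..} (\<lambda>n. {1..K n})" by (rule subsetD)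
      then show False using that by simp
    qed
  qed
  ultimately show ?thesis unfolding vecs_c0_sum_lq by blast
qed

lemma basis_combination_in_vecs:
  assumes "finite S" "S \<subseteq> Sigma {1..} (\<lambda>n. {1..K n})" "\<And>n. 1 \<le> n \<Longrightarrow> 0 < q n"
  shows "(\<Sum>a\<in>S. c a *\<^sub>R basis_vec (fst a) (snd a)) \<in> vecs (c0_sum_lq K q)"
  using assms by (intro finite_support_in_vecs[of S]) (auto simp: apply_basis_combination)

lemma basis_vec_in_vecs:
  assumes "1 \<le> n" "i \<in> {1..K n}" "\<And>n. 1 \<le> n \<Longrightarrow> 0 < q n"
  shows "basis_vec n i \<in> vecs (c0_sum_lq K q)"
  using assms by (intro finite_support_in_vecs[of "{(n, i)}"]) (auto simp: apply_basis_vec)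

lemma vecs_add:
  assumes x: "x \<in> vecs (c0_sum_lq K q)" and y: "y \<in> vecs (c0_sum_lq K q)" and q: "\<And>n. 1 \<le> n \<Longrightarrow> 1 \<le> q n"
  shows "x + y \<in> vecs (c0_sum_lq K q)"
proof -
  have lx: "(\<lambda>n. lq_norm (K n) (q n) (\<lambda>i. apply_bcontfun x (n, i))) \<longlonglongrightarrow> 0"
    and sx: "\<forall>n i. \<not> (1 \<le> n \<and> 1 \<le> i \<and> i \<le> K n) \<longrightarrow> apply_bcontfun x (n, i) = 0"
    using x unfolding vecs_c0_sum_lq by blast+
  have ly: "(\<lambda>n. lq_norm (K n) (q n) (\<lambda>i. apply_bcontfun y (n, i))) \<longlonglongrightarrow> 0"
    and sy: "\<forall>n i. \<not> (1 \<le> n \<and> 1 \<le> i \<and> i \<le> K n) \<longrightarrow> apply_bcontfun y (n, i) = 0"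
    using y unfolding vecs_c0_sum_lq by blast+
  have "(\<lambda>n. 4 * max (lq_norm (K n) (q n) (\<lambda>i. apply_bcontfun x (n, i)))
      (lq_norm (K n) (q n) (\<lambda>i. apply_bcontfun y (n, i)))) \<longlonglongrightarrow> 0"
    using tendsto_mult_left[OF tendsto_max[OF lx ly], of 4] by simp
  then have "(\<lambda>n. lq_norm (K n) (q n) (\<lambda>i. apply_bcontfun x (n, i) + apply_bcontfun y (n, i))) \<longlonglongrightarrow> 0"
    by (rule tendsto_sandwich[OF _ _ tendsto_const, rotated 2])
       (auto intro!: always_eventually eventually_sequentiallyI[of 1] lq_norm_add_le q)
  moreover have "\<forall>n i. \<not> (1 \<le> n \<and> 1 \<le> i \<and> i \<le> K n) \<longrightarrow> apply_bcontfun (x + y) (n, i) = 0"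
    using sx sy unfolding plus_bcontfun.rep_eq by (metis add_0)
  ultimately show ?thesis unfolding vecs_c0_sum_lq plus_bcontfun.rep_eq by blast
qed

lemma vecs_scaleR:
  assumes x: "x \<in> vecs (c0_sum_lq K q)" and q: "\<And>n. 1 \<le> n \<Longrightarrow> 1 \<le> q n"
  shows "c *\<^sub>R x \<in> vecs (c0_sum_lq K q)"
proof -
  have lx: "(\<lambda>n. lq_norm (K n) (q n) (\<lambda>i. apply_bcontfun x (n, i))) \<longlonglongrightarrow> 0"
    and sx: "\<forall>n i. \<not> (1 \<le> n \<and> 1 \<le> i \<and> i \<le> K n) \<longrightarrow> apply_bcontfun x (n, i) = 0"
    using x unfolding vecs_c0_sum_lq by blast+
  have "(\<lambda>n. \<bar>c\<bar> * lq_norm (K n) (q n) (\<lambda>i. apply_bcontfun x (n, i))) \<longlonglongrightarrow> 0"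
    using tendsto_mult_left[OF lx, of "\<bar>c\<bar>"] by simp
  moreover have "\<forall>\<^sub>F n in sequentially. \<bar>c\<bar> * lq_norm (K n) (q n) (\<lambda>i. apply_bcontfun x (n, i))
      = lq_norm (K n) (q n) (\<lambda>i. c * apply_bcontfun x (n, i))"
  proof (rule eventually_sequentiallyI[of 1])
    fix n :: nat assume "1 \<le> n"
    then have "0 < q n" using q by fastforce
    then show "\<bar>c\<bar> * lq_norm (K n) (q n) (\<lambda>i. apply_bcontfun x (n, i))
      = lq_norm (K n) (q n) (\<lambda>i. c * apply_bcontfun x (n, i))" by (simp add: lq_norm_scale)
  qed
  ultimately have "(\<lambda>n. lq_norm (K n) (q n) (\<lambda>i. c * apply_bcontfun x (n, i))) \<longlonglongrightarrow> 0"
    by (rule Lim_transform_eventually)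
  moreover have "\<forall>n i. \<not> (1 \<le> n \<and> 1 \<le> i \<and> i \<le> K n) \<longrightarrow> apply_bcontfun (c *\<^sub>R x) (n, i) = 0"
    using sx unfolding scaleR_bcontfun.rep_eq by (metis scaleR_zero_right)
  ultimately show ?thesis unfolding vecs_c0_sum_lq scaleR_bcontfun.rep_eq real_scaleR_def by blast
qed

lemma c0_sum_lq_dominated:
  assumes dom: "\<And>n v. 1 \<le> n \<Longrightarrow> lq_norm (K n) (q n) v \<le> c * lq_norm (K n) (r n) v" and c: "0 \<le> c"
    and x: "x \<in> vecs (c0_sum_lq K r)"
  shows "x \<in> vecs (c0_sum_lq K q)" "nrm (c0_sum_lq K q) x \<le> c * nrm (c0_sum_lq K r) x"
proof -
  have lim: "(\<lambda>n. lq_norm (K n) (r n) (\<lambda>i. apply_bcontfun x (n, i))) \<longlonglongrightarrow> 0"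
    and supp: "\<forall>n i. \<not> (1 \<le> n \<and> 1 \<le> i \<and> i \<le> K n) \<longrightarrow> apply_bcontfun x (n, i) = 0"
    using x unfolding vecs_c0_sum_lq by blast+
  have "(\<lambda>n. c * lq_norm (K n) (r n) (\<lambda>i. apply_bcontfun x (n, i))) \<longlonglongrightarrow> 0"
    using tendsto_mult_left[OF lim, of c] by simp
  then have "(\<lambda>n. lq_norm (K n) (q n) (\<lambda>i. apply_bcontfun x (n, i))) \<longlonglongrightarrow> 0"
    by (rule tendsto_sandwich[OF _ _ tendsto_const, rotated 2])
       (auto intro!: always_eventually eventually_sequentiallyI[of 1] dom)
  with supp show "x \<in> vecs (c0_sum_lq K q)" unfolding vecs_c0_sum_lq by blast
  show "nrm (c0_sum_lq K q) x \<le> c * nrm (c0_sum_lq K r) x"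
  proof (rule nrm_le)
    fix n :: nat assume n: "1 \<le> n"
    show "lq_norm (K n) (q n) (\<lambda>i. apply_bcontfun x (n, i)) \<le> c * nrm (c0_sum_lq K r) x"
      by (rule order_trans[OF dom[OF n] mult_left_mono[OF block_le_nrm[OF x n] c]])
  qed
qed

lemma bounded_linear_between_basis_combination:
  assumes T: "bounded_linear_between (c0_sum_lq K q) Y T"
    and S: "finite S" "S \<subseteq> Sigma {1..} (\<lambda>n. {1..K n})" and q: "\<And>n. 1 \<le> n \<Longrightarrow> 0 < q n"
  shows "T (\<Sum>a\<in>S. c a *\<^sub>R basis_vec (fst a) (snd a)) = (\<Sum>a\<in>S. c a *\<^sub>R T (basis_vec (fst a) (snd a)))"
  using S
proof (induction S rule: finite_induct)
  case empty
  have "0 \<in> vecs (c0_sum_lq K q)" using basis_combination_in_vecs[of "{}" K q] q by simp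
  then have "T (0 *\<^sub>R 0) = 0 *\<^sub>R T 0" using T unfolding bounded_linear_between_def by blast
  then show ?case by simp
next
  case (insert a S)
  let ?e = "basis_vec (fst a) (snd a)"
  have e: "?e \<in> vecs (c0_sum_lq K q)"
    using insert.prems q by (intro basis_vec_in_vecs) auto
  have ce: "c a *\<^sub>R ?e \<in> vecs (c0_sum_lq K q)"
    using basis_combination_in_vecs[of "{a}" K q c] insert.prems q by simp
  have "(\<Sum>a\<in>S. c a *\<^sub>R basis_vec (fst a) (snd a)) \<in> vecs (c0_sum_lq K q)"
    using insert q by (intro basis_combination_in_vecs) auto
  then have "T (c a *\<^sub>R ?e + (\<Sum>a\<in>S. c a *\<^sub>R basis_vec (fst a) (snd a)))
      = T (c a *\<^sub>R ?e) + T (\<Sum>a\<in>S. c a *\<^sub>R basis_vec (fst a) (snd a))"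
    using T ce by (simp add: bounded_linear_between_def)
  also have "T (c a *\<^sub>R ?e) = c a *\<^sub>R T ?e" using T e by (simp add: bounded_linear_between_def)
  finally show ?case using insert by simp
qed

lemma operator_block_bound:
  assumes T: "bounded_linear_between (c0_sum_lq K q) (c0_sum_lq K r) T"
    and C: "\<And>x. x \<in> vecs (c0_sum_lq K q) \<Longrightarrow> nrm (c0_sum_lq K r) (T x) \<le> C * nrm (c0_sum_lq K q) x"
    and q: "\<And>n. 1 \<le> n \<Longrightarrow> 0 < q n" and n: "1 \<le> n" and C0: "0 \<le> C" "0 \<le> b"
    and F: "finite F" "F \<subseteq> {1..}" and y: "\<And>m. m \<in> F \<Longrightarrow> lq_norm (K m) (q m) (y m) \<le> b"
  shows "lq_norm (K n) (r n)
     (\<lambda>i. \<Sum>m\<in>F. \<Sum>j=1..K m. apply_bcontfun (T (basis_vec m j)) (n, i) * y m j) \<le> C * b"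
proof -
  define S where "S = Sigma F (\<lambda>m. {1..K m})"
  have S: "finite S" "S \<subseteq> Sigma {1..} (\<lambda>n. {1..K n})" using F by (auto simp: S_def)
  define x where "x = (\<Sum>a\<in>S. y (fst a) (snd a) *\<^sub>R basis_vec (fst a) (snd a))"
  have xv: "x \<in> vecs (c0_sum_lq K q)" unfolding x_def by (intro basis_combination_in_vecs S q)
  have Tx: "T x = (\<Sum>a\<in>S. y (fst a) (snd a) *\<^sub>R T (basis_vec (fst a) (snd a)))"
    unfolding x_def by (rule bounded_linear_between_basis_combination[OF T S q])
  have app: "apply_bcontfun (T x) (n, i) = (\<Sum>m\<in>F. \<Sum>j=1..K m. apply_bcontfun (T (basis_vec m j)) (n, i) * y m j)" for i
  proof -
    have "apply_bcontfun (T x) (n, i) = (\<Sum>a\<in>S. apply_bcontfun (T (basis_vec (fst a) (snd a))) (n, i) * y (fst a) (snd a))"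
      by (simp add: Tx apply_bcontfun_sum scaleR_bcontfun.rep_eq mult.commute)
    then show ?thesis
      using F unfolding S_def by (subst sum.Sigma) (auto simp: case_prod_unfold)
  qed
  have nx: "nrm (c0_sum_lq K q) x \<le> b"
  proof (rule nrm_le)
    fix m :: nat assume m: "1 \<le> m"
    have ax: "apply_bcontfun x a = (if a \<in> S then y (fst a) (snd a) else 0)" for a
      unfolding x_def using apply_basis_combination[OF S(1), of "\<lambda>a. y (fst a) (snd a)"] by simp
    show "lq_norm (K m) (q m) (\<lambda>i. apply_bcontfun x (m, i)) \<le> b"
    proof (cases "m \<in> F")
      case True
      then have "lq_norm (K m) (q m) (\<lambda>i. apply_bcontfun x (m, i)) = lq_norm (K m) (q m) (y m)"
        by (intro lq_norm_cong) (simp add: ax S_def)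
      then show ?thesis using y[OF True] by simp
    next
      case False
      then have "lq_norm (K m) (q m) (\<lambda>i. apply_bcontfun x (m, i)) = 0"
        using q[OF m] by (intro lq_norm_zero) (auto simp: ax S_def)
      then show ?thesis using C0 by simp
    qed
  qed
  have "T x \<in> vecs (c0_sum_lq K r)" using T xv by (auto simp: bounded_linear_between_def)
  from block_le_nrm[OF this n] have "lq_norm (K n) (r n) (\<lambda>i. apply_bcontfun (T x) (n, i)) \<le> C * b"
    using C[OF xv] mult_left_mono[OF nx C0(1)] by linarith
  then show ?thesis by (simp only: app)
qed

lemma operator_block_matrix_bound:
  assumes T: "bounded_linear_between (c0_sum_lq K q) (c0_sum_lq K r) T"
    and C: "\<And>x. x \<in> vecs (c0_sum_lq K q) \<Longrightarrow> nrm (c0_sum_lq K r) (T x) \<le> C * nrm (c0_sum_lq K q) x"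
    and q: "\<And>n. 1 \<le> n \<Longrightarrow> 0 < q n" and nm: "1 \<le> n" "1 \<le> m" and C0: "0 \<le> C"
  shows "matrix_bound C (K n) (q n) (K m) (r m) (\<lambda>j i. apply_bcontfun (T (basis_vec n i)) (m, j))"
  unfolding matrix_bound_def
proof
  fix x
  show "lq_norm (K m) (r m) (\<lambda>j. \<Sum>i=1..K n. apply_bcontfun (T (basis_vec n i)) (m, j) * x i)
      \<le> C * lq_norm (K n) (q n) x"
    using operator_block_bound[OF T C q nm(2) C0, of "lq_norm (K n) (q n) x" "{n}" "\<lambda>_. x"] nm by simp
qed

text \<open>
  The tail of $T e_i$ tends to $0$ in norm because the sum is a $c_0$-sum, so the trace may be
  computed with finitely many blocks.
\<close>
lemma factorization_trace_tail:
  assumes T: "bounded_linear_between (c0_sum_lq K q) (c0_sum_lq K r) T"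
    and S: "bounded_linear_between (c0_sum_lq K r) (c0_sum_lq K q) S"
    and C: "\<And>x. x \<in> vecs (c0_sum_lq K r) \<Longrightarrow> nrm (c0_sum_lq K q) (S x) \<le> C * nrm (c0_sum_lq K r) x"
    and ST: "\<And>x. x \<in> vecs (c0_sum_lq K q) \<Longrightarrow> S (T x) = x"
    and q: "\<And>n. 1 \<le> n \<Longrightarrow> 0 < q n" and r: "\<And>n. 1 \<le> n \<Longrightarrow> 0 < r n"
    and n: "1 \<le> n" and i: "i \<in> {1..K n}" and pos: "0 < C" "0 < \<eta>"
  shows "\<forall>\<^sub>F N in sequentially. \<bar>1 - (\<Sum>m=1..N. \<Sum>j=1..K m. 
      apply_bcontfun (S (basis_vec m j)) (n, i) * apply_bcontfun (T (basis_vec n i)) (m, j))\<bar> \<le> \<eta>"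
proof -
  define x where "x = T (basis_vec n i)"
  have e: "basis_vec n i \<in> vecs (c0_sum_lq K q)" using n i q by (intro basis_vec_in_vecs) auto
  have xv: "x \<in> vecs (c0_sum_lq K r)" using T e by (auto simp: x_def bounded_linear_between_def)
  then have lim: "(\<lambda>m. lq_norm (K m) (r m) (\<lambda>j. apply_bcontfun x (m, j))) \<longlonglongrightarrow> 0"
    by (simp add: vecs_c0_sum_lq)
  have "\<forall>\<^sub>F m in sequentially. lq_norm (K m) (r m) (\<lambda>j. apply_bcontfun x (m, j)) < \<eta> / C"
    using order_tendstoD(2)[OF lim] pos by simp
  then obtain N0 where N0: "\<And>m. N0 \<le> m \<Longrightarrow> lq_norm (K m) (r m) (\<lambda>j. apply_bcontfun x (m, j)) < \<eta> / C"
    by (auto simp: eventually_sequentially)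
  show ?thesis
  proof (rule eventually_sequentiallyI)
    fix N assume N: "N0 \<le> N"
    define A where "A = Sigma {1..N} (\<lambda>m. {1..K m})"
    have A: "finite A" "A \<subseteq> Sigma {1..} (\<lambda>n. {1..K n})" by (auto simp: A_def)
    define z where "z = (\<Sum>a\<in>A. apply_bcontfun x a *\<^sub>R basis_vec (fst a) (snd a))"
    have zv: "z \<in> vecs (c0_sum_lq K r)" unfolding z_def by (intro basis_combination_in_vecs A r)
    have rest: "apply_bcontfun (x - z) (m, j) = (if m \<le> N then 0 else apply_bcontfun x (m, j))" for m j
    proof -
      have "apply_bcontfun z (m, j) = (if (m, j) \<in> A then apply_bcontfun x (m, j) else 0)"
        unfolding z_def by (rule apply_basis_combination[OF A(1)])
      moreover have "apply_bcontfun x (m, j) = 0" if "m \<le> N" "(m, j) \<notin> A"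
        using xv that by (auto simp: vecs_c0_sum_lq A_def)
      ultimately show ?thesis by (auto simp: minus_bcontfun.rep_eq A_def)
    qed
    have le: "lq_norm (K m) (r m) (\<lambda>j. apply_bcontfun (x - z) (m, j))
        \<le> lq_norm (K m) (r m) (\<lambda>j. apply_bcontfun x (m, j))" if "1 \<le> m" for m
      using r[OF that] by (intro lq_norm_mono) (auto simp del: minus_bcontfun.rep_eq simp add: rest)
    have uv: "x - z \<in> vecs (c0_sum_lq K r)"
      unfolding vecs_c0_sum_lq
    proof (intro conjI allI impI)
      fix m j assume "\<not> (1 \<le> m \<and> 1 \<le> j \<and> j \<le> K m)"
      then show "apply_bcontfun (x - z) (m, j) = 0" using xv by (simp del: minus_bcontfun.rep_eq add: rest vecs_c0_sum_lq)
    next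
      show "(\<lambda>m. lq_norm (K m) (r m) (\<lambda>j. apply_bcontfun (x - z) (m, j))) \<longlonglongrightarrow> 0"
        by (rule tendsto_sandwich[OF _ _ tendsto_const lim])
           (auto simp del: minus_bcontfun.rep_eq intro!: eventually_sequentiallyI[of 1] le)
    qed
    have nu: "nrm (c0_sum_lq K r) (x - z) \<le> \<eta> / C"
    proof (rule nrm_le)
      fix m :: nat assume m: "1 \<le> m"
      show "lq_norm (K m) (r m) (\<lambda>j. apply_bcontfun (x - z) (m, j)) \<le> \<eta> / C"
      proof (cases "m \<le> N")
        case True
        then have "lq_norm (K m) (r m) (\<lambda>j. apply_bcontfun (x - z) (m, j)) = 0"
          using r[OF m] by (intro lq_norm_zero) (auto simp del: minus_bcontfun.rep_eq simp add: rest)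
        then show ?thesis using pos by simp
      next
        case False
        then have "N0 \<le> m" using N by simp
        from N0[OF this] le[OF m] show ?thesis by linarith
      qed
    qed
    have "S (z + (x - z)) = S z + S (x - z)"
      using S zv uv unfolding bounded_linear_between_def by blast
    moreover have "S (z + (x - z)) = basis_vec n i" using ST[OF e] by (simp add: x_def)
    ultimately have "S (x - z) = basis_vec n i - S z" by (metis add_diff_cancel_left')
    then have "apply_bcontfun (S (x - z)) (n, i) = 1 - apply_bcontfun (S z) (n, i)"
      by (simp add: minus_bcontfun.rep_eq apply_basis_vec)
    moreover have "\<bar>apply_bcontfun (S (x - z)) (n, i)\<bar> \<le> \<eta>"
    proof -
      have Su: "S (x - z) \<in> vecs (c0_sum_lq K q)" using S uv by (auto simp: bounded_linear_between_def)
      have "\<bar>apply_bcontfun (S (x - z)) (n, i)\<bar> \<le> lq_norm (K n) (q n) (\<lambda>i. apply_bcontfun (S (x - z)) (n, i))"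
        by (rule abs_le_lq_norm[OF q[OF n] i, of "\<lambda>i. apply_bcontfun (S (x - z)) (n, i)"])
      also have "\<dots> \<le> C * nrm (c0_sum_lq K r) (x - z)" using block_le_nrm[OF Su n] C[OF uv] by linarith
      also have "\<dots> \<le> C * (\<eta> / C)" using nu pos by (intro mult_left_mono) auto
      finally show ?thesis using pos by simp
    qed
    moreover have "apply_bcontfun (S z) (n, i) = (\<Sum>m=1..N. \<Sum>j=1..K m. 
      apply_bcontfun (S (basis_vec m j)) (n, i) * apply_bcontfun (T (basis_vec n i)) (m, j))"
    proof -
      have "S z = (\<Sum>a\<in>A. apply_bcontfun x a *\<^sub>R S (basis_vec (fst a) (snd a)))"
        unfolding z_def by (rule bounded_linear_between_basis_combination[OF S A r])
      then have "apply_bcontfun (S z) (n, i) = (\<Sum>a\<in>A. apply_bcontfun (S (basis_vec (fst a) (snd a))) (n, i) * apply_bcontfun x a)"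
        by (simp add: apply_bcontfun_sum scaleR_bcontfun.rep_eq mult.commute)
      then show ?thesis
        unfolding A_def x_def by (subst sum.Sigma) (auto simp: case_prod_unfold)
    qed
    ultimately show "\<bar>1 - (\<Sum>m=1..N. \<Sum>j=1..K m. 
      apply_bcontfun (S (basis_vec m j)) (n, i) * apply_bcontfun (T (basis_vec n i)) (m, j))\<bar> \<le> \<eta>" by simp
  qed
qed

lemma factorization_dimension_estimate:
  assumes T: "bounded_linear_between (c0_sum_lq K q) (c0_sum_lq K r) T"
    and S: "bounded_linear_between (c0_sum_lq K r) (c0_sum_lq K q) S"
    and CT: "\<And>x. x \<in> vecs (c0_sum_lq K q) \<Longrightarrow> nrm (c0_sum_lq K r) (T x) \<le> C * nrm (c0_sum_lq K q) x"
    and CS: "\<And>x. x \<in> vecs (c0_sum_lq K r) \<Longrightarrow> nrm (c0_sum_lq K q) (S x) \<le> C * nrm (c0_sum_lq K r) x"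
    and ST: "\<And>x. x \<in> vecs (c0_sum_lq K q) \<Longrightarrow> S (T x) = x"
    and q: "\<And>n. 1 \<le> n \<Longrightarrow> 2 \<le> q n" and r: "\<And>n. 1 \<le> n \<Longrightarrow> 2 \<le> r n"
    and n: "1 \<le> n" and pos: "0 < C" "0 < \<kappa>" "0 \<le> L" "0 < \<eta>" and ne: "r n \<noteq> q n"
    and L: "\<And>m. n < m \<Longrightarrow> r m < q n \<and> (C / \<kappa>) powr (q n * r m / (q n - r m)) \<le> L"
  shows "real (K n) \<le> C\<^sup>2 * (\<Sum>m=1..<n. real (K m))
      + C * (\<kappa> * real (K n) + C * (C / \<kappa>) powr (q n * r n / \<bar>q n - r n\<bar>))
      + (\<kappa> * C * real (K n) + L\<^sup>2 * C\<^sup>2 * real (K n) powr (1 - 1 / q n)) + \<eta> * real (K n)"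
proof -
  have q0: "0 < q n" and r0: "0 < r n" if "1 \<le> n" for n
    using q[OF that] r[OF that] by simp_all
  define t where "t m j i = apply_bcontfun (T (basis_vec n i)) (m, j)" for m j i
  define s where "s m j i = apply_bcontfun (S (basis_vec m j)) (n, i)" for m j i
  have "\<forall>\<^sub>F N in sequentially. \<forall>i\<in>{1..K n}. \<bar>1 - (\<Sum>m=1..N. \<Sum>j=1..K m. s m j i * t m j i)\<bar> \<le> \<eta>"
    unfolding s_def t_def
  proof (intro eventually_ball_finite ballI finite_atLeastAtMost)
    fix i assume i: "i \<in> {1..K n}"
    show "\<forall>\<^sub>F N in sequentially. \<bar>1 - (\<Sum>m=1..N. \<Sum>j=1..K m. 
      apply_bcontfun (S (basis_vec m j)) (n, i) * apply_bcontfun (T (basis_vec n i)) (m, j))\<bar> \<le> \<eta>"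
      by (rule factorization_trace_tail[OF T S]) (fact CS ST q0 r0 n i pos)+
  qed
  then have "\<forall>\<^sub>F N in sequentially. n \<le> N \<and> (\<forall>i\<in>{1..K n}. \<bar>1 - (\<Sum>m=1..N. \<Sum>j=1..K m. s m j i * t m j i)\<bar> \<le> \<eta>)"
    using eventually_ge_at_top[of n] by eventually_elim auto
  then obtain N where N: "n \<le> N" "\<And>i. i \<in> {1..K n} \<Longrightarrow> \<bar>1 - (\<Sum>m=1..N. \<Sum>j=1..K m. s m j i * t m j i)\<bar> \<le> \<eta>"
    unfolding eventually_sequentially by (meson order_refl)
  show ?thesis
  proof (rule trace_estimate[where s = s and t = t and r = r and K = K and q = "q n" and n = n and N = N])
    show "matrix_bound C (K n) (q n) (K m) (r m) (t m)" if "1 \<le> m" for m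
      unfolding t_def
      by (rule operator_block_matrix_bound[OF T]) (fact CT q0 n that less_imp_le[OF pos(1)])+
    show "lq_norm (K n) (q n) (\<lambda>i. \<Sum>m\<in>F. \<Sum>j=1..K m. s m j i * y m j) \<le> C * b"
      if "finite F" "F \<subseteq> {1..}" "0 \<le> b" "\<And>m. m \<in> F \<Longrightarrow> lq_norm (K m) (r m) (y m) \<le> b" for F y b
      unfolding s_def
      by (rule operator_block_bound[OF S]) (fact CS r0 n that less_imp_le[OF pos(1)])+
    show "r m < q n \<and> (C / \<kappa>) powr (q n * r m / (q n - r m)) \<le> L" if "n < m" for m
      by (rule L[OF that])
    show "\<bar>1 - (\<Sum>m=1..N. \<Sum>j=1..K m. s m j i * t m j i)\<bar> \<le> \<eta>" if "i \<in> {1..K n}" for i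
      by (rule N(2)[OF that])
    show "2 \<le> r m" if "1 \<le> m" for m by (rule r[OF that])
  qed (rule n N(1) pos q[OF n] ne)+
qed

section \<open>Isomorphisms and complemented embeddings\<close>

lemma bounded_linear_between_compose:
  assumes T: "bounded_linear_between X Y T" and S: "bounded_linear_between Y Z S"
    and Y: "\<And>y. y \<in> vecs Y \<Longrightarrow> 0 \<le> nrm Y y"
  shows "bounded_linear_between X Z (\<lambda>x. S (T x))"
proof -
  obtain C where C: "\<forall>x\<in>vecs X. nrm Y (T x) \<le> C * nrm X x"
    using T unfolding bounded_linear_between_def by blast
  obtain D where D: "\<forall>y\<in>vecs Y. nrm Z (S y) \<le> D * nrm Y y"
    using S unfolding bounded_linear_between_def by blast
  have TY: "T x \<in> vecs Y" if "x \<in> vecs X" for x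
    using T that unfolding bounded_linear_between_def by blast
  have "nrm Z (S (T x)) \<le> max D 0 * C * nrm X x" if x: "x \<in> vecs X" for x
  proof -
    have "nrm Z (S (T x)) \<le> D * nrm Y (T x)" using D TY[OF x] by blast
    also have "\<dots> \<le> max D 0 * nrm Y (T x)" using Y[OF TY[OF x]] by (intro mult_right_mono) auto
    also have "\<dots> \<le> max D 0 * (C * nrm X x)" using C x by (intro mult_left_mono) auto
    finally show ?thesis by (simp add: mult.assoc)
  qed
  then show ?thesis
    using T S TY unfolding bounded_linear_between_def by (auto simp: image_subset_iff)
qed

text \<open>
  The closure of the carrier of $Y$ under the operations is needed because the additivity of
  \<open>inv_into\<close> on \<open>vecs Y\<close> involves its values at sums, and \<open>inv_into\<close> is meaningful on \<open>vecs Y\<close> only.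
\<close>
lemma isomorphism_betweenI:
  assumes T: "bounded_linear_between X Y T" and S: "bounded_linear_between Y X S"
    and ST: "\<And>x. x \<in> vecs X \<Longrightarrow> S (T x) = x" and TS: "\<And>y. y \<in> vecs Y \<Longrightarrow> T (S y) = y"
    and add: "\<And>x y. x \<in> vecs Y \<Longrightarrow> y \<in> vecs Y \<Longrightarrow> x + y \<in> vecs Y"
    and scale: "\<And>c x. x \<in> vecs Y \<Longrightarrow> c *\<^sub>R x \<in> vecs Y"
  shows "isomorphism_between X Y T"
proof -
  have TY: "T x \<in> vecs Y" if "x \<in> vecs X" for x
    using T that unfolding bounded_linear_between_def by blast
  have SX: "S y \<in> vecs X" if "y \<in> vecs Y" for y
    using S that unfolding bounded_linear_between_def by blast
  have bij: "bij_betw T (vecs X) (vecs Y)"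
    by (rule bij_betw_byWitness[where f' = S]) (use ST TS TY SX in auto)
  have inv: "inv_into (vecs X) T y = S y" if y: "y \<in> vecs Y" for y
  proof -
    have "inv_into (vecs X) T (T (S y)) = S y"
      by (rule inv_into_f_f[OF bij_betw_imp_inj_on[OF bij] SX[OF y]])
    then show ?thesis by (simp add: TS y)
  qed
  have "bounded_linear_between Y X (inv_into (vecs X) T)"
    using S unfolding bounded_linear_between_def by (auto simp: inv add scale image_subset_iff)
  with T bij show ?thesis by (simp add: isomorphism_between_def)
qed

lemma isomorphic_imp_complementably_embeds:
  assumes "isomorphic_nspaces X Y"
  shows "complementably_embeds X Y"
proof -
  have "complemented_subspace (vecs Y) Y"
    unfolding complemented_subspace_def bounded_linear_between_def
    by (rule exI[of _ "\<lambda>x. x"]) (auto intro: exI[of _ 1])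
  moreover have "\<lparr>vecs = vecs Y, nrm = nrm Y\<rparr> = Y" by (cases Y) simp
  ultimately show ?thesis using assms unfolding complementably_embeds_def by metis
qed

text \<open>
  Complemented embeddings are used only through the factorization of the identity of $X$ through
  $Y$.
\<close>
lemma complementably_embeds_factorization:
  assumes "complementably_embeds X Y" and Y: "\<And>y. y \<in> vecs Y \<Longrightarrow> 0 \<le> nrm Y y"
  obtains T S where "bounded_linear_between X Y T" "bounded_linear_between Y X S"
    "\<And>x. x \<in> vecs X \<Longrightarrow> S (T x) = x"
proof -
  obtain Z P T where P: "bounded_linear_between Y Y P" "\<forall>x\<in>vecs Y. P (P x) = P x" "P ` vecs Y = Z"
    and iso: "isomorphism_between X \<lparr>vecs = Z, nrm = nrm Y\<rparr> T"
    using assms(1) unfolding complementably_embeds_def complemented_subspace_def isomorphic_nspaces_def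
    by blast
  let ?Z = "\<lparr>vecs = Z, nrm = nrm Y\<rparr>"
  let ?S = "inv_into (vecs X) T"
  have bij: "bij_betw T (vecs X) Z" and T: "bounded_linear_between X ?Z T"
    and S: "bounded_linear_between ?Z X ?S"
    using iso by (simp_all add: isomorphism_between_def)
  have ZY: "Z \<subseteq> vecs Y" using P unfolding bounded_linear_between_def by blast
  have PZ: "bounded_linear_between Y ?Z P"
    using P(1,3) unfolding bounded_linear_between_def by auto
  have TY: "bounded_linear_between X Y T"
    using T ZY unfolding bounded_linear_between_def by auto
  have SP: "bounded_linear_between Y X (\<lambda>y. ?S (P y))"
    by (rule bounded_linear_between_compose[OF PZ S]) (use Y ZY in auto)
  have "?S (P (T x)) = x" if x: "x \<in> vecs X" for x
  proof -
    have "T x \<in> Z" using bij x by (auto simp: bij_betw_def)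
    then have "P (T x) = T x" using P(2,3) by auto
    then show ?thesis using bij x by (simp add: bij_betw_def inv_into_f_f)
  qed
  from that[OF TY SP this] show ?thesis .
qed

section \<open>Dimensions and exponents\<close>

text \<open>
  The exponent $1000 n^3$ is chosen so large that $K_n$ is at least $n$ times the sum of its predecessors
  (lemma \<open>dims_sum_le\<close>), that $K_n^{1/4}$ outweighs the bounds on the number of large columns, which are of the
  size $n^{O(n^2)}$ (lemma \<open>index_le_root_dims\<close>), and that the increments $\alpha(n) / \ln K_n$ are small
  against the gaps $1/n - 1/(n+1)$ (lemma \<open>exponent_increment_le\<close>).
\<close>
definition dims :: "nat \<Rightarrow> nat" where
  "dims n = 2 ^ (1000 * n ^ 3)"

text \<open>
  The exponents decrease, so that the blocks after the $n$-th have smaller exponents than the $n$-th,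
  and stay above $2$, where $\ell_r$ has cotype $r$.
\<close>
definition base_exponent :: "nat \<Rightarrow> real" where
  "base_exponent n = 2 + 1 / real n"

definition exponent :: "(nat \<Rightarrow> nat) \<Rightarrow> nat \<Rightarrow> real" where
  "exponent \<alpha> n = base_exponent n + real (\<alpha> n) / ln (real (dims n))"

lemma c0_lp_eq: "c0_lp dims base_exponent \<alpha> = c0_sum_lq dims (exponent \<alpha>)"
  by (simp add: c0_lp_def exponent_def[abs_def])

lemma dims_ge_2: "1 \<le> n \<Longrightarrow> 2 \<le> dims n"
  using power_increasing[of 1 "1000 * n ^ 3" "2::nat"] by (simp add: dims_def)

lemma ln_dims_ge: "500 * real n ^ 3 \<le> ln (real (dims n))"
proof -
  have "1 / 2 \<le> ln (2::real)" using ln2_ge_two_thirds by simp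
  then have "1000 * real n ^ 3 * (1 / 2) \<le> 1000 * real n ^ 3 * ln 2" by (intro mult_left_mono) auto
  then show ?thesis by (simp add: dims_def ln_realpow)
qed

lemma ln_dims_pos: "1 \<le> n \<Longrightarrow> 0 < ln (real (dims n))"
  using ln_dims_ge[of n] by (rule less_le_trans[rotated]) simp

lemma X0_less: "\<alpha> \<in> X0 \<Longrightarrow> 1 \<le> n \<Longrightarrow> \<alpha> n < n"
  by (auto simp: X0_def PiE_iff)

lemma exponent_ge: "2 \<le> exponent \<alpha> n"
proof -
  have "1 \<le> real (dims n)" by (simp add: dims_def)
  then show ?thesis by (simp add: exponent_def base_exponent_def)
qed

lemma exponent_gt_1: "1 < exponent \<alpha> n"
  using exponent_ge[of \<alpha> n] by simp

text \<open>
  The bound is half of $1/n - 1/(n+1)$, which leaves the other half as a gap between the exponents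
  of different blocks.
\<close>
lemma exponent_increment_le:
  assumes "\<alpha> \<in> X0" "1 \<le> n"
  shows "real (\<alpha> n) / ln (real (dims n)) \<le> 1 / (2 * real n * (real n + 1))"
proof -
  have n: "1 \<le> real n" using assms(2) by simp
  have "real (\<alpha> n) / ln (real (dims n)) \<le> real n / (500 * real n ^ 3)"
    using X0_less[OF assms] ln_dims_ge[of n] assms(2) by (intro frac_le) auto
  also have "\<dots> = 1 / (500 * real n * real n)" using n by (simp add: power3_eq_cube)
  also have "\<dots> \<le> 1 / (2 * real n * (real n + 1))"
  proof (rule divide_left_mono)
    have "real n * (real n + 1) \<le> real n * (250 * real n)" using n by (intro mult_left_mono) auto
    then show "2 * real n * (real n + 1) \<le> 500 * real n * real n" by simp
  qed (use n in \<open>auto intro!: mult_pos_pos\<close>)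
  finally show ?thesis .
qed

lemma exponent_le:
  assumes "\<alpha> \<in> X0" "1 \<le> n"
  shows "exponent \<alpha> n \<le> 4"
proof -
  have n: "1 \<le> real n" using assms(2) by simp
  have "1 \<le> 2 * real n * (real n + 1)" using n mult_mono[of 1 "real n" 1 "real n + 1"] by simp
  then have "1 / (2 * real n * (real n + 1)) \<le> 1" by simp
  moreover have "1 / real n \<le> 1" using n by simp
  ultimately show ?thesis
    using exponent_increment_le[OF assms] by (simp add: exponent_def base_exponent_def)
qed

text \<open>
  The gap depends on $n$ only. It holds for different sequences $\alpha$ and $\beta$ because the
  increments never exceed half of the distance between consecutive base exponents.
\<close>
lemma exponent_gap:
  assumes "\<beta> \<in> X0" "1 \<le> n" "n < m"
  shows "1 / (2 * real n * (real n + 1)) \<le> exponent \<alpha> n - exponent \<beta> m"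
proof -
  have n: "1 \<le> real n" and m: "real n + 1 \<le> real m" using assms by auto
  have a: "2 + 1 / real n \<le> exponent \<alpha> n"
  proof -
    have "1 \<le> real (dims n)" by (simp add: dims_def)
    then show ?thesis by (simp add: exponent_def base_exponent_def)
  qed
  have "exponent \<beta> m \<le> 2 + 1 / real m + 1 / (2 * real m * (real m + 1))"
    using exponent_increment_le[OF assms(1), of m] assms by (simp add: exponent_def base_exponent_def)
  also have "1 / real m \<le> 1 / (real n + 1)" using m n by (intro divide_left_mono) auto
  also have "1 / (2 * real m * (real m + 1)) \<le> 1 / (2 * real n * (real n + 1))"
    using m n by (intro divide_left_mono mult_mono) (auto intro!: mult_pos_pos)
  finally have b: "exponent \<beta> m \<le> 2 + 1 / (real n + 1) + 1 / (2 * real n * (real n + 1))" by simp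
  have "1 / x - 1 / (x + 1) = 1 / (x * (x + 1))" if "0 < x" for x :: real
    using that by (simp add: field_simps)
  from this[of "real n"] have "1 / real n - 1 / (real n + 1) = 2 * (1 / (2 * real n * (real n + 1)))"
    using n by simp
  with a b show ?thesis by linarith
qed

lemma dims_sum_le: "n * (\<Sum>m=1..<n. dims m) \<le> dims n"
proof (cases n)
  case (Suc k)
  have "n * (n * dims m) \<le> dims n" if m: "m \<in> {1..<n}" for m
  proof -
    define P where "P = k * n ^ 2"
    have "m * m ^ 2 \<le> k * n ^ 2" using m Suc by (intro mult_mono power_mono) auto
    then have 1: "m ^ 3 \<le> P" by (simp add: P_def power3_eq_cube power2_eq_square)
    have 2: "P + n ^ 2 = n ^ 3"
      by (simp add: P_def Suc power3_eq_cube power2_eq_square)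
    have 3: "n \<le> n ^ 2" by (simp add: power2_eq_square)
    have "n + (n + 1000 * c) \<le> 1000 * (a + b)" if "c \<le> a" "n \<le> b" for a b c
    proof -
      have "1000 * c \<le> 1000 * a" using that(1) by (rule mult_le_mono2)
      moreover have "n + n \<le> 1000 * b" using that(2) by simp
      ultimately show ?thesis by (simp add: distrib_left)
    qed
    from this[OF 1 3] have e: "n + (n + 1000 * m ^ 3) \<le> 1000 * n ^ 3" unfolding 2 .
    have n2: "n \<le> 2 ^ n" by (rule less_imp_le[OF less_exp])
    have "n * (n * dims m) \<le> 2 ^ n * (2 ^ n * dims m)" by (intro mult_mono n2) auto
    also have "\<dots> = 2 ^ (n + (n + 1000 * m ^ 3))" by (simp only: dims_def power_add)
    also have "\<dots> \<le> dims n" unfolding dims_def by (rule power_increasing[OF e]) simp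
    finally show ?thesis .
  qed
  then have "(\<Sum>m=1..<n. n * (n * dims m)) \<le> of_nat (card {1..<n}) * dims n"
    by (rule sum_bounded_above)
  also have "\<dots> \<le> n * dims n" by simp
  finally have "n * (n * (\<Sum>m=1..<n. dims m)) \<le> n * dims n"
    by (simp only: sum_distrib_left)
  moreover have "0 < n" by (simp add: Suc)
  ultimately show ?thesis by (simp only: nat_mult_le_cancel1)
qed simp

lemma real_dims: "real (dims n) = 2 powr (1000 * real n ^ 3)"
  by (simp add: dims_def powr_realpow[symmetric])

text \<open>
  The left-hand side is $n L^2$ with $L = n^{32 n (n+1)}$; this $L$ will bound the number of large
  columns that \<open>few_large_columns\<close> allows for the exponent gap of \<open>exponent_gap\<close> when $C/\kappa \le n$.
\<close>
lemma index_le_root_dims: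
  assumes "1 \<le> n"
  shows "real n powr (64 * real n * (real n + 1) + 1) \<le> real (dims n) powr (1/4)"
proof -
  have n: "1 \<le> real n" using assms by simp
  have "real n \<le> 2 ^ n" using of_nat_mono[OF less_imp_le[OF less_exp[of n]], where 'a = real] by simp
  then have "real n \<le> 2 powr real n" by (simp add: powr_realpow)
  then have "real n powr (64 * real n * (real n + 1) + 1) \<le> (2 powr real n) powr (64 * real n * (real n + 1) + 1)"
    using n by (intro powr_mono2) auto
  also have "\<dots> = 2 powr (real n * (64 * real n * (real n + 1) + 1))" by (simp add: powr_powr)
  also have "\<dots> \<le> 2 powr (250 * real n ^ 3)"
  proof (rule powr_mono)
    have "real n ^ 1 \<le> real n ^ 3" using n by (intro power_increasing) auto
    moreover have "real n ^ 2 \<le> real n ^ 3" using n by (intro power_increasing) auto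
    ultimately show "real n * (64 * real n * (real n + 1) + 1) \<le> 250 * real n ^ 3"
      by (simp add: algebra_simps power2_eq_square power3_eq_cube)
  qed simp
  also have "\<dots> = real (dims n) powr (1/4)" by (simp add: real_dims powr_powr)
  finally show ?thesis .
qed

section \<open>$H_0$ and the relations between the $c_0$-sums\<close>

text \<open>
  The threshold $\kappa = 1/(16 C)$ makes the contribution of all small columns at most $K_n/16$. The
  hypothesis $16 C^2 \le n$ gives $C/\kappa = 16 C^2 \le n$ and turns the factors $C^2$ into $n/16$. If
  $|\alpha(n) - \beta(n)|$ exceeded the stated bound, the number of large columns between the two blocks $n$
  would be at most $\sqrt{K_n}$, and all terms of the dimension estimate together would be smaller than
  $K_n$.
\<close>
lemma factorization_forces_close:
  fixes C :: real
  assumes \<alpha>: "\<alpha> \<in> X0" and \<beta>: "\<beta> \<in> X0"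
    and T: "bounded_linear_between (c0_sum_lq dims (exponent \<alpha>)) (c0_sum_lq dims (exponent \<beta>)) T"
    and S: "bounded_linear_between (c0_sum_lq dims (exponent \<beta>)) (c0_sum_lq dims (exponent \<alpha>)) S"
    and CT: "\<And>x. x \<in> vecs (c0_sum_lq dims (exponent \<alpha>)) \<Longrightarrow>
        nrm (c0_sum_lq dims (exponent \<beta>)) (T x) \<le> C * nrm (c0_sum_lq dims (exponent \<alpha>)) x"
    and CS: "\<And>x. x \<in> vecs (c0_sum_lq dims (exponent \<beta>)) \<Longrightarrow>
        nrm (c0_sum_lq dims (exponent \<alpha>)) (S x) \<le> C * nrm (c0_sum_lq dims (exponent \<beta>)) x"
    and ST: "\<And>x. x \<in> vecs (c0_sum_lq dims (exponent \<alpha>)) \<Longrightarrow> S (T x) = x"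
    and C: "1 \<le> C" and n: "1 \<le> n" "16 * C\<^sup>2 \<le> real n"
  shows "\<bar>real (\<alpha> n) - real (\<beta> n)\<bar> \<le> 32 * ln (16 * C\<^sup>2)"
proof (rule ccontr)
  assume far: "\<not> ?thesis"
  define a where "a = 16 * C\<^sup>2"
  define K where "K = real (dims n)"
  define q where "q = exponent \<alpha> n"
  define r where "r = exponent \<beta> n"
  define \<Delta> where "\<Delta> = \<bar>real (\<alpha> n) - real (\<beta> n)\<bar>"
  define L where "L = real n powr (32 * real n * (real n + 1))"
  have C2: "1 \<le> C\<^sup>2" using C by simp
  have a: "1 < a" "a \<le> real n" using C2 n by (simp_all add: a_def)
  have a_eq: "C / (1 / (16 * C)) = a" using C by (simp add: a_def power2_eq_square)
  have lna: "0 < ln a" using a by simp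
  have \<Delta>: "32 * ln a < \<Delta>" using far by (simp add: \<Delta>_def a_def)
  have \<Delta>0: "0 < \<Delta>" using \<Delta> lna by linarith
  have K: "1 \<le> K" by (simp add: K_def dims_def)
  have lnK: "0 < ln K" unfolding K_def by (rule ln_dims_pos[OF n(1)])
  have qr: "2 \<le> q" "q \<le> 4" "2 \<le> r" "r \<le> 4"
    using exponent_ge exponent_le[OF \<alpha> n(1)] exponent_le[OF \<beta> n(1)] by (simp_all add: q_def r_def)
  have diff: "\<bar>q - r\<bar> = \<Delta> / ln K"
  proof -
    have "q - r = (real (\<alpha> n) - real (\<beta> n)) / ln K"
      by (simp add: q_def r_def exponent_def K_def diff_divide_distrib)
    then show ?thesis using lnK by (simp add: \<Delta>_def)
  qed
  then have ne: "r \<noteq> q" using \<Delta>0 lnK by auto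
  have qr16: "q * r \<le> 16" using mult_mono[OF qr(2,4)] qr by simp
  have nr: "1 \<le> real n" using n by simp
  have est: "K \<le> C\<^sup>2 * (\<Sum>m=1..<n. real (dims m))
      + C * (1 / (16 * C) * K + C * (C / (1 / (16 * C))) powr (q * r / \<bar>q - r\<bar>))
      + (1 / (16 * C) * C * K + L\<^sup>2 * C\<^sup>2 * K powr (1 - 1 / q)) + 1 / 16 * K"
    unfolding K_def q_def r_def
  proof (rule factorization_dimension_estimate[OF T S])
    show "exponent \<beta> m < exponent \<alpha> n \<and>
        (C / (1 / (16 * C))) powr (exponent \<alpha> n * exponent \<beta> m / (exponent \<alpha> n - exponent \<beta> m)) \<le> L"
      if "n < m" for m
    proof
      have gap: "1 / (2 * real n * (real n + 1)) \<le> exponent \<alpha> n - exponent \<beta> m"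
        by (rule exponent_gap[OF \<beta> n(1) that])
      have p: "0 < 1 / (2 * real n * (real n + 1))" using nr by simp
      with gap show "exponent \<beta> m < exponent \<alpha> n" by linarith
      have m: "1 \<le> m" using that by simp
      have "exponent \<alpha> n * exponent \<beta> m \<le> 4 * 4"
        using exponent_le[OF \<beta> m] exponent_le[OF \<alpha> n(1)] exponent_ge[of \<beta> m]
        by (intro mult_mono) auto
      then have "exponent \<alpha> n * exponent \<beta> m / (exponent \<alpha> n - exponent \<beta> m)
          \<le> 16 / (1 / (2 * real n * (real n + 1)))"
        using p gap by (intro frac_le) auto
      also have "\<dots> = 32 * real n * (real n + 1)" by simp
      finally have "a powr (exponent \<alpha> n * exponent \<beta> m / (exponent \<alpha> n - exponent \<beta> m))
          \<le> a powr (32 * real n * (real n + 1))"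
        using a by (intro powr_mono) auto
      also have "\<dots> \<le> L" unfolding L_def using a nr by (intro powr_mono2) auto
      finally show "(C / (1 / (16 * C))) powr (exponent \<alpha> n * exponent \<beta> m / (exponent \<alpha> n - exponent \<beta> m)) \<le> L"
        by (simp only: a_eq)
    qed
    show "2 \<le> exponent \<alpha> m" "2 \<le> exponent \<beta> m" for m by (rule exponent_ge)+
    show "exponent \<beta> n \<noteq> exponent \<alpha> n" using ne by (simp add: q_def r_def)
    show "0 < C" "0 < 1 / (16 * C)" "0 \<le> L" using C by (auto simp: L_def)
  qed (fact CT CS ST n | simp only: zero_less_divide_1_iff zero_less_numeral)+
  have 1: "C\<^sup>2 * (\<Sum>m=1..<n. real (dims m)) \<le> K / 16"
  proof -
    have "C\<^sup>2 * (\<Sum>m=1..<n. real (dims m)) \<le> real n / 16 * (\<Sum>m=1..<n. real (dims m))"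
      using n by (intro mult_right_mono) (auto intro: sum_nonneg)
    also have "\<dots> = real (n * (\<Sum>m=1..<n. dims m)) / 16" by simp
    also have "\<dots> \<le> K / 16"
      unfolding K_def using dims_sum_le[of n] by (intro divide_right_mono of_nat_mono) auto
    finally show ?thesis .
  qed
  \<comment> \<open>Here \<open>\<Delta> > 32 * ln a\<close> is used: \<open>a powr (16 * ln K / \<Delta>)\<close> is at most the square root of \<open>K\<close>.\<close>
  have 2: "C * (1 / (16 * C) * K + C * (C / (1 / (16 * C))) powr (q * r / \<bar>q - r\<bar>)) \<le> K / 16 + K / 16"
  proof -
    have "q * r / \<bar>q - r\<bar> \<le> 16 / \<bar>q - r\<bar>" using qr16 by (intro divide_right_mono) auto
    also have "\<dots> = 16 * ln K / \<Delta>" using lnK \<Delta>0 by (simp add: diff)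
    also have "\<dots> \<le> 16 * ln K / (32 * ln a)" using \<Delta> lna lnK by (intro divide_left_mono) auto
    finally have "a powr (q * r / \<bar>q - r\<bar>) \<le> a powr (16 * ln K / (32 * ln a))"
      using a by (intro powr_mono) auto
    also have "\<dots> = K powr (1 / 2)" using a lna K by (simp add: powr_def)
    finally have b: "a powr (q * r / \<bar>q - r\<bar>) \<le> K powr (1 / 2)" .
    have "real n = real n powr 1" by simp
    also have "\<dots> \<le> real n powr (64 * real n * (real n + 1) + 1)" using nr by (intro powr_mono) auto
    also have "\<dots> \<le> K powr (1/4)" unfolding K_def by (rule index_le_root_dims[OF n(1)])
    also have "\<dots> \<le> K powr (1/2)" using K by (intro powr_mono) auto
    finally have c: "real n \<le> K powr (1/2)" .
    have "C\<^sup>2 * a powr (q * r / \<bar>q - r\<bar>) \<le> (K powr (1/2) / 16) * K powr (1 / 2)"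
      using n c b by (intro mult_mono) auto
    also have "\<dots> = K powr (1/2 + 1/2) / 16" by (simp only: powr_add times_divide_eq_left)
    also have "\<dots> = K / 16" using K by simp
    finally have "C\<^sup>2 * a powr (q * r / \<bar>q - r\<bar>) \<le> K / 16" .
    moreover have "C * (1 / (16 * C) * K + C * (C / (1 / (16 * C))) powr (q * r / \<bar>q - r\<bar>))
        = K / 16 + C\<^sup>2 * a powr (q * r / \<bar>q - r\<bar>)"
      unfolding a_eq using C by (simp add: distrib_left power2_eq_square)
    ultimately show ?thesis by linarith
  qed
  \<comment> \<open>As \<open>q \<le> 4\<close>, the gain \<open>K powr (1 / q)\<close> is at least \<open>K powr (1 / 4)\<close>.\<close>
  have 3: "1 / (16 * C) * C * K + L\<^sup>2 * C\<^sup>2 * K powr (1 - 1 / q) \<le> K / 16 + K / 16"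
  proof -
    have "L\<^sup>2 * real n = real n powr (32 * real n * (real n + 1) + 32 * real n * (real n + 1) + 1)"
      unfolding L_def power2_eq_square using nr by (simp only: powr_add) simp
    also have "\<dots> \<le> K powr (1/4)" using index_le_root_dims[OF n(1)] by (simp add: K_def mult.assoc)
    finally have b: "L\<^sup>2 * real n \<le> K powr (1/4)" .
    have "L\<^sup>2 * C\<^sup>2 \<le> L\<^sup>2 * (real n / 16)" using n by (intro mult_left_mono) auto
    also have "\<dots> \<le> K powr (1/4) / 16" using b by simp
    finally have c: "L\<^sup>2 * C\<^sup>2 \<le> K powr (1/4) / 16" .
    have "1 / 4 \<le> 1 / q" using qr by (intro divide_left_mono) auto
    then have "K powr (1 - 1 / q) \<le> K powr (3/4)" using K by (intro powr_mono) auto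
    with c have "L\<^sup>2 * C\<^sup>2 * K powr (1 - 1 / q) \<le> (K powr (1/4) / 16) * K powr (3/4)"
      by (intro mult_mono) auto
    also have "\<dots> = K powr (1/4 + 3/4) / 16" by (simp only: powr_add times_divide_eq_left)
    also have "\<dots> = K / 16" using K by simp
    finally show ?thesis using C by simp
  qed
  have "1 / 16 * K = K / 16" by simp
  with est 1 2 3 have "K \<le> K / 16 + (K / 16 + K / 16) + (K / 16 + K / 16) + K / 16" by linarith
  then show False using K by simp
qed

text \<open>
  The finitely many $n < 16 C^2$ are harmless since $\alpha(n)$ and $\beta(n)$ are smaller than $n$.
\<close>
lemma factorization_imp_H0:
  assumes \<alpha>: "\<alpha> \<in> X0" and \<beta>: "\<beta> \<in> X0"
    and T: "bounded_linear_between (c0_sum_lq dims (exponent \<alpha>)) (c0_sum_lq dims (exponent \<beta>)) T"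
    and S: "bounded_linear_between (c0_sum_lq dims (exponent \<beta>)) (c0_sum_lq dims (exponent \<alpha>)) S"
    and ST: "\<And>x. x \<in> vecs (c0_sum_lq dims (exponent \<alpha>)) \<Longrightarrow> S (T x) = x"
  shows "(\<alpha>, \<beta>) \<in> H0"
proof -
  let ?X = "c0_sum_lq dims (exponent \<alpha>)" and ?Y = "c0_sum_lq dims (exponent \<beta>)"
  obtain C1 where C1: "\<forall>x\<in>vecs ?X. nrm ?Y (T x) \<le> C1 * nrm ?X x"
    using T unfolding bounded_linear_between_def by blast
  obtain C2 where C2: "\<forall>x\<in>vecs ?Y. nrm ?X (S x) \<le> C2 * nrm ?Y x"
    using S unfolding bounded_linear_between_def by blast
  define C where "C = max 1 (max C1 C2)"
  have CT: "nrm ?Y (T x) \<le> C * nrm ?X x" if "x \<in> vecs ?X" for x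
  proof -
    have "C1 * nrm ?X x \<le> C * nrm ?X x"
      using nrm_nonneg[OF that] by (intro mult_right_mono) (auto simp: C_def)
    then show ?thesis using C1 that by force
  qed
  have CS: "nrm ?X (S x) \<le> C * nrm ?Y x" if "x \<in> vecs ?Y" for x
  proof -
    have "C2 * nrm ?Y x \<le> C * nrm ?Y x"
      using nrm_nonneg[OF that] by (intro mult_right_mono) (auto simp: C_def)
    then show ?thesis using C2 that by force
  qed
  have C1: "1 \<le> C" by (simp add: C_def)
  have lnC: "0 \<le> ln (16 * C\<^sup>2)" using C1 one_le_power[OF C1, of 2] by (intro ln_ge_zero) linarith
  define N where "N = nat \<lceil>32 * ln (16 * C\<^sup>2) + 16 * C\<^sup>2\<rceil>"
  have N: "32 * ln (16 * C\<^sup>2) + 16 * C\<^sup>2 \<le> real N" unfolding N_def by linarith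
  have "\<bar>int (\<alpha> n) - int (\<beta> n)\<bar> \<le> int N" if n: "1 \<le> n" for n
  proof -
    have "\<bar>real (\<alpha> n) - real (\<beta> n)\<bar> \<le> real N"
    proof (cases "16 * C\<^sup>2 \<le> real n")
      case True
      have "\<bar>real (\<alpha> n) - real (\<beta> n)\<bar> \<le> 32 * ln (16 * C\<^sup>2)"
        by (rule factorization_forces_close[OF \<alpha> \<beta> T S]) (fact CT CS ST C1 n True)+
      then show ?thesis using N zero_le_power2[of C] by linarith
    next
      case False
      then show ?thesis using X0_less[OF \<alpha> n] X0_less[OF \<beta> n] N lnC by linarith
    qed
    then show ?thesis by linarith
  qed
  then show ?thesis using \<alpha> \<beta> unfolding H0_def by blast
qed

lemma H0_sym: "(\<alpha>, \<beta>) \<in> H0 \<Longrightarrow> (\<beta>, \<alpha>) \<in> H0"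
  unfolding H0_def by (auto simp: abs_minus_commute)

lemma H0_lq_norm_dominated:
  assumes "(\<alpha>, \<beta>) \<in> H0"
  obtains c where "0 \<le> c"
    "\<And>n v. 1 \<le> n \<Longrightarrow> lq_norm (dims n) (exponent \<alpha> n) v \<le> c * lq_norm (dims n) (exponent \<beta> n) v"
proof -
  obtain N :: nat where N: "\<And>n. 1 \<le> n \<Longrightarrow> \<bar>int (\<alpha> n) - int (\<beta> n)\<bar> \<le> int N"
    using assms by (auto simp: H0_def)
  show ?thesis
  proof
    show "0 \<le> exp (real N) + 1" by (simp add: add_nonneg_nonneg)
    fix n :: nat and v assume n: "1 \<le> n"
    have ln: "0 < ln (real (dims n))" by (rule ln_dims_pos[OF n])
    have "exponent \<alpha> n - exponent \<beta> n = (real (\<alpha> n) - real (\<beta> n)) / ln (real (dims n))"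
      by (simp add: exponent_def diff_divide_distrib)
    then have "\<bar>exponent \<alpha> n - exponent \<beta> n\<bar> * ln (real (dims n)) = \<bar>real (\<alpha> n) - real (\<beta> n)\<bar>"
      using ln by simp
    also have "\<dots> \<le> real N" using N[OF n] by linarith
    finally show "lq_norm (dims n) (exponent \<alpha> n) v \<le> (exp (real N) + 1) * lq_norm (dims n) (exponent \<beta> n) v"
      using exponent_ge[of \<alpha> n] exponent_ge[of \<beta> n]
      by (intro lq_norm_perturb) (auto simp: dims_def)
  qed
qed

lemma H0_identity_isomorphism:
  assumes "(\<alpha>, \<beta>) \<in> H0"
  shows "isomorphism_between (c0_sum_lq dims (exponent \<alpha>)) (c0_sum_lq dims (exponent \<beta>)) (\<lambda>x. x)"
proof -
  have q: "1 \<le> exponent \<gamma> n" for \<gamma> n using exponent_ge[of \<gamma> n] by simp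
  have bl: "bounded_linear_between (c0_sum_lq dims (exponent \<alpha>)) (c0_sum_lq dims (exponent \<beta>)) (\<lambda>x. x)"
    if H: "(\<alpha>, \<beta>) \<in> H0" for \<alpha> \<beta>
  proof -
    obtain c where c: "0 \<le> c"
      "\<And>n v. 1 \<le> n \<Longrightarrow> lq_norm (dims n) (exponent \<beta> n) v \<le> c * lq_norm (dims n) (exponent \<alpha> n) v"
      using H0_lq_norm_dominated[OF H0_sym[OF H]] by metis
    show ?thesis
      using c0_sum_lq_dominated[where K = dims and q = "exponent \<beta>" and r = "exponent \<alpha>", OF c(2,1)]
      unfolding bounded_linear_between_def by auto
  qed
  show ?thesis
    by (rule isomorphism_betweenI[OF bl[OF assms] bl[OF H0_sym[OF assms]]])
       (auto intro: vecs_add vecs_scaleR q)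
qed

lemma complementably_embeds_imp_H0:
  assumes "\<alpha> \<in> X0" "\<beta> \<in> X0"
    and "complementably_embeds (c0_sum_lq dims (exponent \<alpha>)) (c0_sum_lq dims (exponent \<beta>))"
  shows "(\<alpha>, \<beta>) \<in> H0"
proof -
  obtain T S where "bounded_linear_between (c0_sum_lq dims (exponent \<alpha>)) (c0_sum_lq dims (exponent \<beta>)) T"
    "bounded_linear_between (c0_sum_lq dims (exponent \<beta>)) (c0_sum_lq dims (exponent \<alpha>)) S"
    "\<And>x. x \<in> vecs (c0_sum_lq dims (exponent \<alpha>)) \<Longrightarrow> S (T x) = x"
    using complementably_embeds_factorization[OF assms(3) nrm_nonneg] by metis
  then show ?thesis using factorization_imp_H0[OF assms(1,2)] by metis
qed

lemma c0_lp_equivalences: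
  assumes "\<alpha> \<in> X0" "\<beta> \<in> X0"
  shows "(\<alpha>, \<beta>) \<in> H0 \<longleftrightarrow> canonical_bases_equivalent dims (c0_lp dims base_exponent \<alpha>) (c0_lp dims base_exponent \<beta>)"
    and "(\<alpha>, \<beta>) \<in> H0 \<longleftrightarrow> isomorphic_nspaces (c0_lp dims base_exponent \<alpha>) (c0_lp dims base_exponent \<beta>)"
    and "(\<alpha>, \<beta>) \<in> H0 \<longleftrightarrow> complementably_embeds (c0_lp dims base_exponent \<alpha>) (c0_lp dims base_exponent \<beta>)"
proof -
  let ?X = "c0_lp dims base_exponent \<alpha>" and ?Y = "c0_lp dims base_exponent \<beta>"
  have 12: "canonical_bases_equivalent dims ?X ?Y" if "(\<alpha>, \<beta>) \<in> H0"
    using H0_identity_isomorphism[OF that] unfolding canonical_bases_equivalent_def c0_lp_eq by blast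
  have 23: "isomorphic_nspaces ?X ?Y" if "canonical_bases_equivalent dims ?X ?Y"
    using that unfolding canonical_bases_equivalent_def isomorphic_nspaces_def by blast
  have 34: "complementably_embeds ?X ?Y" if "isomorphic_nspaces ?X ?Y"
    using that by (rule isomorphic_imp_complementably_embeds)
  have 41: "(\<alpha>, \<beta>) \<in> H0" if "complementably_embeds ?X ?Y"
    using complementably_embeds_imp_H0[OF assms] that unfolding c0_lp_eq by blast
  show "(\<alpha>, \<beta>) \<in> H0 \<longleftrightarrow> canonical_bases_equivalent dims ?X ?Y"
    "(\<alpha>, \<beta>) \<in> H0 \<longleftrightarrow> isomorphic_nspaces ?X ?Y"
    "(\<alpha>, \<beta>) \<in> H0 \<longleftrightarrow> complementably_embeds ?X ?Y"
    using 12 23 34 41 by blast+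
qed

section \<open>A finite norming grid in the dual of $\ell_q^K$\<close>

text \<open>
  The functional with coefficients in $\frac{1}{2K}\mathbb{Z}$; the list holds their numerators, and
  its entry \<open>i - 1\<close> belongs to the coordinate \<open>i\<close>.
\<close>
definition grid_functional :: "nat \<Rightarrow> int list \<Rightarrow> (nat \<Rightarrow> real) \<Rightarrow> real" where
  "grid_functional K l v = (\<Sum>i=1..K. real_of_int (l ! (i - 1)) / (2 * real K) * v i)"

text \<open>
  The bound on the entries holds for all grid functionals in the dual unit ball; it makes the
  finiteness of the set evident.
\<close>
definition grid_ball :: "nat \<Rightarrow> real \<Rightarrow> int list set" where
  "grid_ball K q = {l. length l = K \<and> set l \<subseteq> {- 2 * int K..2 * int K} \<and>
     (\<forall>v. \<bar>grid_functional K l v\<bar> \<le> lq_norm K q v)}"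

definition grid_coordinate :: "nat \<Rightarrow> nat \<Rightarrow> int list" where
  "grid_coordinate K i = (replicate K 0)[i - 1 := 2 * int K]"

lemma finite_grid_ball: "finite (grid_ball K q)"
  by (rule finite_subset[OF _ finite_lists_length_eq[of "{- 2 * int K..2 * int K}" K]])
     (auto simp: grid_ball_def)

lemma grid_functional_coordinate:
  assumes "i \<in> {1..K}"
  shows "grid_functional K (grid_coordinate K i) v = v i"
proof -
  have "grid_functional K (grid_coordinate K i) v = (\<Sum>l=1..K. if l = i then v i else 0)"
    unfolding grid_functional_def
  proof (rule sum.cong[OF refl])
    fix l assume "l \<in> {1..K}"
    then show "real_of_int (grid_coordinate K i ! (l - 1)) / (2 * real K) * v l = (if l = i then v i else 0)"
      using assms by (auto simp: grid_coordinate_def nth_list_update)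
  qed
  then show ?thesis using assms by simp
qed

lemma grid_coordinate_in_ball:
  assumes "i \<in> {1..K}" "0 < q"
  shows "grid_coordinate K i \<in> grid_ball K q"
proof -
  have "set (grid_coordinate K i) \<subseteq> {- 2 * int K..2 * int K}"
    unfolding grid_coordinate_def by (rule order_trans[OF set_update_subset_insert]) auto
  moreover have "\<bar>grid_functional K (grid_coordinate K i) v\<bar> \<le> lq_norm K q v" for v
    unfolding grid_functional_coordinate[OF assms(1)] using assms by (intro abs_le_lq_norm) auto
  ultimately show ?thesis by (simp add: grid_ball_def grid_coordinate_def)
qed

lemma grid_functional_linear:
  "grid_functional K l (\<lambda>i. u i + v i) = grid_functional K l u + grid_functional K l v"
  "grid_functional K l (\<lambda>i. c * v i) = c * grid_functional K l v"
  by (simp_all only: grid_functional_def sum.distrib sum_distrib_left distrib_left mult.left_commute)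

lemma grid_functional_cong:
  "(\<And>i. i \<in> {1..K} \<Longrightarrow> u i = v i) \<Longrightarrow> grid_functional K l u = grid_functional K l v"
  by (simp add: grid_functional_def)

lemma young_conjugate:
  fixes a b q :: real
  assumes "1 < q" "0 \<le> a" "0 \<le> b"
  shows "a powr (q - 1) * b \<le> (1 - 1 / q) * a powr q + b powr q / q"
proof -
  define q' where "q' = q / (q - 1)"
  have q': "1 < q'" "1 / q' + 1 / q = 1" using assms by (simp_all add: q'_def field_simps)
  have "a powr (q - 1) * b \<le> (a powr (q - 1)) powr q' / q' + b powr q / q"
    using assms q' by (intro Youngs_inequality) auto
  also have "(a powr (q - 1)) powr q' = a powr q" using assms by (simp add: powr_powr q'_def)
  also have "a powr q / q' = (1 - 1 / q) * a powr q"
  proof -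
    have "1 / q' = 1 - 1 / q" using q'(2) by simp
    then show ?thesis by (simp add: divide_inverse mult.commute)
  qed
  finally show ?thesis .
qed

text \<open>
  For a vector $u$ of norm $1$ the functional with the coefficients $\mathrm{sgn}(u_i) |u_i|^{q-1}$ is
  norming. Rounding the coefficients towards $0$ to the grid does not leave the dual unit ball, and the
  value at $u$ drops by at most $\sum_i |u_i|/(2K) \le 1/2$.
\<close>
lemma grid_ball_norming:
  assumes q: "1 < q" and K: "1 \<le> K"
  obtains l where "l \<in> grid_ball K q" "lq_norm K q v \<le> 2 * grid_functional K l v"
proof (cases "lq_norm K q v = 0")
  case True
  have "0 < q" using q by simp
  then have "v 1 = 0" using abs_le_lq_norm[of q 1 K v] True K by simp
  moreover have "1 \<in> {1..K}" using K by simp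
  ultimately show ?thesis
    using that[OF grid_coordinate_in_ball[of 1 K q]] grid_functional_coordinate[of 1 K v] True \<open>0 < q\<close> by simp
next
  case False
  define M where "M = lq_norm K q v"
  have M: "0 < M" using False lq_norm_nonneg[of K q v] by (simp add: M_def order.strict_iff_order)
  define u where "u i = v i / M" for i
  have uq: "(\<Sum>i=1..K. \<bar>u i\<bar> powr q) = 1"
  proof -
    have "\<bar>u i\<bar> = \<bar>v i\<bar> / M" for i using M by (simp add: u_def)
    then show ?thesis using sum_powr_normalized[of q K v] q False by (simp add: M_def)
  qed
  have u1: "\<bar>u i\<bar> \<le> 1" if "i \<in> {1..K}" for i
    using abs_le_lq_norm[of q i K v] that q M by (simp add: u_def M_def)
  have rK: "0 < real K" using K by simp
  \<comment> \<open>\<open>c i / (2 * K)\<close> is the absolute value of the rounded coefficient and \<open>s i\<close> its sign.\<close>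
  define c where "c i = \<lfloor>2 * real K * \<bar>u i\<bar> powr (q - 1)\<rfloor>" for i
  have c0: "0 \<le> c i" for i by (simp add: c_def)
  have c_le: "real_of_int (c i) / (2 * real K) \<le> \<bar>u i\<bar> powr (q - 1)" for i
    using of_int_floor_le[of "2 * real K * \<bar>u i\<bar> powr (q - 1)"] rK by (simp add: c_def field_simps)
  have c_ge: "\<bar>u i\<bar> powr (q - 1) - 1 / (2 * real K) \<le> real_of_int (c i) / (2 * real K)" for i
  proof -
    have "2 * real K * \<bar>u i\<bar> powr (q - 1) - 1 \<le> real_of_int (c i)" unfolding c_def by linarith
    then have "(2 * real K * \<bar>u i\<bar> powr (q - 1) - 1) / (2 * real K) \<le> real_of_int (c i) / (2 * real K)"
      using rK by (intro divide_right_mono) auto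
    then show ?thesis using rK by (simp add: diff_divide_distrib)
  qed
  define s where "s i = (if v i < 0 then - 1 else 1 :: int)" for i
  define l where "l = map (\<lambda>j. s (Suc j) * c (Suc j)) [0..<K]"
  have nth: "l ! (i - 1) = s i * c i" if "i \<in> {1..K}" for i using that by (auto simp: l_def)
  have grid: "grid_functional K l w = (\<Sum>i=1..K. real_of_int (c i) / (2 * real K) * (real_of_int (s i) * w i))" for w
    unfolding grid_functional_def by (rule sum.cong) (simp_all add: nth mult_ac del: One_nat_def)
  have sgn: "real_of_int (s i) * v i = \<bar>v i\<bar>" for i by (simp add: s_def)
  have bound: "\<bar>grid_functional K l w\<bar> \<le> lq_norm K q w" for w
  proof (cases "lq_norm K q w = 0")
    case True
    have "w i = 0" if "i \<in> {1..K}" for i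
      using abs_le_lq_norm[of q i K w] that True q by simp
    then have "grid_functional K l w = 0" unfolding grid_functional_def by (intro sum.neutral) simp
    then show ?thesis by simp
  next
    case False
    define W where "W = lq_norm K q w"
    have W: "0 < W" using False lq_norm_nonneg[of K q w] by (simp add: W_def order.strict_iff_order)
    have "\<bar>grid_functional K l w\<bar> \<le> (\<Sum>i=1..K. \<bar>u i\<bar> powr (q - 1) * \<bar>w i\<bar>)"
      unfolding grid
    proof (rule order_trans[OF sum_abs sum_mono])
      fix i
      have "\<bar>real_of_int (c i) / (2 * real K) * (real_of_int (s i) * w i)\<bar> = real_of_int (c i) / (2 * real K) * \<bar>w i\<bar>"
        using c0[of i] by (simp add: abs_mult s_def)
      also have "\<dots> \<le> \<bar>u i\<bar> powr (q - 1) * \<bar>w i\<bar>" by (intro mult_right_mono c_le) auto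
      finally show "\<bar>real_of_int (c i) / (2 * real K) * (real_of_int (s i) * w i)\<bar> \<le> \<bar>u i\<bar> powr (q - 1) * \<bar>w i\<bar>" .
    qed
    also have "\<dots> = W * (\<Sum>i=1..K. \<bar>u i\<bar> powr (q - 1) * (\<bar>w i\<bar> / W))"
      using W by (simp add: sum_distrib_left)
    also have "\<dots> \<le> W * (\<Sum>i=1..K. (1 - 1 / q) * \<bar>u i\<bar> powr q + (\<bar>w i\<bar> / W) powr q / q)"
      using W q by (intro mult_left_mono sum_mono young_conjugate) auto
    also have "(\<Sum>i=1..K. (1 - 1 / q) * \<bar>u i\<bar> powr q + (\<bar>w i\<bar> / W) powr q / q)
        = (1 - 1 / q) * (\<Sum>i=1..K. \<bar>u i\<bar> powr q) + (\<Sum>i=1..K. (\<bar>w i\<bar> / W) powr q) / q"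
      by (simp only: sum.distrib sum_distrib_left sum_divide_distrib)
    also have "(\<Sum>i=1..K. (\<bar>w i\<bar> / W) powr q) = 1"
      unfolding W_def using q False by (intro sum_powr_normalized) auto
    finally show ?thesis unfolding uq by (simp add: W_def)
  qed
  have "c i \<le> 2 * int K" if "i \<in> {1..K}" for i
  proof -
    have "\<bar>u i\<bar> powr (q - 1) \<le> 1 powr (q - 1)" using u1[OF that] q by (intro powr_mono2) auto
    then have "2 * real K * \<bar>u i\<bar> powr (q - 1) \<le> 2 * real K * 1" by (intro mult_left_mono) auto
    then show ?thesis unfolding c_def by linarith
  qed
  then have "s i * c i \<in> {- 2 * int K..2 * int K}" if "i \<in> {1..K}" for i
    using c0[of i] that by (fastforce simp: s_def)
  then have "set l \<subseteq> {- 2 * int K..2 * int K}" unfolding l_def by fastforce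
  then have l: "l \<in> grid_ball K q" using bound by (simp add: grid_ball_def l_def)
  have "1 - 1 / 2 \<le> (\<Sum>i=1..K. \<bar>u i\<bar> powr q) - (\<Sum>i=1..K. 1 / (2 * real K))"
    unfolding uq using rK by simp
  also have "\<dots> \<le> (\<Sum>i=1..K. \<bar>u i\<bar> powr q - 1 / (2 * real K) * \<bar>u i\<bar>)"
    unfolding sum_subtractf[symmetric]
  proof (rule sum_mono)
    fix i assume "i \<in> {1..K}"
    then show "\<bar>u i\<bar> powr q - 1 / (2 * real K) \<le> \<bar>u i\<bar> powr q - 1 / (2 * real K) * \<bar>u i\<bar>"
      using mult_left_mono[OF u1, of i "1 / (2 * real K)"] by simp
  qed
  also have "\<dots> \<le> (\<Sum>i=1..K. real_of_int (c i) / (2 * real K) * \<bar>u i\<bar>)"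
  proof (rule sum_mono)
    fix i
    have "\<bar>u i\<bar> powr q = \<bar>u i\<bar> powr (q - 1) * \<bar>u i\<bar>"
      using q by (cases "u i = 0") (simp_all add: powr_diff)
    then have "\<bar>u i\<bar> powr q - 1 / (2 * real K) * \<bar>u i\<bar> = (\<bar>u i\<bar> powr (q - 1) - 1 / (2 * real K)) * \<bar>u i\<bar>"
      by (simp add: left_diff_distrib)
    also have "\<dots> \<le> real_of_int (c i) / (2 * real K) * \<bar>u i\<bar>" by (intro mult_right_mono c_ge) auto
    finally show "\<bar>u i\<bar> powr q - 1 / (2 * real K) * \<bar>u i\<bar> \<le> real_of_int (c i) / (2 * real K) * \<bar>u i\<bar>" .
  qed
  also have "\<dots> = grid_functional K l v / M"
    unfolding grid sgn using M by (simp add: u_def sum_divide_distrib)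
  finally have "M \<le> 2 * grid_functional K l v" using M by (simp add: field_simps)
  with that[OF l] show ?thesis by (simp add: M_def)
qed

section \<open>Copies of the $c_0$-sums inside $c_0$\<close>

lemma apply_Bcontfun_discrete:
  fixes f :: "'a::t2_space \<Rightarrow> real"
  assumes "\<And>a::'a. open {a}" "\<And>a. \<bar>f a\<bar> \<le> B"
  shows "apply_bcontfun (Bcontfun f) = f"
proof -
  have "continuous_on UNIV f"
    unfolding continuous_on_eq_continuous_within continuous_within
    by (simp add: at_within_def nhds_discrete_open[OF assms(1)])
  then have "f \<in> bcontfun" using assms(2) by (intro bcontfun_normI[where b = B]) auto
  then show ?thesis by (rule Bcontfun_inverse)
qed

lemma open_nat_pair: "open {a :: nat \<times> nat}"
  using open_Times[OF open_discrete[of "{fst a}"] open_discrete[of "{snd a}"]] by simp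

lemma tendsto_zero_iff_finite:
  fixes f :: "nat \<Rightarrow> real"
  shows "f \<longlonglongrightarrow> 0 \<longleftrightarrow> (\<forall>e>0. finite {m. e \<le> \<bar>f m\<bar>})"
  by (simp add: tendsto_iff cofinite_eq_sequentially[symmetric] eventually_cofinite not_less)

text \<open>
  The $m$-th coordinate of the image in $c_0$ of the vector with coefficients \<open>u n i\<close>, where \<open>m\<close> codes a
  block and a grid functional. The coordinates that code no functional of the dual unit ball vanish.
  Thus the place of a functional in $c_0$ does not depend on the exponents, and the exponents only
  decide which coordinates are used.
\<close>
definition block_form :: "(nat \<Rightarrow> nat) \<Rightarrow> (nat \<Rightarrow> real) \<Rightarrow> nat \<Rightarrow> (nat \<Rightarrow> nat \<Rightarrow> real) \<Rightarrow> real" where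
  "block_form K q m u = (case from_nat m of (n, l) \<Rightarrow>
     if m = to_nat (n, l) \<and> 1 \<le> n \<and> l \<in> grid_ball (K n) (q n) then grid_functional (K n) l (u n) else 0)"

text \<open>
  The coefficients of a vector can be read off its image in $c_0$ because the coordinate functionals
  belong to the grid.
\<close>
definition grid_value :: "(nat \<Rightarrow> nat) \<Rightarrow> (nat \<Rightarrow>\<^sub>C real) \<Rightarrow> nat \<Rightarrow> nat \<Rightarrow> real" where
  "grid_value K y n i = apply_bcontfun y (to_nat (n, grid_coordinate (K n) i))"

text \<open>
  The range of the embedding, described by linear equations between the coordinates: each coordinate
  is determined by those of the coordinate functionals of the same block. In this form it is evidently
  closed, and depends on the exponents block by block.
\<close>
definition c0_copy :: "(nat \<Rightarrow> nat) \<Rightarrow> (nat \<Rightarrow> real) \<Rightarrow> (nat \<Rightarrow>\<^sub>C real) set" where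
  "c0_copy K q = {y \<in> c0. \<forall>m. apply_bcontfun y m = block_form K q m (grid_value K y)}"

definition grid_embed :: "(nat \<Rightarrow> nat) \<Rightarrow> (nat \<Rightarrow> real) \<Rightarrow> ((nat \<times> nat) \<Rightarrow>\<^sub>C real) \<Rightarrow> (nat \<Rightarrow>\<^sub>C real)" where
  "grid_embed K q x = Bcontfun (\<lambda>m. block_form K q m (\<lambda>n i. apply_bcontfun x (n, i)))"

definition coefficients :: "(nat \<Rightarrow> nat) \<Rightarrow> (nat \<Rightarrow>\<^sub>C real) \<Rightarrow> ((nat \<times> nat) \<Rightarrow>\<^sub>C real)" where
  "coefficients K y = Bcontfun (\<lambda>(n, i). if 1 \<le> n \<and> 1 \<le> i \<and> i \<le> K n then grid_value K y n i else 0)"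

lemma c0_copyD:
  assumes "y \<in> c0_copy K q"
  shows "apply_bcontfun y \<longlonglongrightarrow> 0" "apply_bcontfun y m = block_form K q m (grid_value K y)"
  using assms unfolding c0_copy_def c0_def by blast+

lemma c0_copyI:
  assumes "apply_bcontfun y \<longlonglongrightarrow> 0" "\<And>m. apply_bcontfun y m = block_form K q m (grid_value K y)"
  shows "y \<in> c0_copy K q"
  using assms unfolding c0_copy_def c0_def by blast

lemma block_form_code:
  "1 \<le> n \<Longrightarrow> l \<in> grid_ball (K n) (q n) \<Longrightarrow> block_form K q (to_nat (n, l)) u = grid_functional (K n) l (u n)"
  by (simp add: block_form_def)

lemma block_form_cases:
  obtains (zero) "\<And>u. block_form K q m u = 0"
  | (form) n l where "m = to_nat (n, l)" "1 \<le> n" "l \<in> grid_ball (K n) (q n)"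
      "\<And>u. block_form K q m u = grid_functional (K n) l (u n)"
proof -
  obtain n l where nl: "(from_nat m :: nat \<times> int list) = (n, l)" by fastforce
  show ?thesis
  proof (cases "m = to_nat (n, l) \<and> 1 \<le> n \<and> l \<in> grid_ball (K n) (q n)")
    case True
    then show ?thesis using that(2)[of n l] block_form_code[of n l K q] by blast
  next
    case False
    have "block_form K q m u = 0" for u using False by (auto simp: block_form_def nl)
    then show ?thesis by (rule that(1))
  qed
qed

lemma block_form_add: "block_form K q m (\<lambda>n i. u n i + v n i) = block_form K q m u + block_form K q m v"
  by (rule block_form_cases[of K q m]) (simp_all add: grid_functional_linear)

lemma block_form_scale: "block_form K q m (\<lambda>n i. c * u n i) = c * block_form K q m u"
  by (rule block_form_cases[of K q m]) (simp_all add: grid_functional_linear)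

lemma block_form_cong:
  assumes "\<And>n i. 1 \<le> n \<Longrightarrow> i \<in> {1..K n} \<Longrightarrow> u n i = v n i"
  shows "block_form K q m u = block_form K q m v"
  by (rule block_form_cases[of K q m]) (use assms in \<open>auto intro!: grid_functional_cong simp del: One_nat_def\<close>)

lemma block_form_le:
  assumes "\<And>n. 1 \<le> n \<Longrightarrow> lq_norm (K n) (q n) (u n) \<le> b" "0 \<le> b"
  shows "\<bar>block_form K q m u\<bar> \<le> b"
proof (cases rule: block_form_cases[of K q m])
  case zero
  then show ?thesis using assms(2) by simp
next
  case (form n l)
  have "\<bar>grid_functional (K n) l (u n)\<bar> \<le> lq_norm (K n) (q n) (u n)"
    using form(3) by (simp add: grid_ball_def)
  then show ?thesis using assms(1)[OF form(2)] form(4) by simp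
qed

lemma block_form_coordinate:
  assumes "1 \<le> n" "i \<in> {1..K n}" "0 < q n"
  shows "block_form K q (to_nat (n, grid_coordinate (K n) i)) u = u n i"
proof -
  have "grid_coordinate (K n) i \<in> grid_ball (K n) (q n)" by (rule grid_coordinate_in_ball[OF assms(2,3)])
  then show ?thesis
    using block_form_code[of n "grid_coordinate (K n) i" K q u] assms(1)
      grid_functional_coordinate[OF assms(2), of "u n"] by simp
qed

lemma apply_coefficients:
  "apply_bcontfun (coefficients K y) (n, i) = (if 1 \<le> n \<and> 1 \<le> i \<and> i \<le> K n then grid_value K y n i else 0)"
proof -
  have "\<bar>case a of (n, i) \<Rightarrow> if 1 \<le> n \<and> 1 \<le> i \<and> i \<le> K n then grid_value K y n i else 0\<bar> \<le> norm y" for a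
    using norm_bounded[of y] by (auto simp: grid_value_def split: prod.split)
  then show ?thesis unfolding coefficients_def by (subst apply_Bcontfun_discrete[OF open_nat_pair]) auto
qed

lemma apply_grid_embed:
  assumes "x \<in> vecs (c0_sum_lq K q)"
  shows "apply_bcontfun (grid_embed K q x) m = block_form K q m (\<lambda>n i. apply_bcontfun x (n, i))"
  unfolding grid_embed_def
  by (subst apply_Bcontfun_discrete[where B = "nrm (c0_sum_lq K q) x"])
     (auto intro!: block_form_le nrm_nonneg[OF assms] block_le_nrm[OF assms] open_discrete)

lemma grid_value_grid_embed:
  assumes "x \<in> vecs (c0_sum_lq K q)" "1 \<le> n" "i \<in> {1..K n}" "0 < q n"
  shows "grid_value K (grid_embed K q x) n i = apply_bcontfun x (n, i)"
  unfolding grid_value_def apply_grid_embed[OF assms(1)] by (rule block_form_coordinate) fact+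

lemma grid_embed_in_c0_copy:
  assumes x: "x \<in> vecs (c0_sum_lq K q)" and q: "\<And>n. 1 \<le> n \<Longrightarrow> 0 < q n"
  shows "grid_embed K q x \<in> c0_copy K q"
proof -
  let ?f = "\<lambda>m. block_form K q m (\<lambda>n i. apply_bcontfun x (n, i))"
  have lim: "(\<lambda>n. lq_norm (K n) (q n) (\<lambda>i. apply_bcontfun x (n, i))) \<longlonglongrightarrow> 0"
    using x unfolding vecs_c0_sum_lq by blast
  have "finite {m. e \<le> \<bar>?f m\<bar>}" if e: "0 < e" for e
  proof -
    have fin: "finite {n. e \<le> \<bar>lq_norm (K n) (q n) (\<lambda>i. apply_bcontfun x (n, i))\<bar>}"
      using lim e unfolding tendsto_zero_iff_finite by blast
    have "{m. e \<le> \<bar>?f m\<bar>} \<subseteq> to_nat ` (SIGMA n:{n. e \<le> \<bar>lq_norm (K n) (q n) (\<lambda>i. apply_bcontfun x (n, i))\<bar>}.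
        grid_ball (K n) (q n))"
    proof
      fix m assume "m \<in> {m. e \<le> \<bar>?f m\<bar>}"
      then have m: "e \<le> \<bar>?f m\<bar>" by simp
      show "m \<in> to_nat ` (SIGMA n:{n. e \<le> \<bar>lq_norm (K n) (q n) (\<lambda>i. apply_bcontfun x (n, i))\<bar>}. grid_ball (K n) (q n))"
      proof (cases rule: block_form_cases[of K q m])
        case zero
        then show ?thesis using m e by simp
      next
        case (form n l)
        have "\<bar>?f m\<bar> \<le> lq_norm (K n) (q n) (\<lambda>i. apply_bcontfun x (n, i))"
          using form(3) unfolding form(4) by (simp add: grid_ball_def)
        then have "(n, l) \<in> (SIGMA n:{n. e \<le> \<bar>lq_norm (K n) (q n) (\<lambda>i. apply_bcontfun x (n, i))\<bar>}. grid_ball (K n) (q n))"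
          using m form(3) by auto
        then show ?thesis using form(1) by blast
      qed
    qed
    then show ?thesis
      by (rule finite_subset) (intro finite_imageI finite_SigmaI fin finite_grid_ball)
  qed
  then have "?f \<longlonglongrightarrow> 0" unfolding tendsto_zero_iff_finite by blast
  then have c0: "grid_embed K q x \<in> c0" by (simp add: c0_def apply_grid_embed[OF x, abs_def])
  have "apply_bcontfun (grid_embed K q x) m = block_form K q m (grid_value K (grid_embed K q x))" for m
    unfolding apply_grid_embed[OF x]
    by (rule block_form_cong) (rule grid_value_grid_embed[OF x, symmetric], assumption, assumption, rule q)
  with c0 show ?thesis by (simp add: c0_copy_def)
qed

lemma lq_norm_coefficients:
  assumes y: "y \<in> c0_copy K q" and K: "1 \<le> K n" and q: "1 < q n" and n: "1 \<le> n"
  obtains l where "lq_norm (K n) (q n) (\<lambda>i. apply_bcontfun (coefficients K y) (n, i)) \<le> 2 * apply_bcontfun y (to_nat (n, l :: int list))"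
proof -
  obtain l where l: "l \<in> grid_ball (K n) (q n)"
    "lq_norm (K n) (q n) (grid_value K y n) \<le> 2 * grid_functional (K n) l (grid_value K y n)"
    by (rule grid_ball_norming[OF q K, of "grid_value K y n"])
  have "apply_bcontfun y (to_nat (n, l)) = block_form K q (to_nat (n, l)) (grid_value K y)"
    by (rule c0_copyD(2)[OF y])
  also have "\<dots> = grid_functional (K n) l (grid_value K y n)"
    by (rule block_form_code[OF n]) (rule l(1))
  finally have val: "apply_bcontfun y (to_nat (n, l)) = grid_functional (K n) l (grid_value K y n)" .
  have "lq_norm (K n) (q n) (\<lambda>i. apply_bcontfun (coefficients K y) (n, i)) = lq_norm (K n) (q n) (grid_value K y n)"
  proof (rule lq_norm_cong)
    fix i assume "i \<in> {1..K n}"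
    then show "apply_bcontfun (coefficients K y) (n, i) = grid_value K y n i"
      using n by (simp add: apply_coefficients)
  qed
  then show ?thesis using l(2) by (intro that[of l]) (simp only: val)
qed

text \<open>
  The norm of block $n$ is at most twice a coordinate of $y$ that belongs to this block. These
  coordinates are different for different $n$, hence tend to $0$.
\<close>
lemma coefficients_in_vecs:
  assumes y: "y \<in> c0_copy K q" and K: "\<And>n. 1 \<le> n \<Longrightarrow> 1 \<le> K n" and q: "\<And>n. 1 \<le> n \<Longrightarrow> 1 < q n"
  shows "coefficients K y \<in> vecs (c0_sum_lq K q)"
proof -
  let ?N = "\<lambda>n. lq_norm (K n) (q n) (\<lambda>i. apply_bcontfun (coefficients K y) (n, i))"
  have "\<exists>l. ?N n \<le> 2 * apply_bcontfun y (to_nat (n, l :: int list))" if "1 \<le> n" for n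
    using lq_norm_coefficients[OF y K[OF that] q[OF that] that] by blast
  then obtain l where l: "\<And>n. 1 \<le> n \<Longrightarrow> ?N n \<le> 2 * apply_bcontfun y (to_nat (n, l n :: int list))"
    by metis
  have y0: "apply_bcontfun y \<longlonglongrightarrow> 0" by (rule c0_copyD(1)[OF y])
  have "inj (\<lambda>n. to_nat (n, l n))" by (intro injI) simp
  have "finite {n. e \<le> \<bar>?N n\<bar>}" if e: "0 < e" for e
  proof -
    have "finite {m. e / 2 \<le> \<bar>apply_bcontfun y m\<bar>}"
      using y0 half_gt_zero[OF e] unfolding tendsto_zero_iff_finite by blast
    then have "finite ((\<lambda>n. to_nat (n, l n)) -` {m. e / 2 \<le> \<bar>apply_bcontfun y m\<bar>})"
      by (rule finite_vimageI) fact
    \<comment> \<open>Block \<open>0\<close> is not part of the sum, so the estimate by a coordinate fails there.\<close>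
    then have "finite (insert 0 ((\<lambda>n. to_nat (n, l n)) -` {m. e / 2 \<le> \<bar>apply_bcontfun y m\<bar>}))" by simp
    moreover have "{n. e \<le> \<bar>?N n\<bar>} \<subseteq> insert 0 ((\<lambda>n. to_nat (n, l n)) -` {m. e / 2 \<le> \<bar>apply_bcontfun y m\<bar>})"
    proof
      fix n assume "n \<in> {n. e \<le> \<bar>?N n\<bar>}"
      then have N: "e \<le> ?N n" by simp
      show "n \<in> insert 0 ((\<lambda>n. to_nat (n, l n)) -` {m. e / 2 \<le> \<bar>apply_bcontfun y m\<bar>})"
      proof (cases "n = 0")
        case False
        then have "1 \<le> n" by simp
        from l[OF this] N have "e / 2 \<le> \<bar>apply_bcontfun y (to_nat (n, l n))\<bar>" by linarith
        then show ?thesis by simp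
      qed simp
    qed
    ultimately show ?thesis by (rule finite_subset[rotated])
  qed
  then have "?N \<longlonglongrightarrow> 0" unfolding tendsto_zero_iff_finite by blast
  moreover have "\<forall>n i. \<not> (1 \<le> n \<and> 1 \<le> i \<and> i \<le> K n) \<longrightarrow> apply_bcontfun (coefficients K y) (n, i) = 0"
    unfolding apply_coefficients by (intro allI impI if_not_P)
  ultimately show ?thesis unfolding vecs_c0_sum_lq by blast
qed

lemma grid_embed_coefficients:
  assumes y: "y \<in> c0_copy K q" and K: "\<And>n. 1 \<le> n \<Longrightarrow> 1 \<le> K n" and q: "\<And>n. 1 \<le> n \<Longrightarrow> 1 < q n"
  shows "grid_embed K q (coefficients K y) = y"
proof (rule bcontfun_eqI)
  fix m
  have v: "coefficients K y \<in> vecs (c0_sum_lq K q)" by (rule coefficients_in_vecs[OF y]) (fact K q)+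
  have "apply_bcontfun (grid_embed K q (coefficients K y)) m = block_form K q m (grid_value K y)"
    unfolding apply_grid_embed[OF v]
    by (rule block_form_cong) (simp add: apply_coefficients)
  then show "apply_bcontfun (grid_embed K q (coefficients K y)) m = apply_bcontfun y m"
    using y by (simp add: c0_copy_def)
qed

lemma coefficients_grid_embed:
  assumes x: "x \<in> vecs (c0_sum_lq K q)" and q: "\<And>n. 1 \<le> n \<Longrightarrow> 0 < q n"
  shows "coefficients K (grid_embed K q x) = x"
proof (rule bcontfun_eqI)
  fix a :: "nat \<times> nat"
  obtain n i where a: "a = (n, i)" by fastforce
  show "apply_bcontfun (coefficients K (grid_embed K q x)) a = apply_bcontfun x a"
  proof (cases "1 \<le> n \<and> 1 \<le> i \<and> i \<le> K n")
    case True
    then show ?thesis using grid_value_grid_embed[OF x, of n i] q[of n] by (simp add: a apply_coefficients)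
  next
    case False
    then have "apply_bcontfun x (n, i) = 0" using x unfolding vecs_c0_sum_lq by blast
    then show ?thesis using False by (auto simp: a apply_coefficients)
  qed
qed

lemma bounded_linear_grid_embed:
  assumes q: "\<And>n. 1 \<le> n \<Longrightarrow> 1 \<le> q n"
  shows "bounded_linear_between (c0_sum_lq K q) (as_nspace (c0_copy K q)) (grid_embed K q)"
  unfolding bounded_linear_between_def nspace.simps
proof (intro conjI ballI allI)
  have q0: "0 < q n" if "1 \<le> n" for n using q[OF that] by simp
  show "grid_embed K q ` vecs (c0_sum_lq K q) \<subseteq> c0_copy K q"
    using grid_embed_in_c0_copy q0 by blast
  fix x y assume x: "x \<in> vecs (c0_sum_lq K q)" and y: "y \<in> vecs (c0_sum_lq K q)"
  have xy: "x + y \<in> vecs (c0_sum_lq K q)" by (rule vecs_add[OF x y]) (rule q)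
  show "grid_embed K q (x + y) = grid_embed K q x + grid_embed K q y"
  proof (rule bcontfun_eqI)
    fix m show "apply_bcontfun (grid_embed K q (x + y)) m = apply_bcontfun (grid_embed K q x + grid_embed K q y) m"
      unfolding plus_bcontfun.rep_eq apply_grid_embed[OF x] apply_grid_embed[OF y] apply_grid_embed[OF xy]
      by (rule block_form_add)
  qed
next
  fix c x assume x: "x \<in> vecs (c0_sum_lq K q)"
  have cx: "c *\<^sub>R x \<in> vecs (c0_sum_lq K q)" by (rule vecs_scaleR[OF x]) (rule q)
  show "grid_embed K q (c *\<^sub>R x) = c *\<^sub>R grid_embed K q x"
  proof (rule bcontfun_eqI)
    fix m show "apply_bcontfun (grid_embed K q (c *\<^sub>R x)) m = apply_bcontfun (c *\<^sub>R grid_embed K q x) m"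
      unfolding scaleR_bcontfun.rep_eq apply_grid_embed[OF x] apply_grid_embed[OF cx] real_scaleR_def
      by (rule block_form_scale)
  qed
next
  show "\<exists>C. \<forall>x\<in>vecs (c0_sum_lq K q). norm (grid_embed K q x) \<le> C * nrm (c0_sum_lq K q) x"
  proof (intro exI[of _ 1] ballI)
    fix x assume x: "x \<in> vecs (c0_sum_lq K q)"
    have "norm (apply_bcontfun (grid_embed K q x) m) \<le> nrm (c0_sum_lq K q) x" for m
      unfolding apply_grid_embed[OF x] real_norm_def
      by (rule block_form_le[OF block_le_nrm[OF x] nrm_nonneg[OF x]])
    then show "norm (grid_embed K q x) \<le> 1 * nrm (c0_sum_lq K q) x" by (simp add: norm_bound)
  qed
qed

lemma bounded_linear_coefficients:
  assumes K: "\<And>n. 1 \<le> n \<Longrightarrow> 1 \<le> K n" and q: "\<And>n. 1 \<le> n \<Longrightarrow> 1 < q n"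
  shows "bounded_linear_between (as_nspace (c0_copy K q)) (c0_sum_lq K q) (coefficients K)"
  unfolding bounded_linear_between_def nspace.simps
proof (intro conjI ballI allI)
  show "coefficients K ` c0_copy K q \<subseteq> vecs (c0_sum_lq K q)"
    using coefficients_in_vecs K q by blast
  fix x y
  show "coefficients K (x + y) = coefficients K x + coefficients K y"
    by (rule bcontfun_eqI) (auto simp: plus_bcontfun.rep_eq apply_coefficients grid_value_def)
next
  fix c x
  show "coefficients K (c *\<^sub>R x) = c *\<^sub>R coefficients K x"
    by (rule bcontfun_eqI) (auto simp: scaleR_bcontfun.rep_eq apply_coefficients grid_value_def)
next
  show "\<exists>C. \<forall>y\<in>c0_copy K q. nrm (c0_sum_lq K q) (coefficients K y) \<le> C * norm y"
  proof (intro exI[of _ 2] ballI nrm_le)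
    fix y n assume y: "y \<in> c0_copy K q" and n: "1 \<le> (n :: nat)"
    obtain l :: "int list" where "lq_norm (K n) (q n) (\<lambda>i. apply_bcontfun (coefficients K y) (n, i)) \<le> 2 * apply_bcontfun y (to_nat (n, l))"
      by (rule lq_norm_coefficients[OF y K[OF n] q[OF n] n])
    moreover have "apply_bcontfun y (to_nat (n, l)) \<le> norm y"
      using norm_bounded[of y "to_nat (n, l)"] by simp
    ultimately show "lq_norm (K n) (q n) (\<lambda>i. apply_bcontfun (coefficients K y) (n, i)) \<le> 2 * norm y" by linarith
  qed
qed

lemma c0_copy_closed_subspace: "c0_copy K q \<in> closed_subspaces c0"
proof -
  have "subspace (c0_copy K q)"
  proof (rule subspaceI)
    have "block_form K q m (\<lambda>n i. 0) = 0" for m using block_form_scale[of K q m 0] by simp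
    then show "0 \<in> c0_copy K q"
      by (simp add: c0_copy_def c0_def grid_value_def[abs_def] zero_bcontfun.rep_eq[abs_def])
  next
    fix x y assume x: "x \<in> c0_copy K q" and y: "y \<in> c0_copy K q"
    have lim: "(\<lambda>m. apply_bcontfun x m + apply_bcontfun y m) \<longlonglongrightarrow> 0"
      using tendsto_add[OF c0_copyD(1)[OF x] c0_copyD(1)[OF y]] by simp
    have gv: "grid_value K (x + y) = (\<lambda>n i. grid_value K x n i + grid_value K y n i)"
      by (intro ext) (simp add: grid_value_def plus_bcontfun.rep_eq)
    show "x + y \<in> c0_copy K q"
    proof (rule c0_copyI)
      show "apply_bcontfun (x + y) \<longlonglongrightarrow> 0" using lim by (simp add: plus_bcontfun.rep_eq[abs_def])
      show "apply_bcontfun (x + y) m = block_form K q m (grid_value K (x + y))" for m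
        unfolding gv block_form_add plus_bcontfun.rep_eq
        by (rule arg_cong2[of _ _ _ _ "(+)", OF c0_copyD(2)[OF x] c0_copyD(2)[OF y]])
    qed
  next
    fix c x assume x: "x \<in> c0_copy K q"
    have lim: "(\<lambda>m. c * apply_bcontfun x m) \<longlonglongrightarrow> 0"
      using tendsto_mult_left[OF c0_copyD(1)[OF x], of c] by simp
    have gv: "grid_value K (c *\<^sub>R x) = (\<lambda>n i. c * grid_value K x n i)"
      by (intro ext) (simp add: grid_value_def scaleR_bcontfun.rep_eq)
    show "c *\<^sub>R x \<in> c0_copy K q"
    proof (rule c0_copyI)
      show "apply_bcontfun (c *\<^sub>R x) \<longlonglongrightarrow> 0" using lim by (simp add: scaleR_bcontfun.rep_eq[abs_def])
      show "apply_bcontfun (c *\<^sub>R x) m = block_form K q m (grid_value K (c *\<^sub>R x))" for m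
        unfolding gv block_form_scale scaleR_bcontfun.rep_eq real_scaleR_def
        by (rule arg_cong[OF c0_copyD(2)[OF x]])
    qed
  qed
  moreover have "closed (c0_copy K q)"
    unfolding closed_sequential_limits
  proof (intro allI impI, elim conjE)
    fix y l assume y: "\<forall>k::nat. y k \<in> c0_copy K q" and lim: "y \<longlonglongrightarrow> l"
    have pt: "(\<lambda>k. apply_bcontfun (y k) m) \<longlonglongrightarrow> apply_bcontfun l m" for m
      using tendsto_bcontfun_uniform_limit[OF lim] by (rule tendsto_uniform_limitI) simp
    have bf: "(\<lambda>k. block_form K q m (grid_value K (y k))) \<longlonglongrightarrow> block_form K q m (grid_value K l)" for m
    proof (cases rule: block_form_cases[of K q m])
      case (form n j)
      show ?thesis
        unfolding form(4) grid_functional_def grid_value_def by (intro tendsto_sum tendsto_mult tendsto_const pt)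
    qed simp
    have eq: "apply_bcontfun l m = block_form K q m (grid_value K l)" for m
    proof (rule LIMSEQ_unique[OF pt])
      have "apply_bcontfun (y k) m = block_form K q m (grid_value K (y k))" for k
        using y unfolding c0_copy_def by blast
      then show "(\<lambda>k. apply_bcontfun (y k) m) \<longlonglongrightarrow> block_form K q m (grid_value K l)"
        using bf by simp
    qed
    have "apply_bcontfun l \<longlonglongrightarrow> 0"
    proof (rule swap_uniform_limit'[where f = "\<lambda>k. apply_bcontfun (y k)" and g = "\<lambda>_. 0" and F = sequentially and S = UNIV])
      show "\<forall>\<^sub>F k in sequentially. (apply_bcontfun (y k) \<longlongrightarrow> 0) sequentially"
        using y by (intro always_eventually allI c0_copyD(1)) blast
      show "uniform_limit UNIV (\<lambda>k. apply_bcontfun (y k)) (apply_bcontfun l) sequentially"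
        by (rule tendsto_bcontfun_uniform_limit[OF lim])
    qed auto
    with eq show "l \<in> c0_copy K q" by (intro c0_copyI)
  qed
  ultimately show ?thesis by (auto simp: closed_subspaces_def c0_copy_def)
qed

lemma c0_copy_add: "x \<in> c0_copy K q \<Longrightarrow> y \<in> c0_copy K q \<Longrightarrow> x + y \<in> c0_copy K q"
  and c0_copy_scaleR: "x \<in> c0_copy K q \<Longrightarrow> c *\<^sub>R x \<in> c0_copy K q"
  using c0_copy_closed_subspace[of K q] by (auto simp: closed_subspaces_def subspace_add subspace_scale)

definition truncate :: "nat \<Rightarrow> (nat \<Rightarrow>\<^sub>C real) \<Rightarrow> (nat \<Rightarrow>\<^sub>C real)" where
  "truncate N y = Bcontfun (\<lambda>m. if fst (from_nat m :: nat \<times> int list) \<le> N then apply_bcontfun y m else 0)"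

lemma apply_truncate:
  "apply_bcontfun (truncate N y) m = (if fst (from_nat m :: nat \<times> int list) \<le> N then apply_bcontfun y m else 0)"
  unfolding truncate_def
  by (subst apply_Bcontfun_discrete[where B = "norm y"])
     (use norm_bounded[of y] in \<open>auto intro: open_discrete\<close>)

lemma truncate_in_c0_copy:
  assumes y: "y \<in> c0_copy K q"
  shows "truncate N y \<in> c0_copy K q"
proof -
  have gv: "grid_value K (truncate N y) n = (\<lambda>i. (if n \<le> N then 1 else 0) * grid_value K y n i)" for n
    by (rule ext) (simp add: grid_value_def apply_truncate)
  have "apply_bcontfun (truncate N y) m = block_form K q m (grid_value K (truncate N y))" for m
  proof (cases rule: block_form_cases[of K q m])
    case zero
    then show ?thesis using y by (simp add: apply_truncate c0_copy_def)
  next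
    case (form n l)
    have "apply_bcontfun y m = grid_functional (K n) l (grid_value K y n)"
      using y form(4) by (simp add: c0_copy_def)
    moreover have "fst (from_nat m :: nat \<times> int list) = n" using form(1) by simp
    ultimately show ?thesis unfolding form(4) gv grid_functional_linear by (simp add: apply_truncate)
  qed
  moreover have "apply_bcontfun (truncate N y) \<longlonglongrightarrow> 0"
  proof -
    have "finite {m. e \<le> \<bar>apply_bcontfun (truncate N y) m\<bar>}" if e: "0 < e" for e
    proof (rule finite_subset)
      show "finite {m. e \<le> \<bar>apply_bcontfun y m\<bar>}"
        using c0_copyD(1)[OF y] e unfolding tendsto_zero_iff_finite by blast
      show "{m. e \<le> \<bar>apply_bcontfun (truncate N y) m\<bar>} \<subseteq> {m. e \<le> \<bar>apply_bcontfun y m\<bar>}"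
        using e by (auto simp: apply_truncate split: if_splits)
    qed
    then show ?thesis unfolding tendsto_zero_iff_finite by blast
  qed
  ultimately show ?thesis by (intro c0_copyI)
qed

lemma truncate_approximates:
  assumes y: "y \<in> c0" and e: "0 < e"
  obtains N where "dist (truncate N y) y \<le> e"
proof -
  have "finite {m. e \<le> \<bar>apply_bcontfun y m\<bar>}"
    using y e tendsto_zero_iff_finite[of "apply_bcontfun y"] by (simp add: c0_def)
  then have "finite ((\<lambda>m. fst (from_nat m :: nat \<times> int list)) ` {m. e \<le> \<bar>apply_bcontfun y m\<bar>})" by simp
  then obtain N where N: "\<And>m. e \<le> \<bar>apply_bcontfun y m\<bar> \<Longrightarrow> fst (from_nat m :: nat \<times> int list) \<le> N"
    unfolding finite_nat_set_iff_bounded_le by blast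
  have "dist (truncate N y) y \<le> e"
  proof (rule dist_bound)
    fix m show "dist (apply_bcontfun (truncate N y) m) (apply_bcontfun y m) \<le> e"
    proof (cases "fst (from_nat m :: nat \<times> int list) \<le> N")
      case False
      then have "\<bar>apply_bcontfun y m\<bar> < e" using N[of m] by linarith
      with False show ?thesis by (simp add: apply_truncate dist_real_def)
    qed (use e in \<open>simp add: apply_truncate\<close>)
  qed
  then show ?thesis by (rule that)
qed

text \<open>
  The equations in the definition of the copy only relate coordinates of one block, and after
  truncation those of the blocks beyond $N$ hold trivially.
\<close>
lemma truncate_c0_copy_local:
  assumes eq: "\<And>n. n \<in> {1..N} \<Longrightarrow> q n = r n" and y: "y \<in> c0_copy K q"
  shows "truncate N y \<in> c0_copy K r"
proof -
  let ?z = "truncate N y"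
  have z: "?z \<in> c0_copy K q" by (rule truncate_in_c0_copy[OF y])
  have z0: "grid_value K ?z n = (\<lambda>i. 0)" if "\<not> n \<le> N" for n
    using that by (intro ext) (simp add: grid_value_def apply_truncate)
  have "block_form K q m (grid_value K ?z) = block_form K r m (grid_value K ?z)" for m
  proof -
    obtain n l where nl: "(from_nat m :: nat \<times> int list) = (n, l)" by fastforce
    show ?thesis
    proof (cases "1 \<le> n \<and> n \<le> N")
      case True
      then show ?thesis using eq[of n] by (simp add: block_form_def nl)
    next
      case False
      then show ?thesis using z0[of n] by (auto simp: block_form_def nl grid_functional_def)
    qed
  qed
  then have "apply_bcontfun ?z m = block_form K r m (grid_value K ?z)" for m
    using c0_copyD(2)[OF z] by simp
  with c0_copyD(1)[OF z] show ?thesis by (rule c0_copyI)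
qed

section \<open>Borel reductions to relations between subspaces of $c_0$\<close>

abbreviation sum_space :: "(nat \<Rightarrow> nat) \<Rightarrow> ((nat \<times> nat) \<Rightarrow>\<^sub>C real) nspace" where
  "sum_space \<alpha> \<equiv> c0_sum_lq dims (exponent \<alpha>)"

abbreviation copy :: "(nat \<Rightarrow> nat) \<Rightarrow> (nat \<Rightarrow>\<^sub>C real) set" where
  "copy \<alpha> \<equiv> c0_copy dims (exponent \<alpha>)"

lemma bounded_linear_into_copy: "bounded_linear_between (sum_space \<alpha>) (as_nspace (copy \<alpha>)) (grid_embed dims (exponent \<alpha>))"
  by (rule bounded_linear_grid_embed) (rule less_imp_le[OF exponent_gt_1])

lemma bounded_linear_from_copy: "bounded_linear_between (as_nspace (copy \<alpha>)) (sum_space \<alpha>) (coefficients dims)"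
  by (rule bounded_linear_coefficients) (auto intro: order_trans[OF _ dims_ge_2] exponent_gt_1)

lemma coefficients_of_copy:
  assumes "x \<in> vecs (sum_space \<alpha>)"
  shows "coefficients dims (grid_embed dims (exponent \<alpha>) x) = x"
  by (rule coefficients_grid_embed[OF assms]) (rule less_trans[OF zero_less_one exponent_gt_1])

lemma copy_of_coefficients:
  assumes "y \<in> copy \<alpha>"
  shows "grid_embed dims (exponent \<alpha>) (coefficients dims y) = y"
proof (rule grid_embed_coefficients[OF assms])
  show "1 \<le> dims n" if "1 \<le> n" for n using dims_ge_2[OF that] by simp
qed (rule exponent_gt_1)

lemma H0_imp_isomorphic_copies:
  assumes "(\<alpha>, \<beta>) \<in> H0"
  shows "isomorphic_nspaces (as_nspace (copy \<alpha>)) (as_nspace (copy \<beta>))"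
proof -
  have vecs: "vecs (sum_space \<alpha>) = vecs (sum_space \<beta>)"
    using H0_identity_isomorphism[OF assms] by (simp add: isomorphism_between_def bij_betw_def)
  have bl: "bounded_linear_between (as_nspace (copy \<gamma>)) (as_nspace (copy \<delta>))
      (\<lambda>y. grid_embed dims (exponent \<delta>) (coefficients dims y))" if "(\<gamma>, \<delta>) \<in> H0" for \<gamma> \<delta>
  proof -
    have id: "bounded_linear_between (sum_space \<gamma>) (sum_space \<delta>) (\<lambda>x. x)"
      using H0_identity_isomorphism[OF that] by (simp add: isomorphism_between_def)
    show ?thesis
      by (rule bounded_linear_between_compose[OF
            bounded_linear_between_compose[OF bounded_linear_from_copy id] bounded_linear_into_copy])
         (rule nrm_nonneg, assumption)+
  qed
  have "isomorphism_between (as_nspace (copy \<alpha>)) (as_nspace (copy \<beta>))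
      (\<lambda>y. grid_embed dims (exponent \<beta>) (coefficients dims y))"
  proof (rule isomorphism_betweenI[OF bl[OF assms] bl[OF H0_sym[OF assms]]], unfold nspace.simps)
    have coeff: "coefficients dims y \<in> vecs (sum_space \<gamma>)" if "y \<in> copy \<gamma>" for y \<gamma>
      using bounded_linear_from_copy[of \<gamma>] that unfolding bounded_linear_between_def by auto
    show "grid_embed dims (exponent \<alpha>) (coefficients dims (grid_embed dims (exponent \<beta>) (coefficients dims y))) = y"
      if "y \<in> copy \<alpha>" for y
      using coeff[OF that] by (simp add: vecs coefficients_of_copy) (rule copy_of_coefficients[OF that])
    show "grid_embed dims (exponent \<beta>) (coefficients dims (grid_embed dims (exponent \<alpha>) (coefficients dims y))) = y"
      if "y \<in> copy \<beta>" for y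
      using coeff[OF that] by (simp add: vecs[symmetric] coefficients_of_copy) (rule copy_of_coefficients[OF that])
  qed (rule c0_copy_add c0_copy_scaleR; assumption)+
  then show ?thesis unfolding isomorphic_nspaces_def by blast
qed

lemma complementably_embeds_copies_imp_H0:
  assumes X0: "\<alpha> \<in> X0" "\<beta> \<in> X0"
    and "complementably_embeds (as_nspace (copy \<alpha>)) (as_nspace (copy \<beta>))"
  shows "(\<alpha>, \<beta>) \<in> H0"
proof -
  obtain T S where T: "bounded_linear_between (as_nspace (copy \<alpha>)) (as_nspace (copy \<beta>)) T"
    and S: "bounded_linear_between (as_nspace (copy \<beta>)) (as_nspace (copy \<alpha>)) S"
    and ST: "\<And>x. x \<in> copy \<alpha> \<Longrightarrow> S (T x) = x"
    by (rule complementably_embeds_factorization[OF assms(3)]) auto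
  let ?T = "\<lambda>x. coefficients dims (T (grid_embed dims (exponent \<alpha>) x))"
  let ?S = "\<lambda>x. coefficients dims (S (grid_embed dims (exponent \<beta>) x))"
  have T': "bounded_linear_between (sum_space \<alpha>) (sum_space \<beta>) ?T"
    by (rule bounded_linear_between_compose[OF
          bounded_linear_between_compose[OF bounded_linear_into_copy T] bounded_linear_from_copy]) auto
  have S': "bounded_linear_between (sum_space \<beta>) (sum_space \<alpha>) ?S"
    by (rule bounded_linear_between_compose[OF
          bounded_linear_between_compose[OF bounded_linear_into_copy S] bounded_linear_from_copy]) auto
  have "?S (?T x) = x" if x: "x \<in> vecs (sum_space \<alpha>)" for x
  proof -
    have e: "grid_embed dims (exponent \<alpha>) x \<in> copy \<alpha>"
      using bounded_linear_into_copy[of \<alpha>] x unfolding bounded_linear_between_def by auto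
    then have "T (grid_embed dims (exponent \<alpha>) x) \<in> copy \<beta>"
      using T unfolding bounded_linear_between_def by auto
    then show ?thesis using coefficients_of_copy[OF x] by (simp add: copy_of_coefficients ST[OF e])
  qed
  then show ?thesis by (rule factorization_imp_H0[OF X0 T' S'])
qed

lemma H0_iff_copies:
  assumes "\<alpha> \<in> X0" "\<beta> \<in> X0"
  shows "(\<alpha>, \<beta>) \<in> H0 \<longleftrightarrow> (copy \<alpha>, copy \<beta>) \<in> isomorphism_rel c0"
    and "(\<alpha>, \<beta>) \<in> H0 \<longleftrightarrow> (copy \<alpha>, copy \<beta>) \<in> complemented_embed_rel c0"
proof -
  have "isomorphic_nspaces (as_nspace (copy \<alpha>)) (as_nspace (copy \<beta>)) \<Longrightarrow>
      complementably_embeds (as_nspace (copy \<alpha>)) (as_nspace (copy \<beta>))"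
    by (rule isomorphic_imp_complementably_embeds)
  note * = this H0_imp_isomorphic_copies[of \<alpha> \<beta>] complementably_embeds_copies_imp_H0[OF assms]
  show "(\<alpha>, \<beta>) \<in> H0 \<longleftrightarrow> (copy \<alpha>, copy \<beta>) \<in> isomorphism_rel c0"
    using * by (auto simp: isomorphism_rel_def c0_copy_closed_subspace)
  show "(\<alpha>, \<beta>) \<in> H0 \<longleftrightarrow> (copy \<alpha>, copy \<beta>) \<in> complemented_embed_rel c0"
    using * by (auto simp: complemented_embed_rel_def c0_copy_closed_subspace)
qed

lemma space_borel_of_topology: "space (borel_of_topology X) = topspace X"
  unfolding borel_of_topology_def by (rule space_measure_of) (auto dest: openin_subset)

text \<open>
  Truncations of vectors of the copy approximate them and stay in it. So the copy for $f(x)$ meets an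
  open set $U$ if and only if, for some $N$, a vector truncated to the first $N$ blocks is in $U$. That
  depends on finitely many values $f(x)(n)$ only, for which there are finitely many possibilities.
\<close>
lemma copy_measurable:
  assumes f: "\<And>x. f x \<in> X0"
    and meas: "\<And>n c. 1 \<le> n \<Longrightarrow> {x \<in> topspace X. f x n = c} \<in> sets (borel_of_topology X)"
  shows "(\<lambda>x. copy (f x)) \<in> measurable (borel_of_topology X) (Effros_borel c0)"
  unfolding Effros_borel_def
proof (rule measurable_measure_of)
  show "{{F \<in> closed_subspaces c0. F \<inter> U \<noteq> {}} |U. open U} \<subseteq> Pow (closed_subspaces (c0 :: (nat \<Rightarrow>\<^sub>C real) set))"
    by auto
  show "(\<lambda>x. copy (f x)) \<in> space (borel_of_topology X) \<rightarrow> closed_subspaces c0"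
    by (simp add: c0_copy_closed_subspace)
  fix A assume "A \<in> {{F \<in> closed_subspaces c0. F \<inter> U \<noteq> {}} |U. open U}"
  then obtain U :: "(nat \<Rightarrow>\<^sub>C real) set" where U: "open U" and A: "A = {F \<in> closed_subspaces c0. F \<inter> U \<noteq> {}}"
    by blast
  \<comment> \<open>The initial segments of length \<open>N\<close> whose copies contain a vector of \<open>U\<close> living on the first \<open>N\<close> blocks.\<close>
  define W where "W N = {\<sigma> \<in> (\<Pi>\<^sub>E n\<in>{1..N}. {..<n}). \<exists>y\<in>copy \<sigma>. truncate N y \<in> U}" for N :: nat
  have finW: "finite (W N)" for N
    unfolding W_def by (rule finite_subset[of _ "\<Pi>\<^sub>E n\<in>{1..N}. {..<n}"]) (auto intro: finite_PiE)
  let ?E = "\<lambda>N \<sigma>. topspace X - (\<Union>n\<in>{1..N}. topspace X - {x \<in> topspace X. f x n = \<sigma> n})"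
  have top: "topspace X \<in> sets (borel_of_topology X)"
    using sets.top[of "borel_of_topology X"] by (simp add: space_borel_of_topology)
  have E: "?E N \<sigma> \<in> sets (borel_of_topology X)" for N \<sigma>
  proof -
    have "(\<Union>n\<in>{1..N}. topspace X - {x \<in> topspace X. f x n = \<sigma> n}) \<in> sets (borel_of_topology X)"
      by (rule sets.finite_UN) (auto intro!: sets.Diff top meas)
    then show ?thesis by (rule sets.Diff[OF top])
  qed
  have Emem: "x \<in> ?E N \<sigma> \<longleftrightarrow> x \<in> topspace X \<and> (\<forall>n\<in>{1..N}. f x n = \<sigma> n)" for x N \<sigma> by auto
  have "(\<lambda>x. copy (f x)) -` A \<inter> space (borel_of_topology X) = (\<Union>N. \<Union>\<sigma>\<in>W N. ?E N \<sigma>)"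
  proof (intro equalityI subsetI)
    fix x assume "x \<in> (\<lambda>x. copy (f x)) -` A \<inter> space (borel_of_topology X)"
    then have x: "x \<in> topspace X" and "copy (f x) \<inter> U \<noteq> {}" by (auto simp: A space_borel_of_topology)
    then obtain y where y: "y \<in> copy (f x)" "y \<in> U" by blast
    obtain e where e: "0 < e" "\<And>z. dist z y < e \<Longrightarrow> z \<in> U"
      using U y(2) unfolding open_dist by blast
    have "y \<in> c0" using y(1) by (simp add: c0_copy_def)
    then obtain N where "dist (truncate N y) y \<le> e / 2"
      by (rule truncate_approximates[OF _ half_gt_zero[OF e(1)]])
    then have yU: "truncate N y \<in> U" using e by (intro e(2)) linarith
    define \<sigma> where "\<sigma> = restrict (f x) {1..N}"
    have agree: "exponent (f x) n = exponent \<sigma> n" if "n \<in> {1..N}" for n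
      using that by (simp add: \<sigma>_def exponent_def)
    have "truncate N y \<in> copy \<sigma>" by (rule truncate_c0_copy_local[OF agree y(1)])
    moreover have "truncate N (truncate N y) = truncate N y"
      by (rule bcontfun_eqI) (simp add: apply_truncate)
    ultimately have "\<exists>y\<in>copy \<sigma>. truncate N y \<in> U" using yU by metis
    moreover have "\<sigma> \<in> (\<Pi>\<^sub>E n\<in>{1..N}. {..<n})"
      using X0_less[OF f[of x]] by (auto simp: \<sigma>_def)
    ultimately have "\<sigma> \<in> W N" by (simp add: W_def)
    moreover have "x \<in> ?E N \<sigma>" unfolding Emem using x by (simp add: \<sigma>_def)
    ultimately show "x \<in> (\<Union>N. \<Union>\<sigma>\<in>W N. ?E N \<sigma>)" by blast
  next
    fix x assume "x \<in> (\<Union>N. \<Union>\<sigma>\<in>W N. ?E N \<sigma>)"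
    then obtain N \<sigma> where \<sigma>: "\<sigma> \<in> W N" "x \<in> ?E N \<sigma>" by blast
    then obtain y where y: "y \<in> copy \<sigma>" "truncate N y \<in> U" by (auto simp: W_def)
    have x: "x \<in> topspace X" "\<forall>n\<in>{1..N}. f x n = \<sigma> n" using \<sigma>(2) unfolding Emem by blast+
    have agree: "exponent \<sigma> n = exponent (f x) n" if "n \<in> {1..N}" for n
      using that x(2) by (simp add: exponent_def)
    have "truncate N y \<in> copy (f x)" by (rule truncate_c0_copy_local[OF agree y(1)])
    then show "x \<in> (\<lambda>x. copy (f x)) -` A \<inter> space (borel_of_topology X)"
      using x y(2) c0_copy_closed_subspace by (auto simp: A space_borel_of_topology)
  qed
  moreover have "(\<Union>N. \<Union>\<sigma>\<in>W N. ?E N \<sigma>) \<in> sets (borel_of_topology X)"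
    by (intro sets.countable_UN image_subsetI sets.finite_UN finW E)
  ultimately show "(\<lambda>x. copy (f x)) -` A \<inter> space (borel_of_topology X) \<in> sets (borel_of_topology X)" by simp
qed

lemma Ksigma_equiv_reduces_to_subspaces:
  assumes "Ksigma_equiv X R"
  shows "borel_reducible (borel_of_topology X) R (Effros_borel c0) (isomorphism_rel c0) \<and>
    borel_reducible (borel_of_topology X) R (Effros_borel c0) (complemented_embed_rel c0)"
proof (rule Ksigma_equiv_reduces_to_H0[OF assms])
  fix f
  assume f: "\<And>x. f x \<in> X0"
    and meas: "\<And>n c. 1 \<le> n \<Longrightarrow> {x \<in> topspace X. f x n = c} \<in> sets (borel_of_topology X)"
    and H0: "\<And>x y. x \<in> topspace X \<Longrightarrow> y \<in> topspace X \<Longrightarrow> (x, y) \<in> R \<longleftrightarrow> (f x, f y) \<in> H0"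
  have m: "(\<lambda>x. copy (f x)) \<in> measurable (borel_of_topology X) (Effros_borel c0)"
    by (rule copy_measurable[OF f meas])
  show ?thesis
    unfolding borel_reducible_def space_borel_of_topology
  proof (intro conjI bexI[OF _ m] ballI)
    fix x y assume xy: "x \<in> topspace X" "y \<in> topspace X"
    show "(x, y) \<in> R \<longleftrightarrow> (copy (f x), copy (f y)) \<in> isomorphism_rel c0"
      unfolding H0[OF xy] by (rule H0_iff_copies(1)[OF f f])
    show "(x, y) \<in> R \<longleftrightarrow> (copy (f x), copy (f y)) \<in> complemented_embed_rel c0"
      unfolding H0[OF xy] by (rule H0_iff_copies(2)[OF f f])
  qed
qed

theorem theorem3p3:
  shows "(\<forall>(X :: 'a topology) R. is_E_Ksigma X R \<longrightarrow>
            borel_reducible (borel_of_topology X) R (Effros_borel c0) (isomorphism_rel c0) \<and>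
            borel_reducible (borel_of_topology X) R (Effros_borel c0) (complemented_embed_rel c0)) \<and>
         (\<exists>(K :: nat \<Rightarrow> nat) (p :: nat \<Rightarrow> real).
            (\<forall>n\<ge>1. 2 \<le> K n) \<and> (\<forall>n\<ge>1. 1 < p n) \<and>
            (\<forall>\<alpha>\<in>X0. \<forall>\<beta>\<in>X0.
               ((\<alpha>, \<beta>) \<in> H0 \<longleftrightarrow> canonical_bases_equivalent K (c0_lp K p \<alpha>) (c0_lp K p \<beta>)) \<and>
               ((\<alpha>, \<beta>) \<in> H0 \<longleftrightarrow> isomorphic_nspaces (c0_lp K p \<alpha>) (c0_lp K p \<beta>)) \<and>
               ((\<alpha>, \<beta>) \<in> H0 \<longleftrightarrow> complementably_embeds (c0_lp K p \<alpha>) (c0_lp K p \<beta>))))"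
proof (rule conjI)
  show "\<forall>(X :: 'a topology) R. is_E_Ksigma X R \<longrightarrow>
            borel_reducible (borel_of_topology X) R (Effros_borel c0) (isomorphism_rel c0) \<and>
            borel_reducible (borel_of_topology X) R (Effros_borel c0) (complemented_embed_rel c0)"
    unfolding is_E_Ksigma_def using Ksigma_equiv_reduces_to_subspaces by blast
  have p: "1 < base_exponent n" for n
    by (simp add: base_exponent_def add_pos_nonneg)
  show "\<exists>(K :: nat \<Rightarrow> nat) (p :: nat \<Rightarrow> real).
            (\<forall>n\<ge>1. 2 \<le> K n) \<and> (\<forall>n\<ge>1. 1 < p n) \<and>
            (\<forall>\<alpha>\<in>X0. \<forall>\<beta>\<in>X0.
               ((\<alpha>, \<beta>) \<in> H0 \<longleftrightarrow> canonical_bases_equivalent K (c0_lp K p \<alpha>) (c0_lp K p \<beta>)) \<and>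
               ((\<alpha>, \<beta>) \<in> H0 \<longleftrightarrow> isomorphic_nspaces (c0_lp K p \<alpha>) (c0_lp K p \<beta>)) \<and>
               ((\<alpha>, \<beta>) \<in> H0 \<longleftrightarrow> complementably_embeds (c0_lp K p \<alpha>) (c0_lp K p \<beta>)))"
    by (rule exI[of _ dims], rule exI[of _ base_exponent])
       (intro conjI allI impI ballI dims_ge_2 p c0_lp_equivalences)
qed

end
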